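(* Let $f: X\to S$ be a lagrangian fibration on an irreducible symplectic manifold $X$, and assume that $X$ and $S$ are both projective varieties (over $\mathbf{C}$). Let $s$ be a point of $S$ such that $f$ has local holomorphic sections around $s$. Then $S$ is smooth over $\mathbf{C}$ at $s$.
   Context: An irreducible symplectic manifold is a simply connected compact Kähler manifold $X$ such that $H^0(X,\Omega^2_X)$ is spanned by an everywhere non-degenerate (closed) holomorphic $2$-form $\Psi$. A lagrangian fibration on $X$ is a surjective morphism $f: X\to S$ with connected fibers onto a normal base $S$, with $0<\dim S<\dim X$, whose general fiber is a lagrangian submanifold of $X$ with respect to $\Psi$ (that is, $\Psi$ restricts to zero on it and its dimension is $\frac12\dim X$). "$f$ has local holomorphic sections around $s$" means that there are an open neighborhood $V$ of $s$ in $S$ for the analytic topology and a holomorphic map $\sigma: V\to X$ with $f\circ\sigma$ equal to the inclusion $V\hookrightarrow S$. *)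

theory Defs
  imports "HOL-Analysis.Analysis"
begin

section \<open>Complex projective space\<close>

definition proportional :: "complex ^ 'm \<Rightarrow> complex ^ 'm \<Rightarrow> bool" where
  "proportional x y \<longleftrightarrow> x \<noteq> 0 \<and> y \<noteq> 0 \<and> (\<exists>c. c \<noteq> 0 \<and> y = c *s x)"

text \<open>The type \<open>'m proj\<close> is the projective space of lines in \<open>complex ^ 'm\<close>, of dimension
  \<open>CARD('m) - 1\<close>. The class \<open>proj_class z\<close> is meaningful only for \<open>z \<noteq> 0\<close>.\<close>

quotient_type 'm proj = "complex ^ ('m::finite)" / partial: "proportional"
  morphisms rep_proj proj_class
proof (rule part_equivpI)
  have "proportional (1 :: complex ^ 'm) 1"
    unfolding proportional_def by (auto intro!: exI[of _ 1] simp: vec_eq_iff)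
  then show "\<exists>x :: complex ^ 'm. proportional x x" ..
  show "symp (proportional :: complex ^ 'm \<Rightarrow> _)"
  proof (rule sympI)
    fix x y :: "complex ^ 'm" assume "proportional x y"
    then obtain c where "x \<noteq> 0" "y \<noteq> 0" "c \<noteq> 0" "y = c *s x"
      unfolding proportional_def by auto
    then show "proportional y x"
      unfolding proportional_def by (auto intro!: exI[of _ "inverse c"])
  qed
  show "transp (proportional :: complex ^ 'm \<Rightarrow> _)"
  proof (rule transpI)
    fix x y z :: "complex ^ 'm" assume "proportional x y" "proportional y z"
    then obtain c d where "x \<noteq> 0" "z \<noteq> 0" "c \<noteq> 0" "d \<noteq> 0" "y = c *s x" "z = d *s y"
      unfolding proportional_def by auto
    then show "proportional x z"
      unfolding proportional_def by (auto intro!: exI[of _ "d * c"])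
  qed
qed

definition proj_cone :: "('m::finite) proj set \<Rightarrow> (complex ^ 'm) set" where
  "proj_cone W = {z. z \<noteq> 0 \<and> proj_class z \<in> W}"

instantiation proj :: (finite) topological_space
begin

text \<open>The classical (analytic) topology, as a quotient of the nonzero vectors.\<close>

definition open_proj :: "'a proj set \<Rightarrow> bool" where
  "open_proj W \<longleftrightarrow> open (proj_cone W)"

instance
proof
  have "proj_cone (UNIV :: 'a proj set) = - {0}"
    by (auto simp: proj_cone_def)
  then show "open (UNIV :: 'a proj set)"
    by (simp add: open_proj_def open_Compl)
next
  fix S T :: "'a proj set"
  assume "open S" "open T"
  moreover have "proj_cone (S \<inter> T) = proj_cone S \<inter> proj_cone T"
    by (auto simp: proj_cone_def)
  ultimately show "open (S \<inter> T)"
    by (simp add: open_proj_def open_Int)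
next
  fix K :: "'a proj set set"
  assume "\<forall>S\<in>K. open S"
  moreover have "proj_cone (\<Union>K) = (\<Union>S\<in>K. proj_cone S)"
    by (auto simp: proj_cone_def)
  ultimately show "open (\<Union>K)"
    by (auto simp: open_proj_def intro!: open_UN)
qed

end


section \<open>Projective varieties\<close>

text \<open>Polynomial functions with complex coefficients in the coordinates.\<close>

inductive complex_poly :: "(complex ^ 'm \<Rightarrow> complex) \<Rightarrow> bool" where
  "complex_poly (\<lambda>z. a)"
| "complex_poly (\<lambda>z. z $ i)"
| "complex_poly F \<Longrightarrow> complex_poly G \<Longrightarrow> complex_poly (\<lambda>z. F z + G z)"
| "complex_poly F \<Longrightarrow> complex_poly G \<Longrightarrow> complex_poly (\<lambda>z. F z * G z)"

definition homogeneous_poly :: "(complex ^ 'm \<Rightarrow> complex) \<Rightarrow> bool" where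
  "homogeneous_poly F \<longleftrightarrow> complex_poly F \<and> (\<exists>k. \<forall>c z. F (c *s z) = c ^ k * F z)"

definition zariski_closed :: "('m::finite) proj set \<Rightarrow> bool" where
  "zariski_closed Z \<longleftrightarrow>
     (\<exists>\<F>. (\<forall>F\<in>\<F>. homogeneous_poly F) \<and>
          Z = {p. \<forall>F\<in>\<F>. \<forall>z. z \<noteq> 0 \<and> proj_class z = p \<longrightarrow> F z = 0})"

definition projective_variety :: "('m::finite) proj set \<Rightarrow> bool" where
  "projective_variety Z \<longleftrightarrow>
     zariski_closed Z \<and> Z \<noteq> {} \<and>
     (\<forall>Z1 Z2. zariski_closed Z1 \<and> zariski_closed Z2 \<and> Z \<subseteq> Z1 \<union> Z2 \<longrightarrow> Z \<subseteq> Z1 \<or> Z \<subseteq> Z2)"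

text \<open>Krull dimension: the largest length of a chain of irreducible closed subsets.\<close>

definition variety_dim :: "('m::finite) proj set \<Rightarrow> nat" where
  "variety_dim Z =
     (GREATEST n. \<exists>C. (\<forall>i\<le>n. projective_variety (C i) \<and> C i \<subseteq> Z) \<and>
                      (\<forall>i<n. C i \<subset> C (Suc i)))"

text \<open>The standard affine open subset of \<open>Z\<close> where the \<open>i\<close>-th coordinate does not vanish, as a
  closed algebraic subset of the affine space \<open>complex ^ 'm\<close> lying in the hyperplane \<open>x $ i = 1\<close>.\<close>

definition affine_part :: "'m \<Rightarrow> ('m::finite) proj set \<Rightarrow> (complex ^ 'm) set" where
  "affine_part i Z = {x. x $ i = 1 \<and> proj_class x \<in> Z}"

definition vanishing_ideal :: "(complex ^ 'm) set \<Rightarrow> (complex ^ 'm \<Rightarrow> complex) set" where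
  "vanishing_ideal Y = {F. complex_poly F \<and> (\<forall>y\<in>Y. F y = 0)}"

text \<open>An integral affine variety \<open>Y\<close> is normal at \<open>x\<close> if its local ring at \<open>x\<close> (fractions
  \<open>P / Q\<close> with \<open>Q x \<noteq> 0\<close>) is integrally closed in the function field of \<open>Y\<close>: every fraction
  \<open>F / G\<close> that is a root of a monic polynomial with coefficients \<open>a i / b i\<close> in the local ring
  belongs to the local ring. Equality of rational functions is equality wherever the
  denominators do not vanish.\<close>

definition affine_normal_at :: "(complex ^ 'm) set \<Rightarrow> complex ^ 'm \<Rightarrow> bool" where
  "affine_normal_at Y x \<longleftrightarrow>
     (\<forall>F G n a b.
        complex_poly F \<and> complex_poly G \<and> G \<notin> vanishing_ideal Y \<and>
        (\<forall>i<n. complex_poly (a i) \<and> complex_poly (b i) \<and> b i x \<noteq> 0) \<and>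
        (\<forall>y\<in>Y. G y \<noteq> 0 \<and> (\<forall>i<n. b i y \<noteq> 0) \<longrightarrow>
           (F y / G y) ^ n + (\<Sum>i<n. (a i y / b i y) * (F y / G y) ^ i) = 0) \<longrightarrow>
        (\<exists>P Q. complex_poly P \<and> complex_poly Q \<and> Q x \<noteq> 0 \<and>
           (\<forall>y\<in>Y. G y \<noteq> 0 \<and> Q y \<noteq> 0 \<longrightarrow> F y / G y = P y / Q y)))"

definition normal_variety :: "('m::finite) proj set \<Rightarrow> bool" where
  "normal_variety S \<longleftrightarrow> (\<forall>i. \<forall>x \<in> affine_part i S. affine_normal_at (affine_part i S) x)"

definition gradient :: "(complex ^ 'm \<Rightarrow> complex) \<Rightarrow> complex ^ 'm \<Rightarrow> complex ^ 'm" where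
  "gradient F x = (\<chi> j. frechet_derivative F (at x) (axis j 1))"

text \<open>Jacobian criterion on each standard affine chart around \<open>p\<close>: the rank at the point of the
  Jacobian matrix of the ideal of the chart is the codimension in \<open>complex ^ 'm\<close>.
  Here \<open>vec.dim\<close> is the dimension over the complex numbers.\<close>

definition smooth_at :: "('m::finite) proj set \<Rightarrow> 'm proj \<Rightarrow> bool" where
  "smooth_at S p \<longleftrightarrow>
     p \<in> S \<and>
     (\<forall>i. \<forall>x \<in> affine_part i S. proj_class x = p \<longrightarrow>
        vec.dim ((\<lambda>F. gradient F x) ` vanishing_ideal (affine_part i S)) + variety_dim S
          = CARD('m))"


section \<open>Complex manifolds\<close>

definition holo_fun_on :: "(complex ^ 'd) set \<Rightarrow> (complex ^ 'd \<Rightarrow> complex) \<Rightarrow> bool" where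
  "holo_fun_on W g \<longleftrightarrow>
     open W \<and> (\<forall>z\<in>W. \<exists>a. (g has_derivative (\<lambda>v. \<Sum>j\<in>UNIV. a $ j * v $ j)) (at z))"

definition holo_map_on :: "(complex ^ 'd) set \<Rightarrow> (complex ^ 'd \<Rightarrow> complex ^ 'e) \<Rightarrow> bool" where
  "holo_map_on W g \<longleftrightarrow> (\<forall>i. holo_fun_on W (\<lambda>z. g z $ i))"

type_synonym ('a, 'd) chart = "'a set \<times> ('a \<Rightarrow> complex ^ 'd)"

definition chart_image :: "('a, 'd) chart \<Rightarrow> (complex ^ 'd) set" where
  "chart_image c = snd c ` fst c"

definition chart_param :: "('a, 'd) chart \<Rightarrow> complex ^ 'd \<Rightarrow> 'a" where
  "chart_param c = inv_into (fst c) (snd c)"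

definition overlap :: "('a, 'd) chart \<Rightarrow> ('a, 'd) chart \<Rightarrow> (complex ^ 'd) set" where
  "overlap c c' = snd c ` (fst c \<inter> fst c')"

definition transition :: "('a, 'd) chart \<Rightarrow> ('a, 'd) chart \<Rightarrow> complex ^ 'd \<Rightarrow> complex ^ 'd" where
  "transition c c' = snd c' \<circ> chart_param c"

definition complex_manifold :: "'a topology \<Rightarrow> ('a, 'd::finite) chart set \<Rightarrow> bool" where
  "complex_manifold T A \<longleftrightarrow>
     Hausdorff_space T \<and>
     (\<exists>\<B>. countable \<B> \<and> (\<forall>U\<in>\<B>. openin T U) \<and>
        (\<forall>U x. openin T U \<and> x \<in> U \<longrightarrow> (\<exists>V\<in>\<B>. x \<in> V \<and> V \<subseteq> U))) \<and>
     (\<Union>c\<in>A. fst c) = topspace T \<and>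
     (\<forall>c\<in>A. openin T (fst c) \<and> open (chart_image c) \<and>
        homeomorphic_map (subtopology T (fst c)) (top_of_set (chart_image c)) (snd c)) \<and>
     (\<forall>c\<in>A. \<forall>c'\<in>A. holo_map_on (overlap c c') (transition c c'))"

text \<open>Same as \<open>simply_connected\<close> of the library, for an abstract topology
  (constant loops give path-connectedness).\<close>

definition simply_connected_top :: "'a topology \<Rightarrow> bool" where
  "simply_connected_top T \<longleftrightarrow>
     (\<forall>p q. pathin T p \<and> p 1 = p 0 \<and> pathin T q \<and> q 1 = q 0 \<longrightarrow>
        homotopic_with (\<lambda>r. r 1 = r 0) (top_of_set {0..1}) T p q)"


subsection \<open>Differential 2-forms\<close>

text \<open>A 2-form is given by its expressions \<open>\<omega> c z u v\<close> in the charts \<open>c\<close> of the atlas, at the point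
  with coordinates \<open>z\<close>, on tangent vectors \<open>u\<close>, \<open>v\<close>.\<close>

type_synonym ('a, 'd, 'b) form2 =
  "('a, 'd) chart \<Rightarrow> complex ^ 'd \<Rightarrow> complex ^ 'd \<Rightarrow> complex ^ 'd \<Rightarrow> 'b"

definition form2_on ::
  "('a, 'd::finite) chart set \<Rightarrow> ('a, 'd, 'b::real_normed_vector) form2 \<Rightarrow> bool" where
  "form2_on A \<omega> \<longleftrightarrow>
     (\<forall>c\<in>A. \<forall>z \<in> chart_image c. bilinear (\<omega> c z) \<and> (\<forall>u. \<omega> c z u u = 0)) \<and>
     (\<forall>c\<in>A. \<forall>c'\<in>A. \<forall>z \<in> overlap c c'. \<forall>u v.
        \<omega> c z u v =
        \<omega> c' (transition c c' z)
          (frechet_derivative (transition c c') (at z) u)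
          (frechet_derivative (transition c c') (at z) v))"

definition closed_form2 ::
  "('a, 'd::finite) chart set \<Rightarrow> ('a, 'd, 'b::real_normed_vector) form2 \<Rightarrow> bool" where
  "closed_form2 A \<omega> \<longleftrightarrow>
     (\<forall>c\<in>A. \<forall>z \<in> chart_image c. \<forall>u v w.
        frechet_derivative (\<lambda>y. \<omega> c y v w) (at z) u
        - frechet_derivative (\<lambda>y. \<omega> c y u w) (at z) v
        + frechet_derivative (\<lambda>y. \<omega> c y u v) (at z) w = 0)"

definition holomorphic_form2 ::
  "('a, 'd::finite) chart set \<Rightarrow> ('a, 'd, complex) form2 \<Rightarrow> bool" where
  "holomorphic_form2 A \<omega> \<longleftrightarrow>
     form2_on A \<omega> \<and>
     (\<forall>c\<in>A. (\<forall>z \<in> chart_image c. \<forall>a u v. \<omega> c z (a *s u) v = a * \<omega> c z u v) \<and>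
            (\<forall>u v. holo_fun_on (chart_image c) (\<lambda>z. \<omega> c z u v)))"

definition nondegenerate_form2 ::
  "('a, 'd::finite) chart set \<Rightarrow> ('a, 'd, complex) form2 \<Rightarrow> bool" where
  "nondegenerate_form2 A \<omega> \<longleftrightarrow>
     (\<forall>c\<in>A. \<forall>z \<in> chart_image c. \<forall>u. u \<noteq> 0 \<longrightarrow> (\<exists>v. \<omega> c z u v \<noteq> 0))"

primrec cont_diff_on :: "nat \<Rightarrow> (complex ^ 'd) set \<Rightarrow> (complex ^ 'd \<Rightarrow> real) \<Rightarrow> bool" where
  "cont_diff_on 0 W g \<longleftrightarrow> continuous_on W g"
| "cont_diff_on (Suc k) W g \<longleftrightarrow>
     (\<forall>z\<in>W. g differentiable (at z)) \<and>
     (\<forall>v. cont_diff_on k W (\<lambda>z. frechet_derivative g (at z) v))"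

text \<open>A Kaehler form: a smooth closed real form of type (1,1) that is positive.\<close>

definition kaehler_form :: "('a, 'd::finite) chart set \<Rightarrow> ('a, 'd, real) form2 \<Rightarrow> bool" where
  "kaehler_form A \<omega> \<longleftrightarrow>
     form2_on A \<omega> \<and> closed_form2 A \<omega> \<and>
     (\<forall>c\<in>A. \<forall>k u v. cont_diff_on k (chart_image c) (\<lambda>z. \<omega> c z u v)) \<and>
     (\<forall>c\<in>A. \<forall>z \<in> chart_image c.
        (\<forall>u v. \<omega> c z (\<i> *s u) (\<i> *s v) = \<omega> c z u v) \<and>
        (\<forall>u. u \<noteq> 0 \<longrightarrow> \<omega> c z u (\<i> *s u) > 0))"

definition irreducible_symplectic ::
  "'a topology \<Rightarrow> ('a, 'd::finite) chart set \<Rightarrow> ('a, 'd, complex) form2 \<Rightarrow> bool" where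
  "irreducible_symplectic T A \<Psi> \<longleftrightarrow>
     complex_manifold T A \<and> topspace T \<noteq> {} \<and> compact_space T \<and> simply_connected_top T \<and>
     (\<exists>\<omega>. kaehler_form A \<omega>) \<and>
     holomorphic_form2 A \<Psi> \<and> closed_form2 A \<Psi> \<and> nondegenerate_form2 A \<Psi> \<and>
     (\<forall>\<eta>. holomorphic_form2 A \<eta> \<longrightarrow>
        (\<exists>a. \<forall>c\<in>A. \<forall>z \<in> chart_image c. \<forall>u v. \<eta> c z u v = a * \<Psi> c z u v))"


subsection \<open>Lagrangian submanifolds\<close>

definition biholomorphic_on :: "(complex ^ 'd) set \<Rightarrow> (complex ^ 'd \<Rightarrow> complex ^ 'd) \<Rightarrow> bool" where
  "biholomorphic_on W g \<longleftrightarrow>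
     holo_map_on W g \<and> inj_on g W \<and> holo_map_on (g ` W) (inv_into W g)"

definition complex_submanifold ::
  "'a topology \<Rightarrow> ('a, 'd::finite) chart set \<Rightarrow> nat \<Rightarrow> 'a set \<Rightarrow> bool" where
  "complex_submanifold T A k L \<longleftrightarrow>
     closedin T L \<and>
     (\<forall>x\<in>L. \<exists>c\<in>A. \<exists>W g J.
        x \<in> fst c \<and> snd c x \<in> W \<and> W \<subseteq> chart_image c \<and> biholomorphic_on W g \<and> card J = k \<and>
        g ` (W \<inter> snd c ` (L \<inter> fst c)) = {w \<in> g ` W. \<forall>j. j \<notin> J \<longrightarrow> w $ j = 0})"

text \<open>Tangent vectors to \<open>L\<close> at the point with coordinates \<open>z\<close>, as velocities of curves in \<open>L\<close>.\<close>

definition tangent_vectors :: "('a, 'd::finite) chart \<Rightarrow> 'a set \<Rightarrow> complex ^ 'd \<Rightarrow> (complex ^ 'd) set"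
  where
  "tangent_vectors c L z =
     {v. \<exists>\<gamma> :: real \<Rightarrow> complex ^ 'd. \<gamma> 0 = z \<and> (\<forall>t. \<gamma> t \<in> snd c ` (L \<inter> fst c)) \<and>
           (\<gamma> has_vector_derivative v) (at 0)}"

definition lagrangian_submanifold ::
  "'a topology \<Rightarrow> ('a, 'd::finite) chart set \<Rightarrow> ('a, 'd, complex) form2 \<Rightarrow> 'a set \<Rightarrow> bool" where
  "lagrangian_submanifold T A \<Psi> L \<longleftrightarrow>
     (\<exists>k. 2 * k = CARD('d) \<and> complex_submanifold T A k L) \<and>
     (\<forall>c\<in>A. \<forall>z \<in> snd c ` (L \<inter> fst c). \<forall>u \<in> tangent_vectors c L z. \<forall>v \<in> tangent_vectors c L z.
        \<Psi> c z u v = 0)"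


section \<open>Holomorphic maps to and from projective varieties\<close>

text \<open>\<open>F\<close> expresses \<open>f\<close> in homogeneous coordinates over the open subset \<open>W\<close> of the chart \<open>c\<close>.\<close>

definition local_lift ::
  "('a, 'd::finite) chart \<Rightarrow> (complex ^ 'd) set \<Rightarrow> (complex ^ 'd \<Rightarrow> complex ^ 'm) \<Rightarrow>
   ('a \<Rightarrow> ('m::finite) proj) \<Rightarrow> bool" where
  "local_lift c W F f \<longleftrightarrow>
     W \<subseteq> chart_image c \<and> holo_map_on W F \<and>
     (\<forall>z\<in>W. F z \<noteq> 0 \<and> f (chart_param c z) = proj_class (F z))"

definition holomorphic_to_proj ::
  "'a topology \<Rightarrow> ('a, 'd::finite) chart set \<Rightarrow> ('a \<Rightarrow> ('m::finite) proj) \<Rightarrow> bool" where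
  "holomorphic_to_proj T A f \<longleftrightarrow>
     (\<forall>x \<in> topspace T. \<exists>c\<in>A. \<exists>W F. x \<in> fst c \<and> snd c x \<in> W \<and> local_lift c W F f)"

text \<open>A realization of the compact manifold as a projective variety: an injective holomorphic
  immersion onto a projective variety. The differential of \<open>f\<close> at \<open>z\<close> kills \<open>v\<close> iff the
  derivative of a lift \<open>F\<close> in direction \<open>v\<close> is a multiple of \<open>F z\<close>.\<close>

definition projective_embedding ::
  "'a topology \<Rightarrow> ('a, 'd::finite) chart set \<Rightarrow> ('a \<Rightarrow> ('n::finite) proj) \<Rightarrow> bool" where
  "projective_embedding T A f \<longleftrightarrow>
     holomorphic_to_proj T A f \<and> inj_on f (topspace T) \<and>
     (\<forall>c\<in>A. \<forall>W F. local_lift c W F f \<longrightarrow>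
        (\<forall>z\<in>W. \<forall>v a. frechet_derivative F (at z) v = a *s F z \<longrightarrow> v = 0)) \<and>
     projective_variety (f ` topspace T)"

text \<open>A holomorphic map from a locally closed analytic subset \<open>V\<close> of projective space, with its
  reduced structure, to the manifold: locally, in a chart, it is the restriction of a
  holomorphic map \<open>G\<close> defined on an open subset \<open>W\<close> of projective space.\<close>

definition holomorphic_from_proj ::
  "('a, 'd::finite) chart set \<Rightarrow> ('m::finite) proj set \<Rightarrow> ('m proj \<Rightarrow> 'a) \<Rightarrow> bool" where
  "holomorphic_from_proj A V \<sigma> \<longleftrightarrow>
     (\<forall>p\<in>V. \<exists>c\<in>A. \<exists>W G.
        open W \<and> p \<in> W \<and> holo_map_on (proj_cone W) (\<lambda>z. G (proj_class z)) \<and>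
        (\<forall>q \<in> V \<inter> W. \<sigma> q \<in> fst c \<and> snd c (\<sigma> q) = G q))"

definition has_local_sections ::
  "('a, 'd::finite) chart set \<Rightarrow> ('a \<Rightarrow> ('m::finite) proj) \<Rightarrow> 'm proj set \<Rightarrow> 'm proj \<Rightarrow> bool" where
  "has_local_sections A f S s \<longleftrightarrow>
     (\<exists>V \<sigma>. openin (top_of_set S) V \<and> s \<in> V \<and> holomorphic_from_proj A V \<sigma> \<and>
            (\<forall>p\<in>V. f (\<sigma> p) = p))"

text \<open>``General'' refers to the complement of a proper Zariski closed subset of the base.\<close>

definition lagrangian_fibration ::
  "'a topology \<Rightarrow> ('a, 'd::finite) chart set \<Rightarrow> ('a, 'd, complex) form2 \<Rightarrow>
   ('a \<Rightarrow> ('m::finite) proj) \<Rightarrow> 'm proj set \<Rightarrow> bool" where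
  "lagrangian_fibration T A \<Psi> f S \<longleftrightarrow>
     normal_variety S \<and> 0 < variety_dim S \<and> variety_dim S < CARD('d) \<and>
     holomorphic_to_proj T A f \<and> f ` topspace T = S \<and>
     (\<forall>t\<in>S. connectedin T {x \<in> topspace T. f x = t}) \<and>
     (\<exists>Z. zariski_closed Z \<and> \<not> S \<subseteq> Z \<and>
        (\<forall>t \<in> S - Z. lagrangian_submanifold T A \<Psi> {x \<in> topspace T. f x = t}))"

end

theory Submission
  imports Defs "HOL-Complex_Analysis.Complex_Analysis"
    "HOL-Computational_Algebra.Fundamental_Theorem_Algebra"
begin

no_notation fps_nth (infixl "$" 75)

text \<open>A local section \<open>\<sigma>\<close> makes \<open>f \<circ> \<sigma>\<close> the identity near \<open>s\<close>. Written with homogeneous lifts on the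
  cone \<open>Z\<close> over \<open>S\<close>, the same composite in the ambient space is a holomorphic map \<open>\<rho>\<close> into \<open>Z\<close>,
  defined near a representative \<open>p\<close> of \<open>s\<close> and fixing \<open>Z\<close>; so \<open>Z\<close> is a holomorphic retract, hence a
  manifold, near \<open>p\<close>, with tangent space the range of the idempotent \<open>D = \<rho>'(p)\<close>. The symplectic
  structure plays no further role.

  To pass from the analytic to the algebraic tangent space one projects \<open>Z\<close> linearly onto the
  tangent space along a complement \<open>N\<close> of it with \<open>N \<inter> Z = 0\<close>. This projection is
  finite, and it is injective on \<open>Z\<close> near \<open>p\<close>. For a linear form \<open>w\<close> separating \<open>p\<close> from the rest of its
  fibre, consider the minimal polynomial \<open>P\<close> of \<open>w\<close> over the polynomials on the target. Every root of
  \<open>P\<close> is a value of \<open>w\<close> on the fibre and \<open>P\<close> is generically squarefree, so a multiple root at \<open>p\<close>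
  would produce two nearby points of \<open>Z\<close> with the same projection. Hence the root is simple, and the
  gradient of the relation \<open>P = 0\<close> cuts down the algebraic tangent space to the analytic one. The
  Krull dimension is bounded above by projecting chains of cones and bounded below by the Zariski
  closures of linear slices of the manifold.\<close>

section \<open>Linear algebra over the complex numbers\<close>

text \<open>The retraction settles only one half of the tangent space question. A polynomial
  \<open>F\<close> vanishing on \<open>Z\<close> satisfies \<open>F\<close> o \<rho> = 0, so its
  gradient at \<open>p\<close> kills the range of \<open>D\<close>. The converse needs polynomials
  in the ideal whose gradients cut out exactly this range, and an analytic germ supplies none of
  them; this is what the finite projection is for. Working with the cone rather than with
  \<open>S\<close> has two effects. A linear map is finite on \<open>Z\<close> as soon as its kernel
  meets \<open>Z\<close> only in 0, and dimensions are those of linear spaces, one larger than the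
  projective ones. Polynomials on the target are functions on all of \<open>complex ^ 'm\<close>,
  compared only on the range of a square matrix \<open>L\<close>. Integral closedness of their ring,
  which would make the minimal polynomial monic, is replaced by growth estimates and division along
  lines. The complement \<open>N\<close> is the kernel of \<open>L\<close> and is not constructed:
  among the finite projections fixing the range of \<open>D\<close> one of least rank is taken, and
  openness of a dominant projection forces its range to be that of \<open>D\<close>.\<close>

definition dotc :: "complex ^ 'm \<Rightarrow> complex ^ 'm \<Rightarrow> complex" where
  "dotc u v = (\<Sum>i\<in>UNIV. u $ i * v $ i)"

lemma dotc_add_right [simp]: "dotc u (v + w) = dotc u v + dotc u w"
  and dotc_add_left [simp]: "dotc (u + w) v = dotc u v + dotc w v"
  and dotc_diff_right [simp]: "dotc u (v - w) = dotc u v - dotc u w"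
  and dotc_scale_right [simp]: "dotc u (c *s v) = c * dotc u v"
  and dotc_scale_left [simp]: "dotc (c *s u) v = c * dotc u v"
  and dotc_zero_right [simp]: "dotc u 0 = 0"
  and dotc_zero_left [simp]: "dotc 0 u = 0"
  by (simp_all add: dotc_def algebra_simps sum.distrib sum_subtractf sum_distrib_left)

lemma dotc_axis [simp]: "dotc (axis i 1) v = v $ i"
  by (simp add: dotc_def axis_def if_distrib[of "\<lambda>x. x * _"] cong: if_cong)

lemma norm_dotc_le: "norm (dotc u v) \<le> (\<Sum>i\<in>UNIV. norm (u $ i)) * norm v"
proof -
  have "norm (dotc u v) \<le> (\<Sum>i\<in>UNIV. norm (u $ i * v $ i))"
    unfolding dotc_def by (rule norm_sum)
  also have "\<dots> \<le> (\<Sum>i\<in>UNIV. norm (u $ i) * norm v)"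
    by (intro sum_mono) (simp add: norm_mult mult_left_mono Finite_Cartesian_Product.norm_nth_le)
  finally show ?thesis by (simp add: sum_distrib_right)
qed

lemma norm_vector_scale: "norm (c *s (v :: complex ^ 'm)) = norm c * norm v"
  by (simp add: norm_vec_def norm_mult L2_set_right_distrib)

lemma linear_dotc: "linear (dotc u)"
  by (rule linearI) (simp_all add: dotc_def algebra_simps sum.distrib scaleR_sum_right)

lemma bounded_linear_dotc: "bounded_linear (dotc u)"
  using linear_dotc by (simp add: linear_conv_bounded_linear)

lemma separating_functional:
  assumes "vec.subspace W" "x \<notin> W"
  obtains u :: "complex ^ 'm" where "\<And>w. w \<in> W \<Longrightarrow> dotc u w = 0" "dotc u x = 1"
proof -
  obtain B where B: "B \<subseteq> W" "vec.independent B" "W \<subseteq> vec.span B" "card B = vec.dim W"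
    by (rule vec.basis_exists)
  have WB: "vec.span B = W"
    using vec.span_subspace[OF B(1,3) assms(1)] .
  then have "vec.independent (insert x B)"
    using B assms(2) by (simp add: vec.independent_insert)
  \<comment> \<open>The extension is vector valued; with the all-ones vector as its value at
    \<open>x\<close>, any coordinate \<open>k\<close> of it can serve as the scalar
    functional.\<close>
  from vec.linear_independent_extend[OF this, of "\<lambda>y. if y = x then (1 :: complex ^ 'm) else 0"]
  obtain f :: "complex ^ 'm \<Rightarrow> complex ^ 'm" where lin: "Vector_Spaces.linear (*s) (*s) f"
    and f: "\<And>y. y \<in> insert x B \<Longrightarrow> f y = (if y = x then 1 else 0)" by blast
  interpret l: Vector_Spaces.linear "(*s)" "(*s)" f by (rule lin)
  obtain k :: 'm where True by blast
  define u where "u = (\<chi> i. f (axis i 1) $ k)"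
  have fu: "f v $ k = dotc u v" for v
  proof -
    have "v = (\<Sum>i\<in>UNIV. v $ i *s axis i 1)"
      by (simp add: basis_expansion)
    then have "f v = f (\<Sum>i\<in>UNIV. v $ i *s axis i 1)" by simp
    also have "\<dots> = (\<Sum>i\<in>UNIV. v $ i *s f (axis i 1))"
      by (simp add: l.sum l.scale)
    finally show ?thesis by (simp add: u_def dotc_def mult.commute)
  qed
  have "x \<notin> B" using B assms(2) by auto
  have "f w = 0" if "w \<in> W" for w
  proof -
    have "w \<in> vec.span B" using that WB by simp
    then show ?thesis
      by (induction rule: vec.span_induct_alt)
        (use f \<open>x \<notin> B\<close> in \<open>auto simp: l.add l.scale l.zero\<close>)
  qed
  then show thesis
    using that[of u] f[of x] fu by (metis insertI1 one_index zero_index)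
qed

lemma separating_functional_nonzero:
  assumes "x \<noteq> (0 :: complex ^ 'm)"
  obtains u where "dotc u x = 1"
  using separating_functional[of "{0}" x] assms by auto

text \<open>Finitely many proper subspaces do not cover a space over an infinite field. A functional
  good for \<open>X\<close> is perturbed by a multiple of one that does not vanish at the new
  vector; each vector rules out at most one multiple.\<close>

lemma functional_nonzero_on_finite:
  assumes "finite X" "(0 :: complex ^ 'm) \<notin> X"
  shows "\<exists>u. \<forall>x\<in>X. dotc u x \<noteq> 0"
  using assms
proof (induction X rule: finite_induct)
  case (insert v X)
  then obtain u where u: "\<forall>x\<in>X. dotc u x \<noteq> 0" by auto
  obtain u' where u': "dotc u' v = 1"
    using insert.prems separating_functional_nonzero[of v] by auto
  define Bad where "Bad = (\<lambda>x. - dotc u x / dotc u' x) ` insert v X \<union> {0}"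
  have "finite Bad" using insert by (simp add: Bad_def)
  then obtain e where e: "e \<notin> Bad"
    using infinite_UNIV_char_0 by (metis ex_new_if_finite)
  have "dotc (u + e *s u') x \<noteq> 0" if x: "x \<in> insert v X" for x
  proof (cases "dotc u' x = 0")
    case True
    then show ?thesis using x u u' by auto
  next
    case False
    have "e \<noteq> - dotc u x / dotc u' x" using e x by (auto simp: Bad_def)
    then show ?thesis using False by (auto simp: field_simps add_eq_0_iff)
  qed
  then show ?case by blast
qed auto

section \<open>Annihilators and complementary dimensions\<close>

definition annihilator :: "(complex ^ 'm) set \<Rightarrow> (complex ^ 'm) set" where
  "annihilator G = {v. \<forall>g\<in>G. dotc g v = 0}"

lemma subspace_annihilator: "vec.subspace (annihilator G)"
  by (auto simp: annihilator_def vec.subspace_def)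

lemma dotc_commute: "dotc u v = dotc v u"
  by (simp add: dotc_def mult.commute)

lemma annihilator_span: "annihilator (vec.span G) = annihilator G"
proof -
  have "dotc g v = 0" if "v \<in> annihilator G" "g \<in> vec.span G" for v g
    using that(2) by (induction rule: vec.span_induct_alt) (use that(1) in \<open>auto simp: annihilator_def\<close>)
  then show ?thesis by (auto simp: annihilator_def vec.span_base)
qed

lemma dim_kernel_functional:
  assumes A: "vec.subspace A" and u: "u \<in> A" "dotc b u \<noteq> 0"
  shows "vec.dim A = Suc (vec.dim {v \<in> A. dotc b v = 0})"
proof -
  let ?K = "{v \<in> A. dotc b v = 0}"
  have K: "vec.subspace ?K" using A by (auto simp: vec.subspace_def)
  then have uK: "u \<notin> vec.span ?K" using u by (simp add: vec.span_eq_iff[THEN iffD2])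
  have "A \<subseteq> vec.span (insert u ?K)"
  proof
    fix v assume v: "v \<in> A"
    define c where "c = dotc b v / dotc b u"
    have "v - c *s u \<in> ?K"
      using A u v by (auto simp: c_def vec.subspace_diff vec.subspace_scale)
    then have "v - c *s u \<in> vec.span (insert u ?K)" by (simp add: vec.span_base)
    moreover have "c *s u \<in> vec.span (insert u ?K)"
      by (simp add: vec.span_base vec.span_scale)
    ultimately have "(v - c *s u) + c *s u \<in> vec.span (insert u ?K)" by (rule vec.span_add)
    then show "v \<in> vec.span (insert u ?K)" by simp
  qed
  moreover have "vec.span (insert u ?K) \<subseteq> A"
    using A u by (intro vec.span_minimal) auto
  ultimately have "vec.span (insert u ?K) = A" by blast
  then have "vec.dim A = vec.dim (insert u ?K)"
    using vec.dim_span[of "insert u ?K"] by simp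
  then show ?thesis using uK by (simp add: vec.dim_insert)
qed

text \<open>The pairing is bilinear and not positive, so a space may meet its annihilator and no
  orthogonal splitting is at hand. Instead each new independent vector lowers the dimension of the
  annihilator by one, since some \<open>u\<close> kills the earlier vectors but not this
  one.\<close>

lemma dim_annihilator_independent:
  assumes "finite B" "vec.independent (B :: (complex ^ 'm) set)"
  shows "vec.dim (annihilator B) + card B = CARD('m)"
  using assms
proof (induction B rule: finite_induct)
  case empty
  then show ?case by (simp add: annihilator_def vec.dim_UNIV card_cart_basis)
next
  case (insert b B)
  have "b \<notin> vec.span B" "vec.independent B"
    using insert by (auto simp: vec.independent_insert)
  then obtain u where "\<And>w. w \<in> vec.span B \<Longrightarrow> dotc u w = 0" "dotc u b = 1"
    using separating_functional[OF vec.subspace_span] by blast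
  then have "u \<in> annihilator B" "dotc b u \<noteq> 0"
    by (auto simp: annihilator_def dotc_commute[of _ u] vec.span_base)
  from dim_kernel_functional[OF subspace_annihilator this]
  have "vec.dim (annihilator B) = Suc (vec.dim (annihilator (insert b B)))"
    by (simp add: annihilator_def conj_commute cong: conj_cong)
  then show ?case using insert \<open>vec.independent B\<close> by simp
qed

lemma dim_annihilator: "vec.dim (G :: (complex ^ 'm) set) + vec.dim (annihilator G) = CARD('m)"
proof -
  obtain B where B: "B \<subseteq> G" "vec.independent B" "G \<subseteq> vec.span B" "card B = vec.dim G"
    by (rule vec.basis_exists)
  have "vec.span B = vec.span G"
    by (metis B(1,3) subset_antisym vec.span_mono vec.span_span)
  then have "annihilator B = annihilator G" by (metis annihilator_span)
  then show ?thesis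
    using dim_annihilator_independent[of B] B(2,4) vec.finiteI_independent by force
qed

lemma subspace_range_matrix: "vec.subspace (range ((*v) (L :: complex ^ 'm ^ 'm)))"
  unfolding vec.subspace_def
  by (auto simp flip: matrix_vector_right_distrib vector_scalar_commute intro: rev_image_eqI[of 0])

text \<open>The first vector is prescribed because the slices of the tangent space built from such a
  flag have to pass through the point \<open>p\<close>.\<close>

lemma flag_exists:
  assumes T: "vec.subspace T" "b0 \<in> T" "(b0 :: complex ^ 'm) \<noteq> 0"
  shows "k < vec.dim T \<Longrightarrow> \<exists>b. b 0 = b0 \<and> (\<forall>j\<le>k. b j \<in> T \<and> b j \<notin> vec.span (b ` {..<j}))"
proof (induction k)
  case 0
  then show ?case using T by (intro exI[of _ "\<lambda>_. b0"]) auto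
next
  case (Suc k)
  then obtain b where b: "b 0 = b0" "\<forall>j\<le>k. b j \<in> T \<and> b j \<notin> vec.span (b ` {..<j})" by auto
  have "vec.dim (b ` {..k}) \<le> card (b ` {..k})" by (simp add: vec.dim_le_card')
  also have "\<dots> \<le> Suc k" using card_image_le[of "{..k}" b] by simp
  finally have "\<not> T \<subseteq> vec.span (b ` {..k})"
    using Suc.prems vec.dim_mono by (metis leD le_trans)
  then obtain x where x: "x \<in> T" "x \<notin> vec.span (b ` {..k})" by auto
  have im: "(b(Suc k := x)) ` {..<j} = b ` {..<j}" if "j \<le> Suc k" for j
    using that by (intro image_cong) auto
  show ?case
    by (rule exI[of _ "b(Suc k := x)"])
      (use b x im in \<open>auto simp: le_Suc_eq lessThan_Suc_atMost\<close>)
qed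

lemma matrix_vector_bounded:
  obtains C where "C > 0" "\<And>x. norm ((L :: complex ^ 'm ^ 'm) *v x) \<le> C * norm x"
proof -
  have "bounded_linear ((*v) L)" by (rule matrix_vector_mul_bounded_linear)
  then obtain C where "\<And>x. norm (L *v x) \<le> norm x * C" "C > 0"
    using bounded_linear.pos_bounded by blast
  then show thesis using that[of C] by (simp add: mult.commute)
qed

section \<open>Polynomial functions\<close>

lemma complex_poly_sum:
  "(\<And>x. x \<in> X \<Longrightarrow> complex_poly (F x)) \<Longrightarrow> complex_poly (\<lambda>z. \<Sum>x\<in>X. F x z)"
proof (induction X rule: infinite_finite_induct)
  case (insert x X)
  then have "complex_poly (\<lambda>z. F x z + (\<Sum>x\<in>X. F x z))" by (intro complex_poly.intros) auto
  then show ?case using insert by simp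
qed (auto intro: complex_poly.intros)

lemma complex_poly_prod:
  "(\<And>x. x \<in> X \<Longrightarrow> complex_poly (F x)) \<Longrightarrow> complex_poly (\<lambda>z. \<Prod>x\<in>X. F x z)"
proof (induction X rule: infinite_finite_induct)
  case (insert x X)
  then have "complex_poly (\<lambda>z. F x z * (\<Prod>x\<in>X. F x z))" by (intro complex_poly.intros) auto
  then show ?case using insert by simp
qed (auto intro: complex_poly.intros)

lemma complex_poly_power: "complex_poly F \<Longrightarrow> complex_poly (\<lambda>z. F z ^ n)"
  by (induction n) (auto intro: complex_poly.intros)

lemma complex_poly_uminus: "complex_poly F \<Longrightarrow> complex_poly (\<lambda>z. - F z)"
  using complex_poly.intros(4)[OF complex_poly.intros(1)[of "-1"], of F] by simp

lemma complex_poly_diff: "complex_poly F \<Longrightarrow> complex_poly G \<Longrightarrow> complex_poly (\<lambda>z. F z - G z)"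
  using complex_poly.intros(3)[OF _ complex_poly_uminus, of F G] by simp

lemma complex_poly_dotc: "complex_poly (dotc u)"
proof -
  have "complex_poly (\<lambda>z. \<Sum>i\<in>UNIV. u $ i * z $ i)"
    by (intro complex_poly_sum complex_poly.intros)
  then show ?thesis by (simp add: dotc_def[abs_def])
qed

lemmas complex_poly_intros =
  complex_poly.intros complex_poly_sum complex_poly_prod complex_poly_power complex_poly_uminus
  complex_poly_diff complex_poly_dotc

lemma complex_poly_compose:
  assumes "complex_poly F" "\<And>i. complex_poly (\<lambda>z. g z $ i)"
  shows "complex_poly (\<lambda>z. F (g z))"
  using assms(1) by (induction F rule: complex_poly.induct) (auto intro: complex_poly_intros assms(2))

lemma complex_poly_matrix: "complex_poly (\<lambda>z. (L *v z) $ i)"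
  by (auto simp: matrix_vector_mult_def intro!: complex_poly_intros)

lemma complex_poly_compose_matrix: "complex_poly F \<Longrightarrow> complex_poly (\<lambda>z. F (L *v z))"
  by (erule complex_poly_compose) (rule complex_poly_matrix)

lemma complex_poly_translate: "complex_poly F \<Longrightarrow> complex_poly (\<lambda>z. F (z - a))"
  by (erule complex_poly_compose) (auto intro: complex_poly_intros)

lemma continuous_on_complex_poly: "complex_poly F \<Longrightarrow> continuous_on S F"
  by (induction F rule: complex_poly.induct) (auto intro!: continuous_intros)

text \<open>Polynomials in one more variable, seen as univariate over the polynomials in the others.\<close>

definition polyfam :: "(complex ^ 'm \<Rightarrow> complex poly) \<Rightarrow> bool" where
  "polyfam h \<longleftrightarrow> (\<forall>i. complex_poly (\<lambda>q. coeff (h q) i)) \<and> (\<exists>d. \<forall>q. degree (h q) \<le> d)"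

lemma polyfam_coeff: "polyfam h \<Longrightarrow> complex_poly (\<lambda>q. coeff (h q) i)"
  by (simp add: polyfam_def)

lemma polyfam_add:
  assumes "polyfam g" "polyfam h"
  shows "polyfam (\<lambda>q. g q + h q)"
proof -
  obtain d e where "\<forall>q. degree (g q) \<le> d" "\<forall>q. degree (h q) \<le> e"
    using assms by (auto simp: polyfam_def)
  then have "\<forall>q. degree (g q + h q) \<le> max d e"
    by (meson degree_add_le_max le_trans max.mono)
  then show ?thesis using assms by (auto simp: polyfam_def intro: complex_poly_intros)
qed

lemma polyfam_mult:
  assumes "polyfam g" "polyfam h"
  shows "polyfam (\<lambda>q. g q * h q)"
proof -
  obtain d e where "\<forall>q. degree (g q) \<le> d" "\<forall>q. degree (h q) \<le> e"
    using assms by (auto simp: polyfam_def)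
  then have "\<forall>q. degree (g q * h q) \<le> d + e"
    by (meson add_mono degree_mult_le le_trans)
  then show ?thesis using assms
    by (auto simp: polyfam_def coeff_mult intro!: complex_poly_intros)
qed

lemma polyfam_monom:
  assumes "complex_poly F"
  shows "polyfam (\<lambda>q. monom (F q) n)"
proof -
  have "complex_poly (\<lambda>q. if n = i then F q else 0)" for i
    using assms by (cases "n = i") (auto intro: complex_poly.intros)
  then show ?thesis using degree_monom_le by (auto simp: polyfam_def)
qed

lemma polyfam_const: "polyfam (\<lambda>q. p)"
  by (auto simp: polyfam_def intro!: complex_poly_intros)

lemma polyfam_smult: "complex_poly F \<Longrightarrow> polyfam h \<Longrightarrow> polyfam (\<lambda>q. smult (F q) (h q))"
  using polyfam_mult[OF polyfam_monom, of F h 0] by (simp add: monom_0)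

lemma polyfam_diff: "polyfam g \<Longrightarrow> polyfam h \<Longrightarrow> polyfam (\<lambda>q. g q - h q)"
  using polyfam_add[OF _ polyfam_smult[OF complex_poly.intros(1)[of "-1"]], of g h] by simp

lemma polyfam_sum:
  "(\<And>x. x \<in> X \<Longrightarrow> polyfam (h x)) \<Longrightarrow> polyfam (\<lambda>q. \<Sum>x\<in>X. h x q)"
  by (induction X rule: infinite_finite_induct) (auto intro: polyfam_add polyfam_const)

lemma polyfam_pderiv: "polyfam h \<Longrightarrow> polyfam (\<lambda>q. pderiv (h q))"
  by (auto simp: polyfam_def coeff_pderiv degree_pderiv intro!: complex_poly_intros)
    (meson diff_le_self le_trans)

lemma polyfam_compose_matrix: "polyfam h \<Longrightarrow> polyfam (\<lambda>q. h (L *v q))"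
  by (auto simp: polyfam_def intro: complex_poly_compose_matrix)

lemma complex_poly_polyfam:
  assumes "polyfam h" "complex_poly F" 
  shows "complex_poly (\<lambda>q. poly (h q) (F q))"
proof -
  obtain d where d: "\<And>q. degree (h q) \<le> d" using assms by (auto simp: polyfam_def)
  have "poly (h q) (F q) = (\<Sum>i\<le>d. coeff (h q) i * F q ^ i)" for q
    using d[of q] by (subst poly_altdef) (intro sum.mono_neutral_left, auto intro: coeff_eq_0)
  moreover have "complex_poly (\<lambda>q. \<Sum>i\<le>d. coeff (h q) i * F q ^ i)"
    using assms by (auto intro!: complex_poly_intros polyfam_coeff)
  ultimately show ?thesis by simp
qed

text \<open>Restriction to the lines through \<open>a\<close>, with coefficients that are polynomial
  in the direction \<open>v\<close>. It carries the identity theorem, division and the splitting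
  into homogeneous components over from one variable.\<close>

lemma polyfam_on_line:
  assumes "complex_poly F"
  obtains h where "polyfam h" "\<And>v t. F (a + t *s v) = poly (h v) t"
proof -
  have "\<exists>h. polyfam h \<and> (\<forall>v t. F (a + t *s v) = poly (h v) t)"
    using assms
  proof (induction F rule: complex_poly.induct)
    case (1 c)
    then show ?case by (intro exI[of _ "\<lambda>_. [:c:]"]) (auto simp: polyfam_const)
  next
    case (2 i)
    have "polyfam (\<lambda>v. monom (a $ i) 0 + monom (v $ i) 1)"
      by (intro polyfam_add polyfam_monom complex_poly.intros)
    then show ?case by (intro exI[of _ "\<lambda>v. monom (a $ i) 0 + monom (v $ i) 1"])
        (auto simp: poly_monom mult.commute)
  next
    case (3 F G)
    then obtain f g where "polyfam f" "polyfam g" "\<forall>v t. F (a + t *s v) = poly (f v) t"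
      "\<forall>v t. G (a + t *s v) = poly (g v) t" by auto
    then show ?case by (intro exI[of _ "\<lambda>v. f v + g v"]) (auto intro: polyfam_add)
  next
    case (4 F G)
    then obtain f g where "polyfam f" "polyfam g" "\<forall>v t. F (a + t *s v) = poly (f v) t"
      "\<forall>v t. G (a + t *s v) = poly (g v) t" by auto
    then show ?case by (intro exI[of _ "\<lambda>v. f v * g v"]) (auto intro: polyfam_mult)
  qed
  then show thesis using that by blast
qed

lemma poly_zero_on_infinite: "infinite {t. poly p t = 0} \<Longrightarrow> p = (0 :: complex poly)"
  using poly_roots_finite by blast

section \<open>Monomials and the Nullstellensatz\<close>

definition mono_fun :: "('m \<Rightarrow> nat) \<Rightarrow> complex ^ 'm \<Rightarrow> complex" where
  "mono_fun \<alpha> z = (\<Prod>i\<in>UNIV. z $ i ^ \<alpha> i)"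

definition expo_box :: "nat \<Rightarrow> ('m \<Rightarrow> nat) set" where
  "expo_box t = {\<alpha>. \<forall>i. \<alpha> i < t}"

definition expo_deg :: "('m::finite \<Rightarrow> nat) \<Rightarrow> nat" where
  "expo_deg \<alpha> = (\<Sum>i\<in>UNIV. \<alpha> i)"

inductive mspan :: "('m::finite \<Rightarrow> nat) set \<Rightarrow> (complex ^ 'm \<Rightarrow> complex) \<Rightarrow> bool" for X where
  mspan_zero: "mspan X (\<lambda>z. 0)"
| mspan_step: "mspan X F \<Longrightarrow> \<alpha> \<in> X \<Longrightarrow> mspan X (\<lambda>z. F z + c * mono_fun \<alpha> z)"

lemma finite_expo_box: "finite (expo_box t :: ('m::finite \<Rightarrow> nat) set)"
proof -
  have "expo_box t = {f :: 'm \<Rightarrow> nat. \<forall>x. (x \<in> UNIV \<longrightarrow> f x \<in> {..<t}) \<and> (x \<notin> UNIV \<longrightarrow> f x = 0)}"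
    by (auto simp: expo_box_def)
  then show ?thesis using finite_set_of_finite_funs[of "UNIV :: 'm set" "{..<t}" 0] by simp
qed

lemma mono_fun_add: "mono_fun (\<lambda>i. \<alpha> i + \<beta> i) z = mono_fun \<alpha> z * mono_fun \<beta> z"
  by (simp add: mono_fun_def power_add prod.distrib)

lemma mono_fun_zero [simp]: "mono_fun (\<lambda>i. 0) z = 1"
  by (simp add: mono_fun_def)

lemma complex_poly_mono_fun: "complex_poly (mono_fun \<alpha>)"
  unfolding mono_fun_def[abs_def] by (intro complex_poly_intros)

lemma mono_fun_single: "mono_fun (\<lambda>i. if i = j then n else 0) z = z $ j ^ n"
proof -
  have "mono_fun (\<lambda>i. if i = j then n else 0) z = (\<Prod>i\<in>UNIV. if i = j then z $ j ^ n else 1)"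
    unfolding mono_fun_def by (rule prod.cong) auto
  then show ?thesis by simp
qed

lemma expo_deg_add: "expo_deg (\<lambda>i. \<alpha> i + \<beta> i) = expo_deg \<alpha> + expo_deg \<beta>"
  by (simp add: expo_deg_def sum.distrib)

lemma expo_deg_single: "expo_deg (\<lambda>i. if i = j then n else 0) = n"
  by (simp add: expo_deg_def)

lemma mono_fun_scale: "mono_fun \<alpha> (c *s z) = c ^ expo_deg \<alpha> * mono_fun \<alpha> z"
  by (simp add: mono_fun_def expo_deg_def power_mult_distrib prod.distrib power_sum)

lemma mspan_mono_fun: "\<alpha> \<in> X \<Longrightarrow> mspan X (\<lambda>z. c * mono_fun \<alpha> z)"
  using mspan_step[OF mspan_zero] by simp

lemma mspan_add: "mspan X G \<Longrightarrow> mspan X F \<Longrightarrow> mspan X (\<lambda>z. F z + G z)"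
  by (induction G rule: mspan.induct) (auto simp flip: add.assoc intro: mspan.intros)

lemma mspan_mono: "mspan X F \<Longrightarrow> X \<subseteq> Y \<Longrightarrow> mspan Y F"
  by (induction F rule: mspan.induct) (auto intro: mspan.intros)

lemma mspan_mult_mono_fun:
  assumes "mspan X F" "\<And>\<alpha>. \<alpha> \<in> X \<Longrightarrow> (\<lambda>i. \<alpha> i + \<beta> i) \<in> Y"
  shows "mspan Y (\<lambda>z. F z * (c * mono_fun \<beta> z))"
  using assms(1)
proof (induction F rule: mspan.induct)
  case (mspan_step F \<alpha> d)
  have "mspan Y (\<lambda>z. F z * (c * mono_fun \<beta> z) + (d * c) * mono_fun (\<lambda>i. \<alpha> i + \<beta> i) z)"
    using mspan_step assms(2) by (intro mspan.mspan_step) auto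
  then show ?case by (simp add: mono_fun_add algebra_simps)
qed (auto intro: mspan.intros)

lemma mspan_mult:
  assumes "mspan Y G" "mspan X F" "\<And>\<alpha> \<beta>. \<alpha> \<in> X \<Longrightarrow> \<beta> \<in> Y \<Longrightarrow> (\<lambda>i. \<alpha> i + \<beta> i) \<in> W"
  shows "mspan W (\<lambda>z. F z * G z)"
  using assms(1)
proof (induction G rule: mspan.induct)
  case (mspan_step G \<beta> c)
  have "mspan W (\<lambda>z. F z * (c * mono_fun \<beta> z))"
    using mspan_mult_mono_fun[OF assms(2)] assms(3) mspan_step by blast
  from mspan_add[OF mspan_step.IH this] show ?case by (simp add: algebra_simps)
qed (auto intro: mspan.intros)

lemma complex_poly_mspan: "mspan X F \<Longrightarrow> complex_poly F"
  by (induction F rule: mspan.induct)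
    (auto intro!: complex_poly.intros complex_poly_mono_fun)

lemma expo_box_mono: "s \<le> t \<Longrightarrow> expo_box s \<subseteq> expo_box t"
  by (auto simp: expo_box_def intro: less_le_trans)

lemma mspan_expo_box:
  assumes "complex_poly F"
  shows "\<exists>t. mspan (expo_box t) F"
  using assms
proof (induction F rule: complex_poly.induct)
  case (1 c)
  have "mspan (expo_box 1) (\<lambda>z :: complex ^ 'm. c * mono_fun (\<lambda>i. 0) z)"
    by (rule mspan_mono_fun) (auto simp: expo_box_def)
  then show ?case by auto
next
  case (2 i)
  have "mspan (expo_box 2) (\<lambda>z. 1 * mono_fun (\<lambda>j. if j = i then 1 else 0) z)"
    by (rule mspan_mono_fun) (auto simp: expo_box_def)
  then show ?case by (auto simp: mono_fun_single)
next
  case (3 F G)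
  then obtain s t where "mspan (expo_box s) F" "mspan (expo_box t) G" by auto
  then have "mspan (expo_box (max s t)) F" "mspan (expo_box (max s t)) G"
    using expo_box_mono by (meson max.cobounded1 max.cobounded2 mspan_mono)+
  then show ?case using mspan_add by blast
next
  case (4 F G)
  then obtain s t where "mspan (expo_box s) F" "mspan (expo_box t) G" by auto
  from mspan_mult[OF this(2,1), of "expo_box (s + t)"]
  show ?case by (auto simp: expo_box_def add_strict_mono)
qed

lemma mspan_coefficients:
  assumes "mspan X F" "finite X"
  shows "\<exists>c. \<forall>z. F z = (\<Sum>\<alpha>\<in>X. c \<alpha> * mono_fun \<alpha> z)"
  using assms(1)
proof (induction F rule: mspan.induct)
  case mspan_zero
  show ?case by (intro exI[of _ "\<lambda>_. 0"]) simp
next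
  case (mspan_step F \<alpha> d)
  then obtain c where c: "\<forall>z. F z = (\<Sum>\<alpha>\<in>X. c \<alpha> * mono_fun \<alpha> z)" by auto
  have "F z + d * mono_fun \<alpha> z = (\<Sum>\<beta>\<in>X. (c(\<alpha> := c \<alpha> + d)) \<beta> * mono_fun \<beta> z)" for z
    using c assms(2) mspan_step(2)
    by (simp add: sum.remove[of X \<alpha>] algebra_simps)
  then show ?case by blast
qed

text \<open>Each monomial is filled up to degree \<open>N\<close> with a power of
  \<open>z $ j\<close>. Every large \<open>N\<close> is allowed so that several polynomials can be
  homogenized in one common degree.\<close>

lemma homogenize:
  assumes "complex_poly F"
  shows "\<exists>D. \<forall>N\<ge>D. \<exists>G. mspan {\<alpha>. expo_deg \<alpha> = N} G \<and>
           (\<forall>z. z $ j \<noteq> 0 \<longrightarrow> z $ j ^ N * F (inverse (z $ j) *s z) = G z)"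
proof -
  obtain t where "mspan (expo_box t) F" using mspan_expo_box[OF assms] by blast
  then show ?thesis
  proof (induction F rule: mspan.induct)
    case mspan_zero
    then show ?case by (auto intro: mspan.intros)
  next
    case (mspan_step F \<alpha> d)
    then obtain D where D: "\<And>N. N \<ge> D \<Longrightarrow> \<exists>G. mspan {\<alpha>. expo_deg \<alpha> = N} G \<and>
           (\<forall>z. z $ j \<noteq> 0 \<longrightarrow> z $ j ^ N * F (inverse (z $ j) *s z) = G z)" by blast
    show ?case
    proof (intro exI[of _ "max D (expo_deg \<alpha>)"] allI impI)
      fix N assume N: "max D (expo_deg \<alpha>) \<le> N"
      then obtain G where G: "mspan {\<alpha>. expo_deg \<alpha> = N} G"
        "\<And>z. z $ j \<noteq> 0 \<Longrightarrow> z $ j ^ N * F (inverse (z $ j) *s z) = G z" using D[of N] by auto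
      define \<beta> where "\<beta> = (\<lambda>i. \<alpha> i + (if i = j then N - expo_deg \<alpha> else 0))"
      have "expo_deg \<beta> = N" using N unfolding \<beta>_def expo_deg_add expo_deg_single by simp
      then have "mspan {\<alpha>. expo_deg \<alpha> = N} (\<lambda>z. G z + d * mono_fun \<beta> z)"
        using G by (intro mspan.mspan_step) auto
      moreover have "z $ j ^ N * (F (inverse (z $ j) *s z) + d * mono_fun \<alpha> (inverse (z $ j) *s z))
          = G z + d * mono_fun \<beta> z" if z: "z $ j \<noteq> 0" for z
      proof -
        have "z $ j ^ N * mono_fun \<alpha> (inverse (z $ j) *s z)
            = z $ j ^ (N - expo_deg \<alpha>) * mono_fun \<alpha> z"
          using z N by (simp add: mono_fun_scale power_diff power_inverse field_simps)
        then show ?thesis using G(2)[OF z]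
          by (simp add: \<beta>_def mono_fun_add mono_fun_single algebra_simps)
      qed
      ultimately show "\<exists>G. mspan {\<alpha>. expo_deg \<alpha> = N} G \<and>
           (\<forall>z. z $ j \<noteq> 0 \<longrightarrow> z $ j ^ N *
             (F (inverse (z $ j) *s z) + d * mono_fun \<alpha> (inverse (z $ j) *s z)) = G z)"
        by blast
    qed
  qed
qed

lemma homogeneous_system_solution:
  fixes v :: "'i \<Rightarrow> 'e \<Rightarrow> 'f::field"
  assumes "finite E" "finite I" "card E < card I"
  shows "\<exists>b. (\<exists>i\<in>I. b i \<noteq> 0) \<and> (\<forall>e\<in>E. (\<Sum>i\<in>I. b i * v i e) = 0)"
  using assms
proof (induction E arbitrary: I v rule: finite_induct)
  case empty
  then obtain i where "i \<in> I" by fastforce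
  then show ?case by (intro exI[of _ "\<lambda>_. 1"]) auto
next
  case (insert e E)
  show ?case
  proof (cases "\<forall>i\<in>I. v i e = 0")
    case True
    have "card E < card I" using insert by simp
    from insert.IH[OF insert.prems(1) this, of v] obtain b where
      "\<exists>i\<in>I. b i \<noteq> 0" "\<forall>e\<in>E. (\<Sum>i\<in>I. b i * v i e) = 0" by blast
    then show ?thesis using True by (intro exI[of _ b]) auto
  next
    case False
    then obtain i0 where i0: "i0 \<in> I" "v i0 e \<noteq> 0" by auto
    define I' where "I' = I - {i0}"
    have I': "finite I'" "card E < card I'" "I = insert i0 I'" "i0 \<notin> I'"
      using insert i0 by (auto simp: I'_def)
    define v' where "v' = (\<lambda>i e'. v i e' - v i e / v i0 e * v i0 e')"
    obtain b where b: "\<exists>i\<in>I'. b i \<noteq> 0" "\<And>e'. e' \<in> E \<Longrightarrow> (\<Sum>i\<in>I'. b i * v' i e') = 0"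
      using insert.IH[OF I'(1,2), of v'] by blast
    define s where "s = - (\<Sum>i\<in>I'. b i * v i e) / v i0 e"
    define b' where "b' = b(i0 := s)"
    have sum: "(\<Sum>i\<in>I. b' i * v i e') = s * v i0 e' + (\<Sum>i\<in>I'. b i * v i e')" for e'
    proof -
      have "(\<Sum>i\<in>I'. b' i * v i e') = (\<Sum>i\<in>I'. b i * v i e')"
        using I'(4) by (intro sum.cong) (auto simp: b'_def)
      then show ?thesis using I' by (simp add: b'_def)
    qed
    have "(\<Sum>i\<in>I. b' i * v i e') = 0" if "e' \<in> insert e E" for e'
    proof (cases "e' = e")
      case True
      then show ?thesis using i0 by (simp add: sum s_def)
    next
      case False
      then have "(\<Sum>i\<in>I'. b i * v' i e') = 0" using b(2) that by auto
      then have "(\<Sum>i\<in>I'. b i * v i e') = (\<Sum>i\<in>I'. b i * v i e) / v i0 e * v i0 e'"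
        by (simp add: v'_def algebra_simps sum_subtractf sum_distrib_left sum_divide_distrib)
      then show ?thesis by (simp add: sum s_def)
    qed
    moreover have "\<exists>i\<in>I. b' i \<noteq> 0" using b(1) I' by (auto simp: b'_def)
    ultimately show ?thesis by blast
  qed
qed

section \<open>Polynomial ideals and their common zeros\<close>

definition poly_ideal :: "(complex ^ 'm \<Rightarrow> complex) set \<Rightarrow> bool" where
  "poly_ideal J \<longleftrightarrow> (\<lambda>z. 0) \<in> J \<and> (\<forall>F\<in>J. complex_poly F) \<and>
     (\<forall>F\<in>J. \<forall>G\<in>J. (\<lambda>z. F z + G z) \<in> J) \<and>
     (\<forall>F\<in>J. \<forall>G. complex_poly G \<longrightarrow> (\<lambda>z. G z * F z) \<in> J)"

lemma poly_ideal_add: "poly_ideal J \<Longrightarrow> F \<in> J \<Longrightarrow> G \<in> J \<Longrightarrow> (\<lambda>z. F z + G z) \<in> J"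
  and poly_ideal_mult: "poly_ideal J \<Longrightarrow> F \<in> J \<Longrightarrow> complex_poly G \<Longrightarrow> (\<lambda>z. G z * F z) \<in> J"
  by (simp_all add: poly_ideal_def)

definition ideal_adjoin ::
  "(complex ^ 'm \<Rightarrow> complex) set \<Rightarrow> (complex ^ 'm \<Rightarrow> complex) \<Rightarrow> (complex ^ 'm \<Rightarrow> complex) set" where
  "ideal_adjoin J g = {\<lambda>z. h z + g z * F z | h F. h \<in> J \<and> complex_poly F}"

lemma poly_ideal_adjoin:
  assumes "poly_ideal J" "complex_poly g"
  shows "poly_ideal (ideal_adjoin J g)"
proof -
  have "(\<lambda>z. 0) \<in> ideal_adjoin J g"
    unfolding ideal_adjoin_def mem_Collect_eq
    by (rule exI[of _ "\<lambda>z. 0"], rule exI[of _ "\<lambda>z. 0"])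
      (use assms in \<open>auto simp: poly_ideal_def intro: complex_poly.intros\<close>)
  moreover have "(\<lambda>z. F z + G z) \<in> ideal_adjoin J g"
    if FG: "F \<in> ideal_adjoin J g" "G \<in> ideal_adjoin J g" for F G
  proof -
    obtain h1 h2 F1 F2 where h: "h1 \<in> J" "h2 \<in> J" "complex_poly F1" "complex_poly F2"
      "F = (\<lambda>z. h1 z + g z * F1 z)" "G = (\<lambda>z. h2 z + g z * F2 z)"
      using FG by (auto simp: ideal_adjoin_def)
    show ?thesis unfolding ideal_adjoin_def mem_Collect_eq
      by (rule exI[of _ "\<lambda>z. h1 z + h2 z"], rule exI[of _ "\<lambda>z. F1 z + F2 z"])
        (use h assms in \<open>auto simp: poly_ideal_def algebra_simps intro: complex_poly.intros\<close>)
  qed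
  moreover have "(\<lambda>z. G z * F z) \<in> ideal_adjoin J g"
    if FG: "F \<in> ideal_adjoin J g" "complex_poly G" for F G
  proof -
    obtain h1 F1 where h: "h1 \<in> J" "complex_poly F1" "F = (\<lambda>z. h1 z + g z * F1 z)"
      using FG by (auto simp: ideal_adjoin_def)
    show ?thesis unfolding ideal_adjoin_def mem_Collect_eq
      by (rule exI[of _ "\<lambda>z. G z * h1 z"], rule exI[of _ "\<lambda>z. G z * F1 z"])
        (use h FG assms in \<open>auto simp: poly_ideal_def algebra_simps intro: complex_poly.intros\<close>)
  qed
  ultimately show ?thesis
    using assms by (auto simp: poly_ideal_def ideal_adjoin_def intro!: complex_poly.intros)
qed

lemma ideal_adjoin_supset: "J \<subseteq> ideal_adjoin J g"
proof
  fix h assume "h \<in> J"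
  then show "h \<in> ideal_adjoin J g"
    unfolding ideal_adjoin_def mem_Collect_eq
    by (intro exI[of _ h] exI[of _ "\<lambda>z. 0"]) (auto intro: complex_poly.intros)
qed

lemma ideal_adjoin_self: "poly_ideal J \<Longrightarrow> g \<in> ideal_adjoin J g"
  unfolding ideal_adjoin_def mem_Collect_eq poly_ideal_def
  by (intro exI[of _ "\<lambda>z. 0"] exI[of _ "\<lambda>z. 1"]) (auto intro: complex_poly.intros)

text \<open>If no \<open>a\<close> works, every \<open>z $ i - a\<close> is invertible modulo
  \<open>J\<close> with inverse \<open>F a\<close>. Uncountably many \<open>a\<close> and countably
  many exponent boxes force infinitely many \<open>F a\<close> into one finite dimensional space,
  hence a linear relation between them.\<close>

lemma ideal_adjoin_coordinate:
  fixes J :: "(complex ^ 'm \<Rightarrow> complex) set"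
  assumes J: "poly_ideal J" "(\<lambda>z. 1) \<notin> J"
  obtains a where "(\<lambda>z. 1) \<notin> ideal_adjoin J (\<lambda>z. z $ i - a)"
proof (rule ccontr)
  assume "\<not> thesis"
  then have "(\<lambda>z. 1) \<in> ideal_adjoin J (\<lambda>z. z $ i - a)" for a using that by blast
  then have "\<forall>a. \<exists>h F. h \<in> J \<and> complex_poly F \<and> (\<lambda>z. 1) = (\<lambda>z. h z + (z $ i - a) * F z)"
    unfolding ideal_adjoin_def by blast
  then obtain h F where hF: "\<And>a. h a \<in> J" "\<And>a. complex_poly (F a)"
    "\<And>a. (\<lambda>z. 1) = (\<lambda>z. h a z + (z $ i - a) * F a z)" by metis
  have eq: "1 - h a z = (z $ i - a) * F a z" for a z
    using fun_cong[OF hF(3), of a z] by (simp add: algebra_simps)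
  obtain T where T: "\<And>a. mspan (expo_box (T a)) (F a)"
    using mspan_expo_box[OF hF(2)] by metis
  have "\<exists>t. infinite {a. T a = t}"
  proof (rule ccontr)
    assume "\<not> ?thesis"
    then have "countable (\<Union>t. {a. T a = t})" by (intro countable_UN) (auto intro: countable_finite)
    moreover have "(\<Union>t. {a. T a = t}) = UNIV" by auto
    ultimately show False using uncountable_UNIV_complex by simp
  qed
  then obtain t where t: "infinite {a. T a = t}" by blast
  obtain I where I: "finite I" "card I = Suc (card (expo_box t :: ('m \<Rightarrow> nat) set))" "I \<subseteq> {a. T a = t}"
    using infinite_arbitrarily_large[OF t] by metis
  have "\<forall>a\<in>I. \<exists>c. \<forall>z. F a z = (\<Sum>\<alpha>\<in>expo_box t. c \<alpha> * mono_fun \<alpha> z)"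
    using T I by (auto intro!: mspan_coefficients finite_expo_box)
  then obtain c where c: "\<And>a z. a \<in> I \<Longrightarrow> F a z = (\<Sum>\<alpha>\<in>expo_box t. c a \<alpha> * mono_fun \<alpha> z)"
    by metis
  obtain b where b: "\<exists>a\<in>I. b a \<noteq> 0"
    "\<And>\<alpha>. \<alpha> \<in> expo_box t \<Longrightarrow> (\<Sum>a\<in>I. b a * c a \<alpha>) = 0"
    using homogeneous_system_solution[OF finite_expo_box I(1), of t c] I(2) by auto
  have zero: "(\<Sum>a\<in>I. b a * F a z) = 0" for z
  proof -
    have "(\<Sum>a\<in>I. b a * F a z) = (\<Sum>a\<in>I. \<Sum>\<alpha>\<in>expo_box t. b a * c a \<alpha> * mono_fun \<alpha> z)"
      by (intro sum.cong) (auto simp: c sum_distrib_left mult.assoc)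
    also have "\<dots> = (\<Sum>\<alpha>\<in>expo_box t. (\<Sum>a\<in>I. b a * c a \<alpha>) * mono_fun \<alpha> z)"
      by (subst sum.swap) (simp add: sum_distrib_right)
    finally show ?thesis using b(2) by simp
  qed
  \<comment> \<open>\<open>p\<close> is the numerator of the sum of \<open>b a / (t - a)\<close>
    over \<open>I\<close>, so the relation between the inverses places \<open>p\<close> evaluated at
    \<open>z $ i\<close> in \<open>J\<close>. It is nonzero because at a node only one summand
    survives.\<close>
  define p where "p = (\<Sum>a\<in>I. smult (b a) (\<Prod>a'\<in>I-{a}. [:-a', 1:]))"
  have "p \<noteq> 0"
  proof -
    obtain a where a: "a \<in> I" "b a \<noteq> 0" using b by auto
    have "poly p a = (\<Sum>a''\<in>I. b a'' * (\<Prod>a'\<in>I-{a''}. a - a'))"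
      by (simp add: p_def poly_sum poly_prod)
    also have "\<dots> = (\<Sum>a''\<in>I. if a'' = a then b a * (\<Prod>a'\<in>I-{a}. a - a') else 0)"
      using I(1) a by (intro sum.cong) auto
    also have "\<dots> = b a * (\<Prod>a'\<in>I-{a}. a - a')" using I(1) a by simp
    finally show ?thesis using I(1) a by auto
  qed
  moreover have "(\<lambda>z. poly p (z $ i)) \<in> J"
  proof -
    have "poly p (z $ i) = (\<Sum>a\<in>I. (b a * (\<Prod>a'\<in>I-{a}. z $ i - a')) * h a z)" for z
    proof -
      have "poly p (z $ i) - (\<Sum>a\<in>I. (b a * (\<Prod>a'\<in>I-{a}. z $ i - a')) * h a z)
          = (\<Sum>a\<in>I. b a * (\<Prod>a'\<in>I-{a}. z $ i - a') * (1 - h a z))"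
        by (simp add: p_def poly_sum poly_prod algebra_simps sum_subtractf)
      also have "\<dots> = (\<Sum>a\<in>I. (\<Prod>a'\<in>I. z $ i - a') * (b a * F a z))"
        by (intro sum.cong) (auto simp: eq prod.remove[OF I(1)])
      also have "\<dots> = 0" using zero by (simp flip: sum_distrib_left)
      finally show ?thesis by simp
    qed
    moreover have "(\<lambda>z. \<Sum>a\<in>X. (b a * (\<Prod>a'\<in>I-{a}. z $ i - a')) * h a z) \<in> J" if "finite X" for X
      using that
    proof (induction X rule: finite_induct)
      case (insert x X)
      have "complex_poly (\<lambda>z. b x * (\<Prod>a'\<in>I-{x}. z $ i - a'))"
        by (intro complex_poly_intros)
      then show ?case using insert J(1) hF(1)[of x] unfolding poly_ideal_def by auto
    qed (use J in \<open>auto simp: poly_ideal_def\<close>)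
    ultimately show ?thesis using I(1) by simp
  qed
  \<comment> \<open>A nonzero polynomial in \<open>z $ i\<close> lying in \<open>J\<close> can be
    stripped of one linear factor at a time, because \<open>z $ i - e\<close> is invertible modulo
    \<open>J\<close>; in the end a nonzero constant lies in \<open>J\<close>.\<close>
  moreover have "(\<lambda>z. 1) \<in> J" if "degree q = n" "q \<noteq> 0" "(\<lambda>z. poly q (z $ i)) \<in> J" for n q
    using that
  proof (induction n arbitrary: q)
    case 0
    then obtain e where e: "q = [:e:]" "e \<noteq> 0" by (metis degree_eq_zeroE pCons_0_0)
    then have "(\<lambda>z. e) \<in> J" using 0 by simp
    then have "(\<lambda>z. inverse e * e) \<in> J"
      by (rule poly_ideal_mult[OF J(1)]) (rule complex_poly.intros)
    then show ?case using e by simp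
  next
    case (Suc n)
    then have "\<not> constant (poly q)" by (simp add: constant_degree)
    then obtain e where "poly q e = 0" using fundamental_theorem_of_algebra by blast
    then obtain r where r: "q = [:-e, 1:] * r" by (metis dvdE poly_eq_0_iff_dvd)
    have cp: "complex_poly (\<lambda>z. poly r (z $ i))"
      by (rule complex_poly_polyfam[OF polyfam_const]) (rule complex_poly.intros)
    then have "(\<lambda>z. poly r (z $ i) * h e z + F e z * poly q (z $ i)) \<in> J"
      using Suc.prems(3) hF cp by (intro poly_ideal_add poly_ideal_mult J(1))
    moreover have "poly r (z $ i) * h e z + F e z * poly q (z $ i) = poly r (z $ i)" for z
    proof -
      have "h e z + (z $ i - e) * F e z = 1" using eq[of e z] by (simp add: algebra_simps)
      then have "poly r (z $ i) * (h e z + (z $ i - e) * F e z) = poly r (z $ i)" by simp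
      then show ?thesis unfolding r by (simp add: algebra_simps)
    qed
    ultimately have "(\<lambda>z. poly r (z $ i)) \<in> J" by simp
    moreover have "r \<noteq> 0" "degree r = n" using Suc.prems r
      by (auto simp: degree_mult_eq simp del: mult_pCons_left)
    ultimately show ?case using Suc.IH by blast
  qed
  ultimately show False using J(2) by blast
qed

text \<open>The residue field at the maximal ideal is reached by adjoining one equation
  \<open>z $ i = a\<close> at a time; a value \<open>a\<close> that keeps the ideal proper exists because the quotient has
  countable dimension over the uncountable ground field.\<close>

theorem weak_nullstellensatz:
  fixes J :: "(complex ^ 'm \<Rightarrow> complex) set"
  assumes J: "poly_ideal J" "(\<lambda>z. 1) \<notin> J"
  obtains a where "\<And>F. F \<in> J \<Longrightarrow> F a = 0"
proof -
  have "\<exists>J'. J \<subseteq> J' \<and> poly_ideal J' \<and> (\<lambda>z. 1) \<notin> J' \<and> (\<forall>i\<in>X. \<exists>a. (\<lambda>z. z $ i - a) \<in> J')"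
    if "finite X" for X :: "'m set"
    using that
  proof (induction X rule: finite_induct)
    case (insert i X)
    then obtain J' where J': "J \<subseteq> J'" "poly_ideal J'" "(\<lambda>z. 1) \<notin> J'"
      "\<forall>i\<in>X. \<exists>a. (\<lambda>z. z $ i - a) \<in> J'" by auto
    obtain a where a: "(\<lambda>z. 1) \<notin> ideal_adjoin J' (\<lambda>z. z $ i - a)"
      using ideal_adjoin_coordinate[OF J'(2,3)] by blast
    have "poly_ideal (ideal_adjoin J' (\<lambda>z. z $ i - a))"
      using J' by (intro poly_ideal_adjoin complex_poly_intros)
    then show ?case
      using a J' ideal_adjoin_supset[of J'] ideal_adjoin_self[OF J'(2)]
      by (intro exI[of _ "ideal_adjoin J' (\<lambda>z. z $ i - a)"]) blast
  qed (use J in auto)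
  from this[of UNIV] obtain J' where J': "J \<subseteq> J'" "poly_ideal J'" "(\<lambda>z. 1) \<notin> J'"
    "\<forall>i. \<exists>a. (\<lambda>z. z $ i - a) \<in> J'" by auto
  then obtain b where b: "\<And>i. (\<lambda>z. z $ i - b i) \<in> J'" by metis
  define a where "a = (\<chi> i. b i)"
  have diff: "(\<lambda>z. F z - F a) \<in> J'" if "complex_poly F" for F
    using that
  proof (induction F rule: complex_poly.induct)
    case (3 F G)
    then have "(\<lambda>z. (F z - F a) + (G z - G a)) \<in> J'"
      by (intro poly_ideal_add[OF J'(2)])
    then show ?case by (simp add: algebra_simps)
  next
    case (4 F G)
    then have "(\<lambda>z. G z * (F z - F a) + F a * (G z - G a)) \<in> J'"
      using 4 by (intro poly_ideal_add poly_ideal_mult J'(2) complex_poly.intros)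
    then show ?case by (simp add: algebra_simps)
  qed (use J'(2) b in \<open>auto simp: poly_ideal_def a_def\<close>)
  have "F a = 0" if "F \<in> J" for F
  proof (rule ccontr)
    assume "F a \<noteq> 0"
    have F: "F \<in> J'" "complex_poly F" using that J' by (auto simp: poly_ideal_def)
    have "(\<lambda>z. inverse (F a) * F z + (- inverse (F a)) * (F z - F a)) \<in> J'"
      using diff[OF F(2)] F by (intro poly_ideal_add poly_ideal_mult J'(2) complex_poly.intros)
    moreover have "inverse (F a) * F z + (- inverse (F a)) * (F z - F a) = 1" for z
      using \<open>F a \<noteq> 0\<close> by (simp add: field_simps)
    ultimately show False using J'(3) by simp
  qed
  then show thesis using that by blast
qed

section \<open>Elimination\<close>

text \<open>Repeated pivoting replaces determinants: one step multiplies the remaining rows by the pivot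
  entry and subtracts, and the diagonal and off-diagonal conditions must survive that.\<close>

lemma elimination:
  fixes Dg Of :: "nat \<Rightarrow> ('p \<Rightarrow> 'r::comm_ring) set"
  assumes diag: "\<And>k a b c d. a \<in> Dg k \<Longrightarrow> b \<in> Dg k \<Longrightarrow> c \<in> Of k \<Longrightarrow> d \<in> Of k \<Longrightarrow>
      (\<lambda>p. a p * b p - c p * d p) \<in> Dg (2 * k)"
    and off: "\<And>k a b c d. a \<in> Dg k \<Longrightarrow> b \<in> Of k \<Longrightarrow> c \<in> Of k \<Longrightarrow> d \<in> Of k \<Longrightarrow>
      (\<lambda>p. a p * b p - c p * d p) \<in> Of (2 * k)"
  assumes "finite X" "i0 \<notin> X"
    and "\<And>i. i \<in> insert i0 X \<Longrightarrow> M i i \<in> Dg k"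
    and "\<And>i j. i \<in> insert i0 X \<Longrightarrow> j \<in> insert i0 X \<Longrightarrow> i \<noteq> j \<Longrightarrow> M i j \<in> Of k"
  shows "\<exists>k'. \<exists>H\<in>Dg k'. \<forall>p v. (\<forall>i\<in>insert i0 X. (\<Sum>j\<in>insert i0 X. M i j p * v j) = 0) \<longrightarrow> H p * v i0 = 0"
  using assms(3-)
proof (induction X arbitrary: M k rule: finite_induct)
  case empty
  then show ?case by (intro exI[of _ k] bexI[of _ "M i0 i0"]) auto
next
  case (insert x X)
  \<comment> \<open>Row \<open>x\<close> is the pivot row, and the unknown \<open>v x\<close>
    disappears. Each new entry is a difference of products of two old ones, which explains the
    passage from level \<open>k\<close> to \<open>2 * k\<close>; for integral relations the level is
    a degree.\<close>
  define N where "N = (\<lambda>i j p. M x x p * M i j p - M i x p * M x j p)"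
  have ne: "i \<noteq> x" if "i \<in> insert i0 X" for i using that insert by auto
  have "N i i \<in> Dg (2 * k)" if "i \<in> insert i0 X" for i
    unfolding N_def using that ne[OF that] ne[OF that, symmetric]
    by (intro diag insert.prems) auto
  moreover have "N i j \<in> Of (2 * k)" if "i \<in> insert i0 X" "j \<in> insert i0 X" "i \<noteq> j" for i j
    unfolding N_def using that ne[OF that(1)] ne[OF that(2), symmetric]
    by (intro off insert.prems) auto
  moreover have "i0 \<notin> X" using insert by auto
  ultimately obtain k' H where H: "H \<in> Dg k'"
    "\<And>p v. \<forall>i\<in>insert i0 X. (\<Sum>j\<in>insert i0 X. N i j p * v j) = 0 \<Longrightarrow> H p * v i0 = 0"
    using insert.IH[of N "2 * k"] by blast
  have "H p * v i0 = 0"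
    if v: "\<forall>i\<in>insert i0 (insert x X). (\<Sum>j\<in>insert i0 (insert x X). M i j p * v j) = 0" for p v
  proof (rule H(2), rule ballI)
    fix i assume i: "i \<in> insert i0 X"
    have fin: "finite (insert i0 X)" and xX: "x \<notin> insert i0 X" using insert by auto
    have ins: "insert i0 (insert x X) = insert x (insert i0 X)" by auto
    have row: "M i' x p * v x + (\<Sum>j\<in>insert i0 X. M i' j p * v j) = 0"
      if "i' \<in> insert x (insert i0 X)" for i'
    proof -
      have "(\<Sum>j\<in>insert x (insert i0 X). M i' j p * v j) = 0" using v that unfolding ins by blast
      then show ?thesis by (simp only: sum.insert[OF fin xX])
    qed
    have "(\<Sum>j\<in>insert i0 X. N i j p * v j)
        = M x x p * (\<Sum>j\<in>insert i0 X. M i j p * v j) - M i x p * (\<Sum>j\<in>insert i0 X. M x j p * v j)"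
      unfolding N_def sum_distrib_left
      by (simp add: left_diff_distrib sum_subtractf mult.assoc)
    also have "\<dots> = M x x p * (- (M i x p * v x)) - M i x p * (- (M x x p * v x))"
      using row[of i] row[of x] i by (simp add: add_eq_0_iff)
    also have "\<dots> = 0" by (simp add: algebra_simps)
    finally show "(\<Sum>j\<in>insert i0 X. N i j p * v j) = 0" .
  qed
  then show ?case using H(1) by blast
qed

lemma sum_UNIV_option: "(\<Sum>i\<in>(UNIV :: 'm::finite option set). f i) = (\<Sum>i\<in>UNIV. f (Some i)) + f None"
  by (simp add: UNIV_option_conv sum.reindex add.commute)

section \<open>Cones over irreducible varieties and finite projections\<close>

text \<open>The vanishing ideal is assumed prime among all polynomials and not only among
  homogeneous ones; closedness is expressed by polynomials separating outside points.\<close>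

locale irreducible_cone =
  fixes Z :: "(complex ^ 'm::finite) set"
  assumes scale_closed: "z \<in> Z \<Longrightarrow> c *s z \<in> Z"
    and nontrivial: "\<exists>z\<in>Z. z \<noteq> 0"
    and algebraic: "z \<notin> Z \<Longrightarrow> \<exists>F. complex_poly F \<and> (\<forall>y\<in>Z. F y = 0) \<and> F z \<noteq> 0"
    and prime: "complex_poly F \<Longrightarrow> complex_poly G \<Longrightarrow> (\<And>z. z \<in> Z \<Longrightarrow> F z * G z = 0) \<Longrightarrow>
      (\<forall>z\<in>Z. F z = 0) \<or> (\<forall>z\<in>Z. G z = 0)"
begin

lemma zero_mem: "0 \<in> Z"
  using nontrivial scale_closed[of _ 0] by auto

lemma closed_cone: "closed Z"
proof -
  have "Z = (\<Inter>F\<in>vanishing_ideal Z. {z. F z = 0})"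
    using algebraic by (fastforce simp: vanishing_ideal_def)
  moreover have "closed {z. F z = 0}" if "F \<in> vanishing_ideal Z" for F
    using that continuous_on_complex_poly[of F UNIV]
    by (auto simp: vanishing_ideal_def intro!: closed_Collect_eq)
  ultimately show ?thesis by (metis (no_types, lifting) closed_INT)
qed

text \<open>The ideal \<open>J\<close> consists of the polynomials that agree on \<open>Z\<close>
  with a combination of the \<open>c i\<close>. It contains all polynomials vanishing on
  \<open>Z\<close>, so a common zero of \<open>J\<close> would be a point of \<open>Z\<close> where
  all \<open>c i\<close> vanish.\<close>

lemma nullstellensatz_on:
  assumes "finite I" and c: "\<And>i. complex_poly (c i)" and nz: "\<And>z. z \<in> Z \<Longrightarrow> \<exists>i\<in>I. c i z \<noteq> 0"
  shows "\<exists>g. (\<forall>i. complex_poly (g i)) \<and> (\<forall>z\<in>Z. 1 = (\<Sum>i\<in>I. c i z * g i z))"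
proof -
  define J where "J = {F. complex_poly F \<and> (\<exists>g. (\<forall>i. complex_poly (g i)) \<and>
     (\<forall>z\<in>Z. F z = (\<Sum>i\<in>I. c i z * g i z)))}"
  have memJ: "F \<in> J" if "complex_poly F" "\<And>i. complex_poly (g i)"
     "\<And>z. z \<in> Z \<Longrightarrow> F z = (\<Sum>i\<in>I. c i z * g i z)" for F g
    using that unfolding J_def by blast
  have "poly_ideal J"
    unfolding poly_ideal_def
  proof (intro conjI ballI allI impI)
    show "(\<lambda>z. 0) \<in> J"
      by (rule memJ[of _ "\<lambda>i z. 0"]) (auto intro: complex_poly.intros)
    fix F assume F: "F \<in> J"
    then show "complex_poly F" by (simp add: J_def)
    obtain g where g: "\<And>i. complex_poly (g i)" "\<And>z. z \<in> Z \<Longrightarrow> F z = (\<Sum>i\<in>I. c i z * g i z)" 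
      and cF: "complex_poly F" using F unfolding J_def by blast
    {
      fix G assume G: "G \<in> J"
      obtain g' where g': "\<And>i. complex_poly (g' i)" "\<And>z. z \<in> Z \<Longrightarrow> G z = (\<Sum>i\<in>I. c i z * g' i z)" 
        and cG: "complex_poly G" using G unfolding J_def by blast
      show "(\<lambda>z. F z + G z) \<in> J"
        by (rule memJ[of _ "\<lambda>i z. g i z + g' i z"])
          (auto intro!: complex_poly.intros g(1) g'(1) cF cG
            simp: g(2) g'(2) algebra_simps sum.distrib)
    }
    {
      fix G :: "complex ^ 'm \<Rightarrow> complex" assume G: "complex_poly G"
      show "(\<lambda>z. G z * F z) \<in> J"
        by (rule memJ[of _ "\<lambda>i z. G z * g i z"])
          (auto intro!: complex_poly.intros g(1) cF G
            simp: g(2) algebra_simps sum_distrib_left)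
    }
  qed
  moreover have "\<not> (\<forall>F\<in>J. F a = 0)" for a
  proof
    assume a: "\<forall>F\<in>J. F a = 0"
    have "a \<in> Z"
    proof (rule ccontr)
      assume "a \<notin> Z"
      then obtain F where F: "complex_poly F" "\<forall>y\<in>Z. F y = 0" "F a \<noteq> 0" using algebraic by blast
      have "F \<in> J" using F
        by (intro memJ[of _ "\<lambda>i z. 0"]) (auto intro: complex_poly.intros)
      from bspec[OF a this] show False using F by simp
    qed
    then obtain k where k: "k \<in> I" "c k a \<noteq> 0" using nz by blast
    have "c k \<in> J"
    proof (rule memJ)
      show "complex_poly (\<lambda>z :: complex ^ 'm. if i = k then 1 else 0)" for i
        by (cases "i = k") (simp_all add: complex_poly.intros(1))
      show "c k z = (\<Sum>i\<in>I. c i z * (if i = k then 1 else 0))" for z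
        using \<open>finite I\<close> k(1) by (simp add: if_distrib[of "\<lambda>x. _ * x"] sum.delta' cong: if_cong)
    qed (rule c)
    from bspec[OF a this] show False using k by simp
  qed
  ultimately have "(\<lambda>z. 1) \<in> J" using weak_nullstellensatz by metis
  then show ?thesis unfolding J_def by blast
qed

end

text \<open>A square matrix stands for the projection, its range being the target. The kernel
  meeting the cone only at 0 means that the projective centre avoids the variety, which makes the
  projection finite.\<close>

locale finite_projection = irreducible_cone Z
  for Z :: "(complex ^ 'm::finite) set" +
  fixes L :: "complex ^ 'm ^ 'm"
  assumes kernel: "z \<in> Z \<Longrightarrow> L *v z = 0 \<Longrightarrow> z = 0"
begin

text \<open>By homogeneity it suffices to bound \<open>L *v z\<close> below on the compact set of
  unit vectors of \<open>Z\<close>, where it has no zero. This properness later controls limits of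
  points of \<open>Z\<close> and the growth of roots.\<close>

lemma norm_bound:
  obtains C where "C > 0" "\<And>z. z \<in> Z \<Longrightarrow> norm z \<le> C * norm (L *v z)"
proof -
  let ?K = "Z \<inter> sphere 0 1"
  have nrm: "(1 / norm z) *\<^sub>R z \<in> ?K" if "z \<in> Z" "z \<noteq> 0" for z
  proof -
    have "(1 / norm z) *\<^sub>R z = complex_of_real (1 / norm z) *s z"
      by (simp add: vec_eq_iff scaleR_conv_of_real[where 'a = complex])
    then have "(1 / norm z) *\<^sub>R z \<in> Z" using that scale_closed by metis
    then show ?thesis using that by simp
  qed
  have "compact ?K" using closed_cone by (simp add: closed_Int_compact)
  moreover have "?K \<noteq> {}" using nontrivial nrm by blast
  moreover have "continuous_on ?K (\<lambda>z. norm (L *v z))"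
    by (intro continuous_intros linear_continuous_on matrix_vector_mul_bounded_linear)
  ultimately obtain z0 where z0: "z0 \<in> ?K" "\<And>z. z \<in> ?K \<Longrightarrow> norm (L *v z0) \<le> norm (L *v z)"
    using continuous_attains_inf by metis
  define e where "e = norm (L *v z0)"
  have "e > 0" using z0 kernel[of z0] by (auto simp: e_def)
  have "norm z \<le> 1 / e * norm (L *v z)" if z: "z \<in> Z" for z
  proof (cases "z = 0")
    case False
    have "e \<le> norm (L *v ((1 / norm z) *\<^sub>R z))" using z0(2)[OF nrm[OF z False]] by (simp add: e_def)
    also have "L *v ((1 / norm z) *\<^sub>R z) = (1 / norm z) *\<^sub>R (L *v z)"
      by (simp add: linear_scale[OF matrix_vector_mul_linear])
    finally show ?thesis using False \<open>e > 0\<close> by (simp add: field_simps)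
  qed auto
  then show thesis using that[of "1 / e"] \<open>e > 0\<close> by simp
qed

text \<open>The equations \<open>L *v z = 0\<close> and \<open>z $ j = 1\<close> have no common
  solution on \<open>Z\<close>, so the Nullstellensatz expresses 1 by them. Rescaling to
  \<open>z $ j = 1\<close> removes the second term, and homogenization clears the
  denominators.\<close>

lemma coordinate_power:
  fixes j :: 'm
  obtains D where "\<And>N. N \<ge> D \<Longrightarrow> \<exists>G. (\<forall>i. mspan {\<alpha>. expo_deg \<alpha> = N} (G i)) \<and>
    (\<forall>z\<in>Z. z $ j ^ Suc N = (\<Sum>i\<in>UNIV. (L *v z) $ i * G i z))"
proof -
  define c where "c = (\<lambda>i z. case i of None \<Rightarrow> z $ j - 1 | Some k \<Rightarrow> (L *v z) $ k)"
  have "\<exists>g. (\<forall>i. complex_poly (g i)) \<and> (\<forall>z\<in>Z. 1 = (\<Sum>i\<in>UNIV. c i z * g i z))"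
  proof (rule nullstellensatz_on)
    show "complex_poly (c i)" for i
      by (cases i) (auto simp: c_def intro: complex_poly_intros complex_poly_matrix)
    show "\<exists>i\<in>UNIV. c i z \<noteq> 0" if z: "z \<in> Z" for z
    proof (rule ccontr)
      assume "\<not> ?thesis"
      then have 0: "c i z = 0" for i by simp
      have "(L *v z) $ k = 0" for k using 0[of "Some k"] by (simp add: c_def)
      then have "z = 0" using kernel[OF z] by (simp add: vec_eq_iff)
      then show False using 0[of None] by (simp add: c_def)
    qed
  qed simp
  then obtain g' where g': "\<And>i. complex_poly (g' i)" 
      "\<And>z. z \<in> Z \<Longrightarrow> 1 = (\<Sum>i\<in>UNIV. c i z * g' i z)" by blast
  define g where "g = (\<lambda>i. g' (Some i))"
  have gh: "complex_poly (g i)"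
    "z \<in> Z \<Longrightarrow> 1 = (\<Sum>i\<in>UNIV. (L *v z) $ i * g i z) + (z $ j - 1) * g' None z" for i z
    using g'(1) g'(2)[of z] by (simp_all add: g_def c_def sum_UNIV_option)
  have "\<forall>i. \<exists>D. \<forall>N\<ge>D. \<exists>G. mspan {\<alpha>. expo_deg \<alpha> = N} G \<and>
           (\<forall>z. z $ j \<noteq> 0 \<longrightarrow> z $ j ^ N * g i (inverse (z $ j) *s z) = G z)"
    by (intro allI homogenize gh(1))
  from choice[OF this] obtain D where D: "\<And>i N. N \<ge> D i \<Longrightarrow> \<exists>G. mspan {\<alpha>. expo_deg \<alpha> = N} G \<and>
           (\<forall>z. z $ j \<noteq> 0 \<longrightarrow> z $ j ^ N * g i (inverse (z $ j) *s z) = G z)"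
    by blast
  define D' where "D' = Max (range D)"
  have D': "D i \<le> D'" for i unfolding D'_def by simp
  have "\<exists>G. (\<forall>i. mspan {\<alpha>. expo_deg \<alpha> = N} (G i)) \<and>
    (\<forall>z\<in>Z. z $ j ^ Suc N = (\<Sum>i\<in>UNIV. (L *v z) $ i * G i z))" if N: "N \<ge> Suc D'" for N
  proof -
    obtain n where n: "N = Suc n" "n \<ge> D'" using N by (cases N) auto
    then have "\<forall>i. \<exists>G. mspan {\<alpha>. expo_deg \<alpha> = n} G \<and>
           (\<forall>z. z $ j \<noteq> 0 \<longrightarrow> z $ j ^ n * g i (inverse (z $ j) *s z) = G z)"
      using D D' le_trans by blast
    from choice[OF this] obtain G where G: "\<And>i. mspan {\<alpha>. expo_deg \<alpha> = n} (G i)"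
      "\<And>i z. z $ j \<noteq> 0 \<Longrightarrow> z $ j ^ n * g i (inverse (z $ j) *s z) = G i z" by blast
    \<comment> \<open>The spare factor \<open>z $ j\<close>, for which \<open>N\<close> is taken to
      be a successor, makes both sides vanish at points with \<open>z $ j = 0\<close>, where the
      homogenized identity says nothing.\<close>
    define e where "e = (\<lambda>i. if i = j then 1 else 0 :: nat)"
    have "mspan {\<alpha>. expo_deg \<alpha> = N} (\<lambda>z. G i z * (1 * mono_fun e z))" for i
      by (rule mspan_mult_mono_fun[OF G(1)]) (auto simp: n expo_deg_add e_def expo_deg_single)
    moreover have "z $ j ^ Suc N = (\<Sum>i\<in>UNIV. (L *v z) $ i * (G i z * (1 * mono_fun e z)))"
      if z: "z \<in> Z" for z
    proof (cases "z $ j = 0")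
      case False
      define y where "y = inverse (z $ j) *s z"
      have "y \<in> Z" using z scale_closed by (simp add: y_def)
      moreover have "y $ j = 1" using False by (simp add: y_def)
      ultimately have "1 = (\<Sum>i\<in>UNIV. (L *v y) $ i * g i y)" using gh(2)[of y] by simp
      moreover have "(L *v y) $ i = inverse (z $ j) * (L *v z) $ i" for i
        by (simp add: y_def vector_scalar_commute)
      ultimately have 1: "1 = (\<Sum>i\<in>UNIV. inverse (z $ j) * (L *v z) $ i * g i y)" by simp
      have "z $ j ^ Suc N = z $ j ^ Suc N * (\<Sum>i\<in>UNIV. inverse (z $ j) * (L *v z) $ i * g i y)"
        using 1 by simp
      also have "\<dots> = (\<Sum>i\<in>UNIV. (L *v z) $ i * ((z $ j ^ n * g i y) * z $ j))"
        using False by (simp add: n sum_distrib_left field_simps)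
      also have "\<dots> = (\<Sum>i\<in>UNIV. (L *v z) $ i * (G i z * (1 * mono_fun e z)))"
        using G(2)[OF False] by (simp add: y_def e_def mono_fun_single)
      finally show ?thesis .
    qed (simp add: e_def mono_fun_single)
    ultimately show ?thesis
      by (intro exI[of _ "\<lambda>i z. G i z * (1 * mono_fun e z)"]) blast
  qed
  then show thesis using that by blast
qed

text \<open>On \<open>Z\<close>, a monomial containing \<open>z $ j\<close> to the power
  \<open>N + 1\<close> is a combination of monomials of total degree one less, with entries of
  \<open>L *v z\<close> as coefficients. Descent on the degree leaves only the monomials of the
  box.\<close>

lemma finite_module:
  obtains t where "t > 0" "\<And>F. complex_poly F \<Longrightarrow> \<exists>a. (\<forall>\<alpha>. complex_poly (a \<alpha>)) \<and>
    (\<forall>z\<in>Z. F z = (\<Sum>\<alpha>\<in>expo_box t. a \<alpha> (L *v z) * mono_fun \<alpha> z))"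
proof -
  have "\<forall>j. \<exists>D. \<forall>N\<ge>D. \<exists>G. (\<forall>i. mspan {\<alpha>. expo_deg \<alpha> = N} (G i)) \<and>
    (\<forall>z\<in>Z. z $ j ^ Suc N = (\<Sum>i\<in>UNIV. (L *v z) $ i * G i z))"
    using coordinate_power by metis
  from choice[OF this] obtain D where D: "\<And>j N. N \<ge> D j \<Longrightarrow> \<exists>G. (\<forall>i. mspan {\<alpha>. expo_deg \<alpha> = N} (G i)) \<and>
    (\<forall>z\<in>Z. z $ j ^ Suc N = (\<Sum>i\<in>UNIV. (L *v z) $ i * G i z))" by blast
  define N where "N = Max (range D)"
  have "D j \<le> N" for j unfolding N_def by simp
  then have "\<forall>j. \<exists>G. (\<forall>i. mspan {\<alpha>. expo_deg \<alpha> = N} (G i)) \<and>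
    (\<forall>z\<in>Z. z $ j ^ Suc N = (\<Sum>i\<in>UNIV. (L *v z) $ i * G i z))"
    using D by blast
  from choice[OF this] obtain G where G: "\<And>j i. mspan {\<alpha>. expo_deg \<alpha> = N} (G j i)"
    "\<And>j z. z \<in> Z \<Longrightarrow> z $ j ^ Suc N = (\<Sum>i\<in>UNIV. (L *v z) $ i * G j i z)"
    by blast
  define M where "M = {F. \<exists>a. (\<forall>\<alpha>. complex_poly (a \<alpha>)) \<and>
    (\<forall>z\<in>Z. F z = (\<Sum>\<alpha>\<in>expo_box (Suc N). a \<alpha> (L *v z) * mono_fun \<alpha> z))}"
  have M_add: "(\<lambda>z. F z + F' z) \<in> M" if FF: "F \<in> M" "F' \<in> M" for F F'
  proof -
    obtain a a' where "\<And>\<alpha>. complex_poly (a \<alpha>)" "\<And>\<alpha>. complex_poly (a' \<alpha>)"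
      "\<And>z. z \<in> Z \<Longrightarrow> F z = (\<Sum>\<alpha>\<in>expo_box (Suc N). a \<alpha> (L *v z) * mono_fun \<alpha> z)"
      "\<And>z. z \<in> Z \<Longrightarrow> F' z = (\<Sum>\<alpha>\<in>expo_box (Suc N). a' \<alpha> (L *v z) * mono_fun \<alpha> z)"
      using FF unfolding M_def by blast
    then show ?thesis unfolding M_def mem_Collect_eq
      by (intro exI[of _ "\<lambda>\<alpha> q. a \<alpha> q + a' \<alpha> q"])
        (auto simp: algebra_simps sum.distrib intro: complex_poly.intros)
  qed
  have M_mult: "(\<lambda>z. b (L *v z) * F z) \<in> M" if FF: "F \<in> M" "complex_poly b" for F b
  proof -
    obtain a where "\<And>\<alpha>. complex_poly (a \<alpha>)"
      "\<And>z. z \<in> Z \<Longrightarrow> F z = (\<Sum>\<alpha>\<in>expo_box (Suc N). a \<alpha> (L *v z) * mono_fun \<alpha> z)"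
      using FF unfolding M_def by blast
    then show ?thesis unfolding M_def mem_Collect_eq using FF(2)
      by (intro exI[of _ "\<lambda>\<alpha> q. b q * a \<alpha> q"])
        (auto simp: sum_distrib_left mult.assoc intro: complex_poly.intros)
  qed
  have M_zero: "(\<lambda>z. 0) \<in> M"
    unfolding M_def mem_Collect_eq
    by (intro exI[of _ "\<lambda>\<alpha> q. 0"]) (auto intro: complex_poly.intros)
  have M_cong: "F' \<in> M" if "F \<in> M" "\<And>z. z \<in> Z \<Longrightarrow> F' z = F z" for F F'
    using that unfolding M_def by auto
  have M_sum: "(\<lambda>z. \<Sum>i\<in>I. f i z) \<in> M" if "finite I" "\<And>i. i \<in> I \<Longrightarrow> f i \<in> M" for I :: "'m set" and f
    using that by (induction I rule: finite_induct) (auto intro: M_zero M_add)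
  have M_mspan: "F \<in> M" if "mspan X F" "\<And>\<alpha>. \<alpha> \<in> X \<Longrightarrow> mono_fun \<alpha> \<in> M" for X F
    using that(1)
  proof (induction F rule: mspan.induct)
    case (mspan_step F \<alpha> c)
    then show ?case
      using M_mult[OF that(2) complex_poly.intros(1)] by (intro M_add) auto
  qed (rule M_zero)
  have mono: "mono_fun \<alpha> \<in> M" for \<alpha>
  proof (induction "expo_deg \<alpha>" arbitrary: \<alpha> rule: less_induct)
    case less
    show ?case
    proof (cases "\<alpha> \<in> expo_box (Suc N)")
      case True
      have "complex_poly (\<lambda>z :: complex ^ 'm. if \<beta> = \<alpha> then 1 else 0)" for \<beta>
        by (cases "\<beta> = \<alpha>") (simp_all add: complex_poly.intros(1))
      moreover have "mono_fun \<alpha> z = (\<Sum>\<beta>\<in>expo_box (Suc N). (if \<beta> = \<alpha> then 1 else 0) * mono_fun \<beta> z)" for z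
        using True by (simp add: finite_expo_box if_distrib[of "\<lambda>x. x * _"] sum.delta cong: if_cong)
      ultimately show ?thesis unfolding M_def mem_Collect_eq
        by (intro exI[of _ "\<lambda>\<beta> q. if \<beta> = \<alpha> then 1 else 0"]) simp
    next
      case False
      then obtain j where j: "Suc N \<le> \<alpha> j" by (auto simp: expo_box_def not_less)
      define \<beta> where "\<beta> = \<alpha>(j := \<alpha> j - Suc N)"
      have \<alpha>: "\<alpha> = (\<lambda>i. \<beta> i + (if i = j then Suc N else 0))" using j by (auto simp: \<beta>_def)
      have deg: "expo_deg \<alpha> = expo_deg \<beta> + Suc N"
        by (subst \<alpha>) (simp only: expo_deg_add expo_deg_single)
      have mono_eq: "mono_fun \<alpha> z = mono_fun \<beta> z * z $ j ^ Suc N" for z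
        by (subst \<alpha>) (simp only: mono_fun_add mono_fun_single)
      have "mspan {\<gamma>. expo_deg \<gamma> = N + expo_deg \<beta>} (\<lambda>z. G j i z * (1 * mono_fun \<beta> z))" for i
        by (rule mspan_mult_mono_fun[OF G(1)]) (auto simp: expo_deg_add)
      then have "(\<lambda>z. G j i z * (1 * mono_fun \<beta> z)) \<in> M" for i
        by (rule M_mspan) (auto simp: deg intro: less)
      then have "(\<lambda>z. \<Sum>i\<in>UNIV. (L *v z) $ i * (G j i z * (1 * mono_fun \<beta> z))) \<in> M"
        by (intro M_sum M_mult[where b = "\<lambda>q. q $ _"] complex_poly.intros) auto
      then show ?thesis
      proof (rule M_cong)
        fix z assume "z \<in> Z"
        then show "mono_fun \<alpha> z = (\<Sum>i\<in>UNIV. (L *v z) $ i * (G j i z * (1 * mono_fun \<beta> z)))"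
          unfolding mono_eq G(2)[OF \<open>z \<in> Z\<close>] by (simp add: sum_distrib_left mult_ac)
      qed
    qed
  qed
  have "F \<in> M" if "complex_poly F" for F
    using mspan_expo_box[OF that] M_mspan mono by blast
  then show thesis using that[of "Suc N"] unfolding M_def by blast
qed

end

section \<open>Integral relations\<close>

definition monicfam :: "nat \<Rightarrow> (complex ^ 'm \<Rightarrow> complex poly) \<Rightarrow> bool" where
  "monicfam n h \<longleftrightarrow> polyfam h \<and> (\<forall>q. degree (h q) = n \<and> coeff (h q) n = 1)"

lemma monicfam_mult:
  assumes "monicfam m g" "monicfam n h"
  shows "monicfam (m + n) (\<lambda>q. g q * h q)"
proof -
  have "degree (g q * h q) = m + n" for q
  proof -
    have "g q \<noteq> 0" "h q \<noteq> 0" using assms unfolding monicfam_def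
      by (metis coeff_0 zero_neq_one)+
    then show ?thesis using assms by (simp add: monicfam_def degree_mult_eq)
  qed
  moreover have "coeff (g q * h q) (m + n) = 1" for q
    using assms coeff_mult_degree_sum[of "g q" "h q"] by (simp add: monicfam_def)
  ultimately show ?thesis using assms by (simp add: monicfam_def polyfam_mult)
qed

lemma monicfam_diff:
  assumes "monicfam n g" "polyfam h" "\<And>q. degree (h q) < n"
  shows "monicfam n (\<lambda>q. g q - h q)"
proof -
  have "degree (g q - h q) = n" "coeff (g q - h q) n = 1" for q
  proof -
    show 1: "coeff (g q - h q) n = 1"
      using assms by (simp add: monicfam_def coeff_eq_0)
    have "degree (g q - h q) \<le> n"
      using assms by (intro degree_diff_le) (auto simp: monicfam_def less_imp_le)
    then show "degree (g q - h q) = n" using 1 le_degree[of "g q - h q" n] by simp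
  qed
  then show ?thesis using assms by (simp add: monicfam_def polyfam_diff)
qed

lemma degree_mult_less:
  fixes p q :: "complex poly"
  assumes "degree p \<le> m" "degree q < n"
  shows "degree (p * q) < m + n"
  using degree_mult_le[of p q] assms by linarith

text \<open>Here \<open>r\<close> is a nominal degree: \<open>coeff (P q) r\<close> may vanish for
  some \<open>q\<close>, so it is never inverted, and one exponent \<open>e\<close> clears
  denominators for all \<open>q\<close> at once.\<close>

lemma pseudo_division:
  assumes P: "polyfam P" "\<And>q. degree (P q) \<le> r" "r > 0"
  shows "polyfam h \<Longrightarrow> (\<And>q. degree (h q) \<le> d) \<Longrightarrow>
    \<exists>e Q R. polyfam Q \<and> polyfam R \<and> (\<forall>q. degree (R q) < r) \<and>
      (\<forall>q. smult (coeff (P q) r ^ e) (h q) = P q * Q q + R q)"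
proof (induction d arbitrary: h)
  case 0
  then show ?case
    by (intro exI[of _ 0] exI[of _ "\<lambda>_. 0"] exI[of _ h]) (use P in \<open>auto simp: polyfam_const\<close>)
next
  case (Suc d)
  show ?case
  proof (cases "Suc d < r")
    case True
    then show ?thesis
      by (intro exI[of _ 0] exI[of _ "\<lambda>_. 0"] exI[of _ h])
        (use Suc.prems in \<open>auto simp: polyfam_const intro: le_less_trans\<close>)
  next
    case False
    define m where "m = (\<lambda>q. monom (coeff (h q) (Suc d)) (Suc d - r))"
    define h' where "h' = (\<lambda>q. smult (coeff (P q) r) (h q) - P q * m q)"
    have pm: "polyfam m" unfolding m_def using Suc.prems by (intro polyfam_monom polyfam_coeff)
    have ph': "polyfam h'" unfolding h'_def
      using Suc.prems P pm by (intro polyfam_diff polyfam_smult polyfam_mult polyfam_coeff)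
    have "degree (h' q) \<le> d" for q
    proof (rule degree_le, intro allI impI)
      fix i assume i: "d < i"
      have Pm: "coeff (P q * m q) i = coeff (h q) (Suc d) * coeff (P q) (i - (Suc d - r))"
        unfolding m_def using i by (subst mult.commute) (simp add: coeff_monom_mult)
      show "coeff (h' q) i = 0"
      proof (cases "i = Suc d")
        case True
        then show ?thesis using False Pm by (simp add: h'_def)
      next
        case ne: False
        then have "i > Suc d" using i by simp
        then have "coeff (h q) i = 0" "coeff (P q) (i - (Suc d - r)) = 0"
          using Suc.prems(2)[of q] P(2)[of q] False by (auto intro!: coeff_eq_0)
        then show ?thesis using Pm by (simp add: h'_def)
      qed
    qed
    from Suc.IH[OF ph' this] obtain e Q R where QR: "polyfam Q" "polyfam R"
      "\<And>q. degree (R q) < r" "\<And>q. smult (coeff (P q) r ^ e) (h' q) = P q * Q q + R q" by blast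
    have "smult (coeff (P q) r ^ Suc e) (h q)
        = P q * (Q q + smult (coeff (P q) r ^ e) (m q)) + R q" for q
    proof -
      have "smult (coeff (P q) r ^ Suc e) (h q)
        = smult (coeff (P q) r ^ e) (h' q) + smult (coeff (P q) r ^ e) (P q * m q)"
        by (simp add: h'_def smult_diff_right mult.commute)
      then show ?thesis by (simp add: QR(4) algebra_simps)
    qed
    moreover have "polyfam (\<lambda>q. Q q + smult (coeff (P q) r ^ e) (m q))"
      using QR pm P by (intro polyfam_add polyfam_smult complex_poly_power polyfam_coeff)
    ultimately show ?thesis using QR by blast
  qed
qed

context finite_projection
begin

text \<open>The Cayley-Hamilton argument, for multiplication by \<open>F\<close> on the finite module.\<close>

lemma integral_relation:
  assumes F: "complex_poly F"
  obtains n h where "monicfam n h" "\<And>z. z \<in> Z \<Longrightarrow> poly (h (L *v z)) (F z) = 0"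
proof -
  obtain t where t: "t > 0" "\<And>F. complex_poly F \<Longrightarrow> \<exists>a. (\<forall>\<alpha>. complex_poly (a \<alpha>)) \<and>
    (\<forall>z\<in>Z. F z = (\<Sum>\<alpha>\<in>expo_box t. a \<alpha> (L *v z) * mono_fun \<alpha> z))"
    by (rule finite_module) blast
  have "\<forall>\<alpha>. \<exists>a. (\<forall>\<beta>. complex_poly (a \<beta>)) \<and>
    (\<forall>z\<in>Z. F z * mono_fun \<alpha> z = (\<Sum>\<beta>\<in>expo_box t. a \<beta> (L *v z) * mono_fun \<beta> z))"
    using t(2) F by (intro allI t(2)) (intro complex_poly.intros complex_poly_mono_fun)
  from choice[OF this] obtain a where a: "\<And>\<alpha> \<beta>. complex_poly (a \<alpha> \<beta>)"
    "\<And>\<alpha> z. z \<in> Z \<Longrightarrow> F z * mono_fun \<alpha> z = (\<Sum>\<beta>\<in>expo_box t. a \<alpha> \<beta> (L *v z) * mono_fun \<beta> z)"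
    by blast
  \<comment> \<open>\<open>i0\<close> is the exponent of the monomial 1, so the corresponding entry
    of the vector of monomials is 1 and the conclusion of the elimination becomes a relation for
    \<open>F\<close>.\<close>
  define i0 where "i0 = (\<lambda>_ :: 'm. 0 :: nat)"
  define X where "X = expo_box t - {i0}"
  have i0: "i0 \<in> expo_box t" "i0 \<notin> X" "insert i0 X = expo_box t" "finite X"
    using t(1) finite_expo_box[of t] by (auto simp: i0_def X_def expo_box_def)
  \<comment> \<open>The matrix is the variable \<open>W\<close> times the identity minus the matrix
    of multiplication by \<open>F\<close>. Diagonal entries stay monic of degree \<open>k\<close>
    and the others of degree below \<open>k\<close>, which keeps the final relation monic.\<close>
  define Dg where "Dg = (\<lambda>k. {(\<lambda>(q :: complex ^ 'm, W). poly (h q) W) | h. monicfam k h})"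
  define Of where "Of = (\<lambda>k. {(\<lambda>(q :: complex ^ 'm, W). poly (h q) W) | h. polyfam h \<and> (\<forall>q. degree (h q) < k)})"
  define h where "h = (\<lambda>\<alpha> \<beta> q. (if \<alpha> = \<beta> then [:0, 1:] else 0) - monom (a \<alpha> \<beta> q) 0)"
  define M where "M = (\<lambda>\<alpha> \<beta> (q, W). poly (h \<alpha> \<beta> q) W)"
  have "\<exists>k'. \<exists>H\<in>Dg k'. \<forall>p v. (\<forall>i\<in>insert i0 X. (\<Sum>j\<in>insert i0 X. M i j p * v j) = 0) \<longrightarrow> H p * v i0 = 0"
  proof (rule elimination)
    fix k a b c d
    assume abcd: "a \<in> Dg k" "b \<in> Dg k" "c \<in> Of k" "d \<in> Of k"
    obtain ha hb hc hd where h: "monicfam k ha" "monicfam k hb" "polyfam hc" "polyfam hd"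
      "\<And>q. degree (hc q) < k" "\<And>q. degree (hd q) < k"
      "a = (\<lambda>(q, W). poly (ha q) W)" "b = (\<lambda>(q, W). poly (hb q) W)"
      "c = (\<lambda>(q, W). poly (hc q) W)" "d = (\<lambda>(q, W). poly (hd q) W)"
      using abcd unfolding Dg_def Of_def by blast
    have "monicfam (k + k) (\<lambda>q. ha q * hb q - hc q * hd q)"
      using h by (intro monicfam_diff monicfam_mult polyfam_mult degree_mult_less) (auto intro: less_imp_le)
    then show "(\<lambda>p. a p * b p - c p * d p) \<in> Dg (2 * k)"
      unfolding Dg_def h mem_Collect_eq mult_2
      by (intro exI[of _ "\<lambda>q. ha q * hb q - hc q * hd q"]) (auto simp: fun_eq_iff)
  next
    fix k a b c d
    assume abcd: "a \<in> Dg k" "b \<in> Of k" "c \<in> Of k" "d \<in> Of k"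
    obtain ha hb hc hd where h: "monicfam k ha" "polyfam hb" "polyfam hc" "polyfam hd"
      "\<And>q. degree (hb q) < k" "\<And>q. degree (hc q) < k" "\<And>q. degree (hd q) < k"
      "a = (\<lambda>(q, W). poly (ha q) W)" "b = (\<lambda>(q, W). poly (hb q) W)"
      "c = (\<lambda>(q, W). poly (hc q) W)" "d = (\<lambda>(q, W). poly (hd q) W)"
      using abcd unfolding Dg_def Of_def by blast
    have "degree (ha q) \<le> k" "polyfam ha" for q using h(1) by (auto simp: monicfam_def)
    then have "polyfam (\<lambda>q. ha q * hb q - hc q * hd q)"
      "degree (ha q * hb q - hc q * hd q) < k + k" for q
      using h by (auto intro!: polyfam_diff polyfam_mult degree_diff_less
          degree_mult_less[OF _ h(5)] degree_mult_less[OF less_imp_le h(7)])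
    then show "(\<lambda>p. a p * b p - c p * d p) \<in> Of (2 * k)"
      unfolding Of_def h mem_Collect_eq mult_2
      by (intro exI[of _ "\<lambda>q. ha q * hb q - hc q * hd q"]) (auto simp: fun_eq_iff)
  next
    have pf: "polyfam (h \<alpha> \<beta>)" for \<alpha> \<beta>
      unfolding h_def using a by (intro polyfam_diff polyfam_monom polyfam_const)
    show "M i i \<in> Dg 1" if "i \<in> insert i0 X" for i
    proof -
      have "h i i q = [:- a i i q, 1:]" for q by (simp add: h_def monom_0)
      then have "monicfam 1 (h i i)" using pf[of i i] by (simp add: monicfam_def)
      then show ?thesis unfolding Dg_def M_def by blast
    qed
    show "M i j \<in> Of 1" if "i \<in> insert i0 X" "j \<in> insert i0 X" "i \<noteq> j" for i j
    proof -
      have "h i j q = [:- a i j q:]" for q using that by (simp add: h_def monom_0)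
      then have "\<forall>q. degree (h i j q) < 1" by simp
      then show ?thesis unfolding Of_def M_def using pf[of i j] by blast
    qed
  qed (use i0 in auto)
  then obtain n g where g: "monicfam n g" and
    rel: "\<And>q W v. \<forall>i\<in>expo_box t. (\<Sum>j\<in>expo_box t. M i j (q, W) * v j) = 0 \<Longrightarrow> poly (g q) W * v i0 = 0"
    unfolding i0(3) Dg_def by fastforce
  have "poly (g (L *v z)) (F z) = 0" if z: "z \<in> Z" for z
  proof -
    have "poly (g (L *v z)) (F z) * mono_fun i0 z = 0"
    proof (rule rel[of _ _ "\<lambda>\<beta>. mono_fun \<beta> z"], rule ballI)
      fix \<alpha> :: "'m \<Rightarrow> nat" assume \<alpha>: "\<alpha> \<in> expo_box t"
      have "M \<alpha> \<beta> (L *v z, F z) * mono_fun \<beta> z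
        = (if \<alpha> = \<beta> then F z * mono_fun \<alpha> z else 0) - a \<alpha> \<beta> (L *v z) * mono_fun \<beta> z" for \<beta>
        by (simp add: M_def h_def monom_0 algebra_simps)
      then have "(\<Sum>\<beta>\<in>expo_box t. M \<alpha> \<beta> (L *v z, F z) * mono_fun \<beta> z)
        = (\<Sum>\<beta>\<in>expo_box t. if \<alpha> = \<beta> then F z * mono_fun \<alpha> z else 0)
          - (\<Sum>\<beta>\<in>expo_box t. a \<alpha> \<beta> (L *v z) * mono_fun \<beta> z)"
        by (simp add: sum_subtractf)
      also have "\<dots> = F z * mono_fun \<alpha> z - F z * mono_fun \<alpha> z"
        using a(2)[OF z, of \<alpha>] \<alpha> by (simp add: finite_expo_box)
      finally show "(\<Sum>\<beta>\<in>expo_box t. M \<alpha> \<beta> (L *v z, F z) * mono_fun \<beta> z) = 0" by simp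
    qed
    then show ?thesis by (simp add: i0_def)
  qed
  then show thesis using that g by blast
qed

lemma finite_fibre_coordinate:
  assumes F: "complex_poly F"
  shows "finite (F ` {z\<in>Z. L *v z = q})"
proof -
  obtain n h where h: "monicfam n h" "\<And>z. z \<in> Z \<Longrightarrow> poly (h (L *v z)) (F z) = 0"
    using integral_relation[OF F] by blast
  have "h q \<noteq> 0" using h(1) by (metis coeff_0 monicfam_def zero_neq_one)
  then have "finite {W. poly (h q) W = 0}" by (rule poly_roots_finite)
  moreover have "F ` {z\<in>Z. L *v z = q} \<subseteq> {W. poly (h q) W = 0}" using h(2) by auto
  ultimately show ?thesis by (rule finite_subset[rotated])
qed

lemma finite_fibre: "finite {z\<in>Z. L *v z = q}"
proof -
  let ?S = "{z\<in>Z. L *v z = q}"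
  have "finite (\<Union>i. (\<lambda>z. z $ i) ` ?S)"
    by (intro finite_UN_I finite_fibre_coordinate complex_poly.intros) auto
  then have "finite {f. \<forall>x. (x \<in> (UNIV :: 'm set) \<longrightarrow> f x \<in> (\<Union>i. (\<lambda>z. z $ i) ` ?S)) \<and> (x \<notin> UNIV \<longrightarrow> f x = 0)}"
    by (intro finite_set_of_finite_funs) auto
  then have "finite (vec_lambda ` {f. \<forall>x. (x \<in> (UNIV :: 'm set) \<longrightarrow> f x \<in> (\<Union>i. (\<lambda>z. z $ i) ` ?S)) \<and> (x \<notin> UNIV \<longrightarrow> f x = 0)})"
    by (rule finite_imageI)
  moreover have "?S \<subseteq> vec_lambda ` {f. \<forall>x. (x \<in> (UNIV :: 'm set) \<longrightarrow> f x \<in> (\<Union>i. (\<lambda>z. z $ i) ` ?S)) \<and> (x \<notin> UNIV \<longrightarrow> f x = 0)}"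
  proof
    fix z assume "z \<in> ?S"
    then show "z \<in> vec_lambda ` {f. \<forall>x. (x \<in> (UNIV :: 'm set) \<longrightarrow> f x \<in> (\<Union>i. (\<lambda>z. z $ i) ` ?S)) \<and> (x \<notin> UNIV \<longrightarrow> f x = 0)}"
      by (intro image_eqI[of _ _ "vec_nth z"]) auto
  qed
  ultimately show ?thesis by (rule finite_subset[rotated])
qed

text \<open>A monic relation of least degree has a constant term that is not identically zero.\<close>

lemma norm_polynomial:
  assumes F: "complex_poly F" "\<exists>z\<in>Z. F z \<noteq> 0"
  obtains d where "complex_poly d" "\<exists>z\<in>Z. d (L *v z) \<noteq> 0"
    "\<And>z. z \<in> Z \<Longrightarrow> F z = 0 \<Longrightarrow> d (L *v z) = 0"
proof -
  let ?R = "\<lambda>n. \<exists>h. monicfam n h \<and> (\<forall>z\<in>Z. poly (h (L *v z)) (F z) = 0)"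
  have "\<exists>n. ?R n" using integral_relation[OF F(1)] by metis
  then obtain n where n: "?R n" and least: "\<And>m. m < n \<Longrightarrow> \<not> ?R m"
    using exists_least_iff[of ?R] by blast
  obtain h where h: "monicfam n h" "\<And>z. z \<in> Z \<Longrightarrow> poly (h (L *v z)) (F z) = 0" using n by blast
  have ph: "polyfam h" using h(1) by (simp add: monicfam_def)
  have "\<exists>z\<in>Z. coeff (h (L *v z)) 0 \<noteq> 0"
  proof (rule ccontr)
    assume "\<not> ?thesis"
    then have c0: "\<And>z. z \<in> Z \<Longrightarrow> coeff (h (L *v z)) 0 = 0" by blast
    have "n \<noteq> 0" using c0 h(1) nontrivial unfolding monicfam_def by (metis zero_neq_one)
    then obtain m where m: "n = Suc m" using not0_implies_Suc by blast
    \<comment> \<open>\<open>h'\<close> is \<open>h\<close> divided by the variable once the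
      constant term is dropped. Primeness cancels the factor \<open>F\<close>, so \<open>h'\<close>
      would be a monic relation of smaller degree.\<close>
    define h' where "h' = (\<lambda>q. \<Sum>i\<le>m. monom (coeff (h q) (Suc i)) i)"
    have coeff: "coeff (h' q) i = coeff (h q) (Suc i)" for q i
    proof (cases "i \<le> m")
      case False
      then have "coeff (h q) (Suc i) = 0" using h(1) m by (intro coeff_eq_0) (simp add: monicfam_def)
      then show ?thesis using False by (simp add: h'_def coeff_sum)
    qed (simp add: h'_def coeff_sum)
    have "degree (h' q) = m" for q
    proof (rule antisym)
      show "degree (h' q) \<le> m"
        using h(1) m by (intro degree_le) (auto simp: coeff monicfam_def intro!: coeff_eq_0)
      show "m \<le> degree (h' q)"
        using h(1) m by (intro le_degree) (auto simp: coeff monicfam_def)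
    qed
    moreover have "polyfam h'"
      unfolding h'_def using ph by (intro polyfam_sum polyfam_monom polyfam_coeff)
    ultimately have "monicfam m h'"
      using h(1) m by (auto simp: monicfam_def coeff)
    have eq: "h q = pCons (coeff (h q) 0) (h' q)" for q
      by (rule poly_eqI) (auto simp: coeff coeff_pCons split: nat.split)
    have "F z * poly (h' (L *v z)) (F z) = 0" if "z \<in> Z" for z
      using h(2)[OF that] c0[OF that] by (subst (asm) eq) simp
    moreover have "complex_poly (\<lambda>z. poly (h' (L *v z)) (F z))"
      using \<open>monicfam m h'\<close> F(1)
      by (intro complex_poly_polyfam polyfam_compose_matrix) (auto simp: monicfam_def)
    ultimately have "\<forall>z\<in>Z. poly (h' (L *v z)) (F z) = 0"
      using prime[OF F(1)] F(2) by blast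
    then show False using least[of m] m \<open>monicfam m h'\<close> by blast
  qed
  moreover have "coeff (h (L *v z)) 0 = 0" if "z \<in> Z" "F z = 0" for z
    using h(2)[OF that(1)] that(2) by (simp add: poly_0_coeff_0)
  ultimately show thesis using that[of "\<lambda>q. coeff (h q) 0"] polyfam_coeff[OF ph] by blast
qed

text \<open>If no point lies over \<open>(q0, w0)\<close>, the equations of that point generate the
  unit ideal on \<open>Z\<close>. The determinant trick on the finite module then yields a relation
  \<open>H\<close> with value 1 at \<open>(q0, w0)\<close>. Pseudo-division of \<open>H\<close> by
  \<open>P\<close> leaves a remainder that is zero at \<open>q0\<close> by minimality, which is
  absurd at the root \<open>w0\<close>.\<close>

lemma lying_over:
  assumes F: "complex_poly F" and P: "polyfam P" "\<And>q. degree (P q) \<le> r" "r > 0"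
    and rel: "\<And>z. z \<in> Z \<Longrightarrow> poly (P (L *v z)) (F z) = 0"
    and minimal: "\<And>g. polyfam g \<Longrightarrow> (\<And>q. degree (g q) < r) \<Longrightarrow>
      (\<And>z. z \<in> Z \<Longrightarrow> poly (g (L *v z)) (F z) = 0) \<Longrightarrow> g q0 = 0"
    and lead: "coeff (P q0) r \<noteq> 0" and root: "poly (P q0) w0 = 0"
  shows "\<exists>z\<in>Z. L *v z = q0 \<and> F z = w0"
proof (rule ccontr)
  assume neg: "\<not> ?thesis"
  define c where "c = (\<lambda>i z. case i of None \<Rightarrow> F z - w0 | Some k \<Rightarrow> (L *v z) $ k - q0 $ k)"
  have "\<exists>g. (\<forall>i. complex_poly (g i)) \<and> (\<forall>z\<in>Z. 1 = (\<Sum>i\<in>UNIV. c i z * g i z))"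
  proof (rule nullstellensatz_on)
    show "complex_poly (c i)" for i
      using F by (cases i) (auto simp: c_def intro: complex_poly_intros complex_poly_matrix)
    show "\<exists>i\<in>UNIV. c i z \<noteq> 0" if z: "z \<in> Z" for z
    proof (rule ccontr)
      assume "\<not> ?thesis"
      then have 0: "c i z = 0" for i by simp
      have "(L *v z) $ k = q0 $ k" for k using 0[of "Some k"] by (simp add: c_def)
      moreover have "F z = w0" using 0[of None] by (simp add: c_def)
      ultimately show False using neg z by (auto simp: vec_eq_iff)
    qed
  qed simp
  then obtain g where g: "\<And>i. complex_poly (g i)" 
      "\<And>z. z \<in> Z \<Longrightarrow> 1 = (\<Sum>i\<in>UNIV. c i z * g i z)" by blast
  obtain t where t: "t > 0" "\<And>F. complex_poly F \<Longrightarrow> \<exists>a. (\<forall>\<alpha>. complex_poly (a \<alpha>)) \<and>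
    (\<forall>z\<in>Z. F z = (\<Sum>\<alpha>\<in>expo_box t. a \<alpha> (L *v z) * mono_fun \<alpha> z))"
    by (rule finite_module) blast
  have "\<forall>p. \<exists>a. (\<forall>\<beta>. complex_poly (a \<beta>)) \<and>
    (\<forall>z\<in>Z. g (fst p) z * mono_fun (snd p) z = (\<Sum>\<beta>\<in>expo_box t. a \<beta> (L *v z) * mono_fun \<beta> z))"
    by (intro allI t(2) complex_poly.intros complex_poly_mono_fun g(1))
  from choice[OF this] obtain a' where a': "\<And>p \<beta>. complex_poly (a' p \<beta>)"
    "\<And>p z. z \<in> Z \<Longrightarrow> g (fst p) z * mono_fun (snd p) z = (\<Sum>\<beta>\<in>expo_box t. a' p \<beta> (L *v z) * mono_fun \<beta> z)"
    by blast
  define a where "a = (\<lambda>i \<alpha>. a' (i, \<alpha>))"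
  have a: "complex_poly (a i \<alpha> \<beta>)"
    "z \<in> Z \<Longrightarrow> g i z * mono_fun \<alpha> z = (\<Sum>\<beta>\<in>expo_box t. a i \<alpha> \<beta> (L *v z) * mono_fun \<beta> z)" for i \<alpha> \<beta> z
    using a'(1) a'(2)[of z "(i, \<alpha>)"] by (auto simp: a_def)
  define i0 where "i0 = (\<lambda>_ :: 'm. 0 :: nat)"
  define X where "X = expo_box t - {i0}"
  have i0: "i0 \<in> expo_box t" "i0 \<notin> X" "insert i0 X = expo_box t" "finite X"
    using t(1) finite_expo_box[of t] by (auto simp: i0_def X_def expo_box_def)
  \<comment> \<open>\<open>E e\<close> collects the entries whose value at \<open>(q0, w0)\<close>
    is \<open>e\<close>. At that point the matrix is the identity, and a pivot step preserves the
    values 1 on the diagonal and 0 off it.\<close>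
  define E where "E = (\<lambda>e :: complex. {(\<lambda>(q :: complex ^ 'm, W). poly (h q) W) | h. polyfam h \<and> poly (h q0) w0 = e})"
  define C where "C = (\<lambda>i q. case i of None \<Rightarrow> [:- w0, 1:] | Some k \<Rightarrow> monom (q $ k - q0 $ k) 0)"
  define h where "h = (\<lambda>\<alpha> \<beta> q. (if \<alpha> = \<beta> then 1 else 0) - (\<Sum>i\<in>UNIV. C i q * monom (a i \<alpha> \<beta> q) 0))"
  define M where "M = (\<lambda>\<alpha> \<beta> (q, W). poly (h \<alpha> \<beta> q) W)"
  have E: "(\<lambda>p. a p * b p - c p * d p) \<in> E (e1 * e2 - e3 * e4)"
    if mem: "a \<in> E e1" "b \<in> E e2" "c \<in> E e3" "d \<in> E e4" for a b c d e1 e2 e3 e4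
  proof -
    have ex: "\<exists>h. polyfam h \<and> poly (h q0) w0 = e \<and> f = (\<lambda>(q, W). poly (h q) W)" if "f \<in> E e" for f e
      using that unfolding E_def by blast
    obtain ha hb hc hd where h: "polyfam ha" "polyfam hb" "polyfam hc" "polyfam hd"
      "poly (ha q0) w0 = e1" "poly (hb q0) w0 = e2" "poly (hc q0) w0 = e3" "poly (hd q0) w0 = e4"
      and eq: "a = (\<lambda>(q, W). poly (ha q) W)" "b = (\<lambda>(q, W). poly (hb q) W)"
      "c = (\<lambda>(q, W). poly (hc q) W)" "d = (\<lambda>(q, W). poly (hd q) W)"
      using ex[OF mem(1)] ex[OF mem(2)] ex[OF mem(3)] ex[OF mem(4)] by metis
    have "polyfam (\<lambda>q. ha q * hb q - hc q * hd q)"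
      using h by (intro polyfam_diff polyfam_mult)
    then show ?thesis
      unfolding E_def eq mem_Collect_eq 
      by (intro exI[of _ "\<lambda>q. ha q * hb q - hc q * hd q"]) (use h in \<open>auto simp: fun_eq_iff\<close>)
  qed
  have pC: "polyfam (C i)" for i
    unfolding C_def by (cases i) (auto intro!: polyfam_const polyfam_monom complex_poly_intros)
  have pf: "polyfam (h \<alpha> \<beta>)" for \<alpha> \<beta>
    unfolding h_def by (intro polyfam_diff polyfam_sum polyfam_mult polyfam_monom polyfam_const a(1) pC)
  have C0: "poly (C i q0) w0 = 0" for i by (cases i) (auto simp: C_def monom_0)
  have CF: "poly (C i (L *v z)) (F z) = c i z" for i z by (cases i) (auto simp: C_def c_def monom_0)
  have "\<exists>k' :: nat. \<exists>H\<in>E 1. \<forall>p v. (\<forall>i\<in>insert i0 X. (\<Sum>j\<in>insert i0 X. M i j p * v j) = 0) \<longrightarrow> H p * v i0 = 0"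
  proof (rule elimination[where Dg = "\<lambda>_. E 1" and Of = "\<lambda>_. E 0"])
    show "M i i \<in> E 1" for i
      unfolding E_def M_def using pf[of i i]
      by (intro CollectI exI[of _ "h i i"]) (auto simp: h_def poly_sum C0)
    show "M i j \<in> E 0" if "i \<noteq> j" for i j
      unfolding E_def M_def using pf[of i j] that
      by (intro CollectI exI[of _ "h i j"]) (auto simp: h_def poly_sum C0)
    show "(\<lambda>p. a p * b p - c p * d p) \<in> E 1" if "a \<in> E 1" "b \<in> E 1" "c \<in> E 0" "d \<in> E 0" for a b c d
      using E[OF that] by simp
    show "(\<lambda>p. a p * b p - c p * d p) \<in> E 0" if "a \<in> E 1" "b \<in> E 0" "c \<in> E 0" "d \<in> E 0" for a b c d
      using E[OF that] by simp
  qed (use i0 in auto)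
  then obtain H where H: "polyfam H" "poly (H q0) w0 = 1" and
    Hrel: "\<And>q W v. \<forall>i\<in>expo_box t. (\<Sum>j\<in>expo_box t. M i j (q, W) * v j) = 0 \<Longrightarrow> poly (H q) W * v i0 = 0"
    unfolding i0(3) E_def by fastforce
  have HZ: "poly (H (L *v z)) (F z) = 0" if z: "z \<in> Z" for z
  proof -
    have "poly (H (L *v z)) (F z) * mono_fun i0 z = 0"
    proof (rule Hrel[of _ _ "\<lambda>\<beta>. mono_fun \<beta> z"], rule ballI)
      fix \<alpha> :: "'m \<Rightarrow> nat" assume \<alpha>: "\<alpha> \<in> expo_box t"
      have "M \<alpha> \<beta> (L *v z, F z) * mono_fun \<beta> z
        = (if \<alpha> = \<beta> then mono_fun \<alpha> z else 0)
          - (\<Sum>i\<in>UNIV. c i z * (a i \<alpha> \<beta> (L *v z) * mono_fun \<beta> z))" for \<beta>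
        by (simp add: M_def h_def poly_sum CF monom_0 left_diff_distrib right_diff_distrib sum_distrib_left sum_distrib_right mult_ac)
      then have "(\<Sum>\<beta>\<in>expo_box t. M \<alpha> \<beta> (L *v z, F z) * mono_fun \<beta> z)
        = (\<Sum>\<beta>\<in>expo_box t. if \<alpha> = \<beta> then mono_fun \<alpha> z else 0)
          - (\<Sum>\<beta>\<in>expo_box t. \<Sum>i\<in>UNIV. c i z * (a i \<alpha> \<beta> (L *v z) * mono_fun \<beta> z))"
        by (simp add: sum_subtractf)
      also have "(\<Sum>\<beta>\<in>expo_box t. \<Sum>i\<in>UNIV. c i z * (a i \<alpha> \<beta> (L *v z) * mono_fun \<beta> z))
        = (\<Sum>i\<in>UNIV. c i z * (g i z * mono_fun \<alpha> z))"
        by (subst sum.swap) (simp add: a(2)[OF z] sum_distrib_left)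
      also have "\<dots> = mono_fun \<alpha> z"
        using g(2)[OF z] by (simp flip: mult.assoc sum_distrib_right)
      finally show "(\<Sum>\<beta>\<in>expo_box t. M \<alpha> \<beta> (L *v z, F z) * mono_fun \<beta> z) = 0"
        using \<alpha> by (simp add: finite_expo_box)
    qed
    then show ?thesis by (simp add: i0_def)
  qed
  obtain dH where "\<And>q. degree (H q) \<le> dH" using H(1) by (auto simp: polyfam_def)
  from pseudo_division[OF P H(1) this] obtain e Q R where QR: "polyfam R" "\<And>q. degree (R q) < r"
    "\<And>q. smult (coeff (P q) r ^ e) (H q) = P q * Q q + R q" by blast
  have "poly (R (L *v z)) (F z) = 0" if "z \<in> Z" for z
    using arg_cong[OF QR(3)[of "L *v z"], of "\<lambda>p. poly p (F z)"] that by (simp add: HZ rel)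
  then have "R q0 = 0" using minimal[OF QR(1,2)] by blast
  then have "coeff (P q0) r ^ e = 0"
    using arg_cong[OF QR(3)[of q0], of "\<lambda>p. poly p w0"] by (simp add: H(2) root)
  then show False using lead by simp
qed

end

section \<open>Quotients of polynomials with bounded growth\<close>

lemma nonneg_off_finite:
  fixes f :: "complex \<Rightarrow> real"
  assumes "continuous_on UNIV f" "finite S" "\<And>t. t \<notin> S \<Longrightarrow> 0 \<le> f t"
  shows "0 \<le> f t"
proof -
  have "closure (- S) = UNIV"
    using assms(2) by (simp add: closure_complement empty_interior_finite)
  then show ?thesis
    using continuous_ge_on_closure[of "- S" f t 0] assms by simp
qed

text \<open>By the bound a root of \<open>q\<close> is also a root of \<open>p\<close>. The common
  factor cancels, and the bound extends over the removed root by continuity. Once \<open>q\<close>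
  is constant, Liouville's theorem for polynomial growth bounds the degree.\<close>

lemma poly_quotient_of_growth:
  fixes p q :: "complex poly"
  assumes "q \<noteq> 0" "\<And>t. norm (poly p t) \<le> C * (1 + norm t) ^ E * norm (poly q t)"
  shows "\<exists>s. p = q * s \<and> degree s \<le> E"
  using assms
proof (induction "degree q" arbitrary: p q)
  case 0
  then obtain e where e: "q = [:e:]" "e \<noteq> 0" by (metis degree_eq_zeroE pCons_0_0)
  define B where "B = C * norm e"
  have "norm (poly p 0) \<le> B" using "0.prems"(2)[of 0] e by (simp add: B_def)
  then have B: "B \<ge> 0" by (rule order_trans[OF norm_ge_zero])
  \<comment> \<open>The constant \<open>2 ^ E\<close> comes from
    \<open>1 + norm z \<le> 2 * norm z\<close> outside the unit disc.\<close>
  have "norm (poly p z) \<le> (B * 2 ^ E) * norm z ^ E" if "1 \<le> norm z" for z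
  proof -
    have "norm (poly p z) \<le> B * (1 + norm z) ^ E" using "0.prems"(2)[of z] e by (simp add: B_def mult_ac)
    also have "\<dots> \<le> B * (2 * norm z) ^ E" using B that by (intro mult_left_mono power_mono) auto
    finally show ?thesis by (simp add: power_mult_distrib mult_ac)
  qed
  moreover have "poly p holomorphic_on UNIV" by (intro holomorphic_intros)
  ultimately have "poly p \<xi> = (\<Sum>k\<le>E. (deriv^^k) (poly p) 0 / fact k * \<xi> ^ k)" for \<xi>
    using Liouville_polynomial[of "poly p" 1 "B * 2 ^ E" E \<xi>] by blast
  then have "poly p = poly (\<Sum>k\<le>E. monom ((deriv^^k) (poly p) 0 / fact k) k)"
    by (auto simp: poly_sum poly_monom)
  then have "p = (\<Sum>k\<le>E. monom ((deriv^^k) (poly p) 0 / fact k) k)"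
    by (simp only: poly_eq_poly_eq_iff)
  moreover have "degree (\<Sum>k\<le>E. monom ((deriv^^k) (poly p) 0 / fact k) k) \<le> E"
    by (intro degree_sum_le) (auto intro: le_trans[OF degree_monom_le])
  ultimately have "degree p \<le> E" by simp
  then show ?case using e by (intro exI[of _ "smult (inverse e) p"]) auto
next
  case (Suc n)
  then have "\<not> constant (poly q)" by (simp add: constant_degree)
  then obtain b where b: "poly q b = 0" using fundamental_theorem_of_algebra by blast
  then have "poly p b = 0" using Suc.prems(2)[of b] by simp
  then obtain p' q' where p': "p = [:-b, 1:] * p'" and q': "q = [:-b, 1:] * q'"
    using b by (metis dvdE poly_eq_0_iff_dvd)
  have q'0: "q' \<noteq> 0" "degree q' = n" using Suc.prems(1) Suc.hyps(2) q'
    by (auto simp: degree_mult_eq simp del: mult_pCons_left)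
  have "norm (poly p' t) \<le> C * (1 + norm t) ^ E * norm (poly q' t)" for t
  proof -
    have "0 \<le> C * (1 + norm t) ^ E * norm (poly q' t) - norm (poly p' t)"
    proof (rule nonneg_off_finite[where S = "{b}" and
          f = "\<lambda>t. C * (1 + norm t) ^ E * norm (poly q' t) - norm (poly p' t)"])
      show "continuous_on UNIV (\<lambda>t. C * (1 + norm t) ^ E * norm (poly q' t) - norm (poly p' t))"
        by (intro continuous_intros)
      fix t assume t: "t \<notin> {b}"
      have "norm (t - b) * norm (poly p' t) \<le> norm (t - b) * (C * (1 + norm t) ^ E * norm (poly q' t))"
      proof -
        have "poly p t = (t - b) * poly p' t" "poly q t = (t - b) * poly q' t"
          unfolding p' q' by (simp_all add: algebra_simps)
        then show ?thesis using Suc.prems(2)[of t] by (simp add: norm_mult mult_ac)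
      qed
      then show "0 \<le> C * (1 + norm t) ^ E * norm (poly q' t) - norm (poly p' t)"
        using t by simp
    qed simp
    then show ?thesis by simp
  qed
  from Suc.hyps(1)[OF q'0(2)[symmetric] q'0(1) this] obtain s where "p' = q' * s" "degree s \<le> E" by blast
  then show ?case using p' q' by (intro exI[of _ s]) (simp only: mult.assoc)
qed

text \<open>On every line through \<open>x0\<close> the division takes place in one variable, with a
  uniform bound \<open>E\<close> on the degree of the quotient. Since \<open>a x0\<close> is the
  constant coefficient of \<open>a\<close> on each of these lines and is nonzero, the coefficients
  of the quotient are found recursively as polynomials in the direction.\<close>

lemma polynomial_quotient:
  assumes a: "complex_poly a" and c: "complex_poly c" and x0: "a x0 \<noteq> 0"
    and bound: "\<And>x. a x \<noteq> 0 \<Longrightarrow> norm (c x) \<le> C * (1 + norm x) ^ E * norm (a x)"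
  shows "\<exists>g. complex_poly g \<and> (\<forall>x. c x = a x * g x)"
proof -
  obtain \<alpha> where \<alpha>: "polyfam \<alpha>" "\<And>v t. a (x0 + t *s v) = poly (\<alpha> v) t"
    using polyfam_on_line[OF a] by blast
  obtain \<gamma> where \<gamma>: "polyfam \<gamma>" "\<And>v t. c (x0 + t *s v) = poly (\<gamma> v) t"
    using polyfam_on_line[OF c] by blast
  have \<alpha>0: "coeff (\<alpha> v) 0 = a x0" for v using \<alpha>(2)[of 0 v] by (simp add: poly_0_coeff_0)
  have "0 \<le> C * (1 + norm x0) ^ E * norm (a x0)" using bound[OF x0] norm_ge_zero order_trans by blast
  moreover have "(1 + norm x0) ^ E > 0" by (simp add: add_pos_nonneg)
  ultimately have C: "C \<ge> 0" using x0 by (simp add: zero_le_mult_iff)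
  have "\<exists>s. \<gamma> v = \<alpha> v * s \<and> degree s \<le> E" for v
  proof -
    \<comment> \<open>The constant absorbs the passage from \<open>1 + norm (x0 + t *s v)\<close> to
      \<open>1 + norm t\<close> along the line.\<close>
    define D where "D = C * (1 + norm x0 + norm v) ^ E"
    have nz: "\<alpha> v \<noteq> 0" using \<alpha>0[of v] x0 by auto
    have "norm (poly (\<gamma> v) t) \<le> D * (1 + norm t) ^ E * norm (poly (\<alpha> v) t)" for t
    proof -
      have "0 \<le> D * (1 + norm t) ^ E * norm (poly (\<alpha> v) t) - norm (poly (\<gamma> v) t)"
      proof (rule nonneg_off_finite[where S = "{t. poly (\<alpha> v) t = 0}" and
            f = "\<lambda>t. D * (1 + norm t) ^ E * norm (poly (\<alpha> v) t) - norm (poly (\<gamma> v) t)"])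
        show "continuous_on UNIV (\<lambda>t. D * (1 + norm t) ^ E * norm (poly (\<alpha> v) t) - norm (poly (\<gamma> v) t))"
          by (intro continuous_intros)
        show "finite {t. poly (\<alpha> v) t = 0}" using nz by (rule poly_roots_finite)
        fix t assume t: "t \<notin> {t. poly (\<alpha> v) t = 0}"
        have "1 + norm (x0 + t *s v) \<le> 1 + (norm x0 + norm t * norm v)"
          using norm_triangle_ineq[of x0 "t *s v"] by (simp add: norm_vector_scale)
        also have "\<dots> \<le> (1 + norm x0 + norm v) * (1 + norm t)"
          by (simp add: algebra_simps)
        finally have le: "1 + norm (x0 + t *s v) \<le> (1 + norm x0 + norm v) * (1 + norm t)" .
        have "norm (c (x0 + t *s v)) \<le> C * (1 + norm (x0 + t *s v)) ^ E * norm (a (x0 + t *s v))"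
          using t \<alpha>(2) by (intro bound) simp
        also have "\<dots> \<le> C * ((1 + norm x0 + norm v) * (1 + norm t)) ^ E * norm (a (x0 + t *s v))"
          using C le by (intro mult_right_mono mult_left_mono power_mono) auto
        finally show "0 \<le> D * (1 + norm t) ^ E * norm (poly (\<alpha> v) t) - norm (poly (\<gamma> v) t)"
          by (simp add: \<alpha>(2) \<gamma>(2) D_def power_mult_distrib mult_ac)
      qed
      then show ?thesis by simp
    qed
    from poly_quotient_of_growth[OF nz this] show ?thesis .
  qed
  then obtain s where s: "\<And>v. \<gamma> v = \<alpha> v * s v" "\<And>v. degree (s v) \<le> E" by metis
  have "complex_poly (\<lambda>v. coeff (s v) e)" for e
  proof (induction e rule: less_induct)
    case (less e)
    have "coeff (s v) e = inverse (a x0) * (coeff (\<gamma> v) e - (\<Sum>i<e. coeff (s v) i * coeff (\<alpha> v) (e - i)))" for v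
    proof -
      have "coeff (\<gamma> v) e = (\<Sum>i\<le>e. coeff (s v) i * coeff (\<alpha> v) (e - i))"
        by (subst s(1)) (simp add: coeff_mult mult.commute[of "\<alpha> v"])
      also have "\<dots> = (\<Sum>i<e. coeff (s v) i * coeff (\<alpha> v) (e - i)) + coeff (s v) e * a x0"
        by (simp add: \<alpha>0 flip: lessThan_Suc_atMost)
      finally show ?thesis using x0 by simp
    qed
    moreover have "complex_poly (\<lambda>v. inverse (a x0) * (coeff (\<gamma> v) e - (\<Sum>i<e. coeff (s v) i * coeff (\<alpha> v) (e - i))))"
      by (intro complex_poly.intros complex_poly_diff complex_poly_sum less
          polyfam_coeff[OF \<alpha>(1)] polyfam_coeff[OF \<gamma>(1)]) auto
    ultimately show ?case by simp
  qed
  then have "polyfam s" using s(2) by (auto simp: polyfam_def)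
  then have "complex_poly (\<lambda>v. poly (s v) 1)" by (intro complex_poly_polyfam complex_poly.intros)
  then have "complex_poly (\<lambda>x. poly (s (x - x0)) 1)" by (rule complex_poly_translate)
  moreover have "c x = a x * poly (s (x - x0)) 1" for x
    using \<alpha>(2)[of 1 "x - x0"] \<gamma>(2)[of 1 "x - x0"] by (simp add: s(1))
  ultimately show ?thesis by blast
qed

section \<open>Roots and coefficients in one variable\<close>

lemma coeff_prod_roots_bound:
  assumes "\<And>i. i < n \<Longrightarrow> norm (b i :: complex) \<le> \<rho>" "\<rho> \<ge> 0"
  shows "norm (coeff (\<Prod>i<n. [:-b i, 1:]) k) \<le> (1 + \<rho>) ^ n"
  using assms(1)
proof (induction n arbitrary: k)
  case 0
  then show ?case by (simp add: coeff_1)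
next
  case (Suc n)
  let ?p = "\<Prod>i<n. [:-b i, 1:]"
  have IH: "norm (coeff ?p k) \<le> (1 + \<rho>) ^ n" for k using Suc by simp
  have eq: "(\<Prod>i<Suc n. [:-b i, 1:]) = smult (- b n) ?p + pCons 0 ?p"
    by (simp add: mult.commute)
  have "norm (coeff (pCons 0 ?p) k) \<le> (1 + \<rho>) ^ n"
    using IH assms(2) by (cases k) auto
  moreover have "norm (b n * coeff ?p k) \<le> \<rho> * (1 + \<rho>) ^ n"
    unfolding norm_mult using IH Suc.prems assms(2) by (intro mult_mono) auto
  ultimately have "norm (coeff (\<Prod>i<Suc n. [:-b i, 1:]) k) \<le> \<rho> * (1 + \<rho>) ^ n + (1 + \<rho>) ^ n"
    unfolding eq coeff_add coeff_smult
    by (intro order_trans[OF norm_triangle_ineq] add_mono) (simp_all add: norm_mult)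
  then show ?case by (simp add: algebra_simps)
qed

lemma coeff_bound_by_roots:
  fixes p :: "complex poly"
  assumes "\<And>b. poly p b = 0 \<Longrightarrow> norm b \<le> \<rho>" "\<rho> \<ge> 0"
  shows "norm (coeff p k) \<le> norm (lead_coeff p) * (1 + \<rho>) ^ degree p"
proof -
  obtain b where b: "smult (lead_coeff p) (\<Prod>i<degree p. [:-b i, 1:]) = p"
    by (rule complex_poly_decompose')
  have rb: "norm (b i) \<le> \<rho>" if "i < degree p" for i
  proof (rule assms(1))
    have "poly p (b i) = lead_coeff p * (\<Prod>j<degree p. b i - b j)"
      by (subst b[symmetric]) (simp add: poly_prod)
    then show "poly p (b i) = 0" using that by (auto simp: prod_zero_iff)
  qed
  have "norm (coeff (\<Prod>i<degree p. [:-b i, 1:]) k) \<le> (1 + \<rho>) ^ degree p"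
    using rb assms(2) by (rule coeff_prod_roots_bound)
  then have "norm (lead_coeff p) * norm (coeff (\<Prod>i<degree p. [:-b i, 1:]) k)
    \<le> norm (lead_coeff p) * (1 + \<rho>) ^ degree p" by (intro mult_left_mono) auto
  moreover have "coeff p k = lead_coeff p * coeff (\<Prod>i<degree p. [:-b i, 1:]) k"
    by (subst b[symmetric]) simp
  ultimately show ?thesis by (simp add: norm_mult)
qed

text \<open>The value \<open>norm (poly p x)\<close> is the product of the distances from
  \<open>x\<close> to the roots, so the smallest distance satisfies the bound. This is the
  continuity of roots in quantitative form.\<close>

lemma monic_root_near:
  fixes p :: "complex poly"
  assumes "lead_coeff p = 1" "degree p > 0"
  shows "\<exists>b. poly p b = 0 \<and> norm (x - b) ^ degree p \<le> norm (poly p x)"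
proof -
  let ?n = "degree p"
  obtain b where b: "smult (lead_coeff p) (\<Prod>i<?n. [:-b i, 1:]) = p"
    by (rule complex_poly_decompose')
  have py: "poly p y = (\<Prod>i<?n. y - b i)" for y
    by (subst b[symmetric]) (simp add: poly_prod assms(1))
  obtain i where i: "i < ?n" "\<And>j. j < ?n \<Longrightarrow> norm (x - b i) \<le> norm (x - b j)"
    using ex_min_if_finite[of "(\<lambda>i. norm (x - b i)) ` {..<?n}"] assms(2)
    by (auto simp: not_less lessThan_empty_iff)
  have "norm (x - b i) ^ ?n = (\<Prod>j<?n. norm (x - b i))" by simp
  also have "\<dots> \<le> (\<Prod>j<?n. norm (x - b j))" using i by (intro prod_mono) auto
  also have "\<dots> = norm (poly p x)" by (simp add: py prod_norm)
  finally have "norm (x - b i) ^ ?n \<le> norm (poly p x)" .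
  moreover have "poly p (b i) = 0" using i(1) by (auto simp: py prod_zero_iff)
  ultimately show ?thesis by blast
qed

lemma continuous_on_polyfam:
  fixes h :: "complex ^ 'm \<Rightarrow> complex poly"
  assumes "polyfam h"
  shows "continuous_on UNIV (\<lambda>p. poly (h (fst p)) (snd p))"
proof -
  obtain d where d: "\<And>q. degree (h q) \<le> d" using assms by (auto simp: polyfam_def)
  have "poly (h q) W = (\<Sum>i\<le>d. coeff (h q) i * W ^ i)" for q W
    using d[of q] by (subst poly_altdef) (intro sum.mono_neutral_left, auto intro: coeff_eq_0)
  then have eq: "(\<lambda>p. poly (h (fst p)) (snd p)) = (\<lambda>p. \<Sum>i\<le>d. coeff (h (fst p)) i * snd p ^ i)"
    by (intro ext)
  have "continuous_on UNIV (\<lambda>p :: (complex ^ 'm) \<times> complex. coeff (h (fst p)) i)" for i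
    by (rule continuous_on_compose2[OF continuous_on_complex_poly[OF polyfam_coeff[OF assms, of i], of UNIV]
        continuous_on_fst[OF continuous_on_id]]) simp
  then show ?thesis
    unfolding eq by (intro continuous_on_sum continuous_on_mult continuous_on_power
        continuous_on_snd continuous_on_id)
qed

section \<open>Minimal polynomials for dominant projections\<close>

text \<open>Dominance says that the image of \<open>Z\<close> is Zariski dense in the range of
  \<open>L\<close>; polynomials are compared only there, whence \<open>L *v x\<close> in the
  conclusion. Idempotence makes the range the fixed space of \<open>L\<close>.\<close>

locale dominant_projection = finite_projection Z L
  for Z :: "(complex ^ 'm::finite) set" and L +
  assumes idempotent: "L *v (L *v x) = L *v x"
    and dominant: "complex_poly F \<Longrightarrow> (\<And>z. z \<in> Z \<Longrightarrow> F (L *v z) = 0) \<Longrightarrow> F (L *v x) = 0"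
begin

lemma polyfam_zero_on_range:
  assumes "polyfam g" "\<And>z. z \<in> Z \<Longrightarrow> g (L *v z) = 0"
  shows "g (L *v x) = 0"
proof (rule poly_eqI)
  fix i
  have "coeff (g (L *v x)) i = 0"
    by (rule dominant[OF polyfam_coeff[OF assms(1), of i]]) (simp add: assms(2))
  then show "coeff (g (L *v x)) i = coeff 0 i" by simp
qed

text \<open>The relation of least degree is a priori monic only after inverting its leading coefficient
  \<open>a\<close>. The roots are values of a linear form on the fibre and hence grow at most linearly, so \<open>a\<close>
  divides the other coefficients.\<close>

lemma minimal_polynomial:
  obtains r P where "monicfam r P" "r > 0"
    "\<And>z. z \<in> Z \<Longrightarrow> poly (P (L *v z)) (dotc u z) = 0"
    "\<And>x w. poly (P (L *v x)) w = 0 \<Longrightarrow> \<exists>z\<in>Z. L *v z = L *v x \<and> dotc u z = w"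
    "\<And>g x. polyfam g \<Longrightarrow> (\<And>q. degree (g q) < r) \<Longrightarrow>
      (\<And>z. z \<in> Z \<Longrightarrow> poly (g (L *v z)) (dotc u z) = 0) \<Longrightarrow> g (L *v x) = 0"
proof -
  let ?R = "\<lambda>r. \<exists>g. polyfam g \<and> (\<forall>q. degree (g q) \<le> r) \<and>
    (\<forall>z\<in>Z. poly (g (L *v z)) (dotc u z) = 0) \<and> (\<exists>z\<in>Z. g (L *v z) \<noteq> 0)"
  obtain n h where h: "monicfam n h" "\<And>z. z \<in> Z \<Longrightarrow> poly (h (L *v z)) (dotc u z) = 0"
    using integral_relation[OF complex_poly_dotc] by blast
  have "h q \<noteq> 0" for q using h(1) by (metis coeff_0 monicfam_def zero_neq_one)
  then have "?R n" using h nontrivial by (intro exI[of _ h]) (auto simp: monicfam_def)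
  then obtain r where "?R r" and least: "\<And>m. m < r \<Longrightarrow> \<not> ?R m"
    using exists_least_iff[of ?R] by blast
  then obtain g where g: "polyfam g" "\<And>q. degree (g q) \<le> r"
    "\<And>z. z \<in> Z \<Longrightarrow> poly (g (L *v z)) (dotc u z) = 0" "\<exists>z\<in>Z. g (L *v z) \<noteq> 0" by blast
  have minimal: "f (L *v x) = 0" if f: "polyfam f" "\<And>q. degree (f q) < r"
      "\<And>z. z \<in> Z \<Longrightarrow> poly (f (L *v z)) (dotc u z) = 0" for f x
  proof (rule polyfam_zero_on_range[OF f(1)], rule ccontr)
    fix z assume z: "z \<in> Z" "f (L *v z) \<noteq> 0"
    have "r > 0" using f(2)[of 0] by simp
    moreover have "degree (f q) \<le> r - 1" for q using f(2)[of q] by simp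
    ultimately show False using least[of "r - 1"] f z by auto
  qed
  have "r > 0"
  proof (rule ccontr)
    assume "\<not> r > 0"
    then have "degree (g q) = 0" for q using g(2)[of q] by simp
    then have "g (L *v z) = 0" if "z \<in> Z" for z
      using g(3)[OF that] by (metis degree_eq_zeroE mult_zero_right add_0_right poly_0 poly_pCons pCons_0_0)
    then show False using g(4) by blast
  qed
  define a where "a = (\<lambda>x. coeff (g (L *v x)) r)"
  have cg: "complex_poly (\<lambda>x. coeff (g (L *v x)) i)" for i
    using g(1) polyfam_compose_matrix polyfam_coeff by blast
  have ca: "complex_poly a" unfolding a_def by (rule cg)
  have "\<exists>z\<in>Z. a z \<noteq> 0"
  proof (rule ccontr)
    assume "\<not> ?thesis"
    then have a0: "\<And>z. z \<in> Z \<Longrightarrow> a z = 0" by blast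
    \<comment> \<open>If the top coefficient vanished on the image, deleting it would give a
      relation of lower degree that agrees with \<open>g\<close> there.\<close>
    define f where "f = (\<lambda>q. g q - monom (coeff (g q) r) r)"
    have "polyfam f" unfolding f_def using g(1) by (intro polyfam_diff polyfam_monom polyfam_coeff)
    moreover have "degree (f q) < r" for q
    proof -
      have "coeff (f q) i = 0" if "i > r - 1" for i
        using that g(2)[of q] by (cases "i = r") (auto simp: f_def intro!: coeff_eq_0)
      then have "degree (f q) \<le> r - 1" by (intro degree_le) auto
      then show ?thesis using \<open>r > 0\<close> by simp
    qed
    moreover have fg: "f (L *v z) = g (L *v z)" if "z \<in> Z" for z
      using a0[OF that] by (simp add: f_def a_def)
    ultimately have "f (L *v z) = 0" for z using g(3) by (intro minimal) auto
    then show False using fg g(4) by auto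
  qed
  then obtain z0 where z0: "z0 \<in> Z" "a z0 \<noteq> 0" by blast
  obtain C where C: "C > 0" "\<And>z. z \<in> Z \<Longrightarrow> norm z \<le> C * norm (L *v z)" using norm_bound by blast
  define U where "U = (\<Sum>i\<in>UNIV. norm (u $ i))"
  have U: "U \<ge> 0" "\<And>v. norm (dotc u v) \<le> U * norm v"
    using norm_dotc_le by (auto simp: U_def sum_nonneg)
  obtain K where K: "K > 0" "\<And>x. norm (L *v x) \<le> K * norm x" using matrix_vector_bounded[of L] by blast
  have "\<exists>f. complex_poly f \<and> (\<forall>x. coeff (g (L *v x)) i = a x * f x)" for i
  proof (rule polynomial_quotient[OF ca cg z0(2)])
    \<comment> \<open>A root is \<open>dotc u z\<close> for some \<open>z\<close> over
      \<open>L *v x\<close>, hence at most \<open>U * C * K * norm x\<close> in size;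
      \<open>B\<close> turns 1 plus this bound into a multiple of \<open>1 + norm x\<close>.\<close>
    define B where "B = 1 + U * C * K"
    have B: "B \<ge> 1" using U C K by (simp add: B_def)
    fix x assume ax: "a x \<noteq> 0"
    have deg: "degree (g (L *v x)) = r" using ax g(2)[of "L *v x"] le_degree by (fastforce simp: a_def)
    have "norm b \<le> U * C * K * norm x" if b: "poly (g (L *v x)) b = 0" for b
    proof -
      obtain z where z: "z \<in> Z" "L *v z = L *v x" "dotc u z = b"
        using lying_over[OF complex_poly_dotc g(1,2) \<open>r > 0\<close> g(3), of "L *v x" b] minimal ax b
        unfolding a_def by metis
      have "norm b \<le> U * norm z" using U(2) z by metis
      also have "\<dots> \<le> U * (C * norm (L *v x))" using C(2)[OF z(1)] z U by (intro mult_left_mono) auto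
      also have "\<dots> \<le> U * (C * (K * norm x))" using K C U by (intro mult_left_mono) auto
      finally show ?thesis by (simp add: mult.assoc)
    qed
    then have "norm (coeff (g (L *v x)) i) \<le> norm (lead_coeff (g (L *v x))) * (1 + U * C * K * norm x) ^ degree (g (L *v x))"
      using U C K by (intro coeff_bound_by_roots) auto
    also have "\<dots> \<le> norm (lead_coeff (g (L *v x))) * (B * (1 + norm x)) ^ degree (g (L *v x))"
      using U C K by (intro mult_left_mono power_mono) (auto simp: B_def algebra_simps)
    finally show "norm (coeff (g (L *v x)) i) \<le> B ^ r * (1 + norm x) ^ r * norm (a x)"
      by (simp add: deg a_def power_mult_distrib mult_ac)
  qed
  then obtain f where f: "\<And>i. complex_poly (f i)" "\<And>i x. coeff (g (L *v x)) i = a x * f i x" by metis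
  \<comment> \<open>The top coefficient is set to 1, which makes \<open>P\<close> monic for every
    \<open>q\<close>. That \<open>g\<close> is \<open>a\<close> times \<open>P\<close> is asserted
    only on the range of \<open>L\<close>, where idempotence gives
    \<open>a (L *v x) = a x\<close>.\<close>
  define P where "P = (\<lambda>q. monom 1 r + (\<Sum>i<r. monom (f i q) i))"
  have coeffP: "coeff (P q) i = (if i = r then 1 else if i < r then f i q else 0)" for q i
    unfolding P_def by (auto simp: coeff_sum)
  have P: "monicfam r P"
  proof -
    have "polyfam P" unfolding P_def
      by (intro polyfam_add polyfam_sum polyfam_const polyfam_monom f(1))
    moreover have "degree (P q) = r" for q
    proof (rule antisym)
      show "degree (P q) \<le> r" by (rule degree_le) (auto simp: coeffP)
      show "r \<le> degree (P q)" by (rule le_degree) (auto simp: coeffP)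
    qed
    ultimately show ?thesis by (simp add: monicfam_def coeffP)
  qed
  have gP: "g (L *v x) = smult (a x) (P (L *v x))" for x
  proof (rule poly_eqI)
    fix i
    have eq: "coeff (g (L *v x)) i = a x * f i (L *v x)" for i
      using f(2)[of "L *v x" i] by (simp add: idempotent a_def)
    show "coeff (g (L *v x)) i = coeff (smult (a x) (P (L *v x))) i"
      using eq[of i] g(2)[of "L *v x"] by (auto simp: coeffP a_def coeff_eq_0)
  qed
  have pP: "polyfam P" using P by (simp add: monicfam_def)
  have Prel: "poly (P (L *v z)) (dotc u z) = 0" if "z \<in> Z" for z
  proof -
    have "complex_poly (\<lambda>z. poly (P (L *v z)) (dotc u z))"
      using pP by (intro complex_poly_polyfam polyfam_compose_matrix complex_poly_dotc)
    moreover have "a z * poly (P (L *v z)) (dotc u z) = 0" if "z \<in> Z" for z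
      using g(3)[OF that] by (simp add: gP)
    ultimately show ?thesis using prime[OF ca] z0 that by blast
  qed
  have "\<exists>z\<in>Z. L *v z = L *v x \<and> dotc u z = w" if "poly (P (L *v x)) w = 0" for x w
    by (rule lying_over[OF complex_poly_dotc pP _ \<open>r > 0\<close> Prel])
      (use P that minimal in \<open>auto simp: monicfam_def\<close>)
  then show thesis using that[OF P \<open>r > 0\<close> Prel] minimal by blast
qed

end

section \<open>Chains of irreducible cones\<close>

text \<open>For \<open>dotc u q = 1\<close> this matrix is the projection with centre
  \<open>q\<close> onto the hyperplane \<open>dotc u x = 0\<close>.\<close>

lemma rank_one_projector:
  obtains E :: "complex ^ 'm ^ 'm" where "\<And>x. E *v x = x - dotc u x *s q"
proof -
  have "Vector_Spaces.linear (*s) (*s) (\<lambda>x :: complex ^ 'm. x - dotc u x *s q)"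
    by unfold_locales (simp_all add: vec_eq_iff algebra_simps)
  from matrix_works[OF this] show thesis using that by blast
qed

lemma finite_projection_subset:
  assumes "finite_projection Z L" "irreducible_cone Y" "Y \<subseteq> Z"
  shows "finite_projection Y L"
proof -
  interpret Z: finite_projection Z L by fact
  interpret Y: irreducible_cone Y by fact
  show ?thesis
  proof
    fix z assume "z \<in> Y" "L *v z = 0"
    then show "z = 0" using assms(3) Z.kernel[of z] by blast
  qed
qed

text \<open>A polynomial vanishing on the smaller cone but not on the larger one yields a point \<open>q\<close> of the
  target off the image of the smaller cone, from which one can project further.\<close>

lemma chain_length_bound:
  fixes C :: "nat \<Rightarrow> (complex ^ 'm::finite) set"
  shows "(\<And>i. i \<le> N \<Longrightarrow> irreducible_cone (C i)) \<Longrightarrow> (\<And>i. i < N \<Longrightarrow> C i \<subset> C (Suc i)) \<Longrightarrow>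
    finite_projection (C N) L \<Longrightarrow> N < vec.dim (range ((*v) L))"
proof (induction N arbitrary: L)
  case 0
  interpret finite_projection "C 0" L using "0.prems" by simp
  obtain z where "z \<in> C 0" "z \<noteq> 0" using nontrivial by blast
  then have "L *v z \<noteq> 0" using kernel by blast
  then have "\<not> range ((*v) L) \<subseteq> {0}" by auto
  then have "vec.dim (range ((*v) L)) \<noteq> 0" unfolding vec.dim_eq_0 .
  then show ?case by (simp only: neq0_conv)
next
  case (Suc N)
  interpret Z: finite_projection "C (Suc N)" L using Suc.prems by simp
  interpret Y: irreducible_cone "C N" using Suc.prems(1)[of N] by simp
  have sub: "C N \<subset> C (Suc N)" using Suc.prems(2)[of N] by simp
  then obtain z where z: "z \<in> C (Suc N)" "z \<notin> C N" by blast
  then obtain F where F: "complex_poly F" "\<forall>y\<in>C N. F y = 0" "F z \<noteq> 0" using Y.algebraic by blast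
  then have "\<exists>z\<in>C (Suc N). F z \<noteq> 0" using z(1) by blast
  with F(1) obtain d where d: "complex_poly d" "\<exists>z\<in>C (Suc N). d (L *v z) \<noteq> 0"
    "\<And>z. z \<in> C (Suc N) \<Longrightarrow> F z = 0 \<Longrightarrow> d (L *v z) = 0"
    by (rule Z.norm_polynomial) blast
  obtain y where y: "y \<in> C (Suc N)" "d (L *v y) \<noteq> 0" using d(2) by (rule bexE)
  define q where "q = L *v y"
  have d0: "d (L *v x) = 0" if "x \<in> C N" for x using that d(3)[of x] F(2) sub by blast
  have "q \<noteq> 0" using d0[OF Y.zero_mem] y(2) by (auto simp: q_def)
  then obtain u where u: "dotc u q = 1" using separating_functional_nonzero by blast
  obtain E where E: "\<And>x. E *v x = x - dotc u x *s q" using rank_one_projector by blast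
  \<comment> \<open>Projecting further from \<open>q\<close> stays finite on \<open>C N\<close>: a
    nonzero point of the new kernel would be mapped by \<open>L\<close> to a nonzero multiple of
    \<open>q\<close>, although \<open>d\<close> vanishes on the image of \<open>C N\<close> and not
    at \<open>q\<close>. The rank drops because \<open>q\<close> leaves the range.\<close>
  define L' where "L' = E ** L"
  have L': "L' *v x = L *v x - dotc u (L *v x) *s q" for x
    by (simp add: L'_def E flip: matrix_vector_mul_assoc)
  have "finite_projection (C N) L'"
  proof
    fix x assume x: "x \<in> C N" "L' *v x = 0"
    show "x = 0"
    proof (cases "dotc u (L *v x) = 0")
      case True
      then have "L *v x = 0" using x(2) L' by simp
      then show ?thesis using x sub Z.kernel by blast
    next
      case False
      define c where "c = dotc u (L *v x)"
      have "L *v x = c *s q" using x(2) L'[of x] by (simp add: c_def)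
      then have "L *v (inverse c *s x) = q"
        using False by (simp add: vector_scalar_commute c_def[symmetric])
      then have "d q = 0" using d0[OF Y.scale_closed[OF x(1)]] by metis
      then show ?thesis using y(2) by (simp add: q_def)
    qed
  qed
  with Suc.prems have "N < vec.dim (range ((*v) L'))"
    by (intro Suc.IH) auto
  then have "Suc N \<le> vec.dim (range ((*v) L'))" by simp
  also have "vec.dim (range ((*v) L')) < vec.dim (range ((*v) L))"
  proof (rule vec.dim_psubset)
    have "range ((*v) L') \<subset> range ((*v) L)"
    proof
      have "L' *v x = L *v (x - dotc u (L *v x) *s y)" for x
        by (simp add: L' q_def matrix_vector_mult_diff_distrib vector_scalar_commute)
      then show "range ((*v) L') \<subseteq> range ((*v) L)" by auto
      have "dotc u (L' *v x) = 0" for x by (simp add: L' u)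
      then have "q \<notin> range ((*v) L')" using u by auto
      then show "range ((*v) L') \<noteq> range ((*v) L)" by (auto simp: q_def)
    qed
    then show "vec.span (range ((*v) L')) \<subset> vec.span (range ((*v) L))"
      using vec.span_eq_iff subspace_range_matrix by metis
  qed
  finally show ?case by simp
qed

section \<open>Local behaviour of dominant projections\<close>

context finite_projection
begin

text \<open>Otherwise a sequence in \<open>Z\<close> outside the ball has images and values of
  \<open>u\<close> converging to those of \<open>z0\<close>. It is bounded by
  \<open>norm_bound\<close>, and a limit point lies in the same fibre with the same value of
  \<open>u\<close>, so it is \<open>z0\<close>.\<close>

lemma near_fibre_point:
  assumes z0: "z0 \<in> Z" and sep: "\<And>z. z \<in> Z \<Longrightarrow> L *v z = L *v z0 \<Longrightarrow> dotc u z = dotc u z0 \<Longrightarrow> z = z0"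
    and "\<epsilon> > 0"
  obtains \<delta> where "\<delta> > 0" "\<And>z. z \<in> Z \<Longrightarrow> dist (L *v z) (L *v z0) < \<delta> \<Longrightarrow>
    dist (dotc u z) (dotc u z0) < \<delta> \<Longrightarrow> dist z z0 < \<epsilon>"
proof (rule ccontr)
  note result = that
  assume "\<not> thesis"
  then have "\<exists>z. z \<in> Z \<and> dist (L *v z) (L *v z0) < \<delta> \<and> dist (dotc u z) (dotc u z0) < \<delta> \<and> \<not> dist z z0 < \<epsilon>"
    if "\<delta> > 0" for \<delta> using that result[of \<delta>] by blast
  then have "\<forall>n. \<exists>z. z \<in> Z \<and> dist (L *v z) (L *v z0) < 1 / Suc n \<and>
      dist (dotc u z) (dotc u z0) < 1 / Suc n \<and> \<not> dist z z0 < \<epsilon>" by simp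
  then obtain z where z: "\<And>n. z n \<in> Z" "\<And>n. dist (L *v z n) (L *v z0) < 1 / Suc n"
    "\<And>n. dist (dotc u (z n)) (dotc u z0) < 1 / Suc n" "\<And>n. dist (z n) z0 \<ge> \<epsilon>"
    by (metis not_less)
  have "(\<lambda>n. dist (L *v z n) (L *v z0)) \<longlonglongrightarrow> 0"
    by (rule tendsto_sandwich[OF _ _ tendsto_const LIMSEQ_Suc[OF lim_1_over_n]])
      (use z(2) in \<open>auto intro!: always_eventually less_imp_le\<close>)
  then have lim1: "(\<lambda>n. L *v z n) \<longlonglongrightarrow> L *v z0" by (rule iffD2[OF tendsto_dist_iff])
  have "(\<lambda>n. dist (dotc u (z n)) (dotc u z0)) \<longlonglongrightarrow> 0"
    by (rule tendsto_sandwich[OF _ _ tendsto_const LIMSEQ_Suc[OF lim_1_over_n]])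
      (use z(3) in \<open>auto intro!: always_eventually less_imp_le\<close>)
  then have lim2: "(\<lambda>n. dotc u (z n)) \<longlonglongrightarrow> dotc u z0" by (rule iffD2[OF tendsto_dist_iff])
  obtain C where C: "C > 0" "\<And>z. z \<in> Z \<Longrightarrow> norm z \<le> C * norm (L *v z)" using norm_bound by blast
  obtain B where "\<And>n. norm (L *v z n) \<le> B"
    using convergent_imp_Bseq[OF convergentI[OF lim1]] by (auto simp: Bseq_def)
  then have "norm (z n) \<le> C * B" for n
    using C(2)[OF z(1)[of n]] C(1) by (meson less_imp_le mult_left_mono order_trans)
  then have "bounded (range z)" by (auto simp: bounded_iff)
  then obtain l r where lr: "strict_mono r" "(z \<circ> r) \<longlonglongrightarrow> l"
    using bounded_imp_convergent_subsequence by blast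
  have "l \<in> Z" using closed_sequentially[OF closed_cone, of "z \<circ> r" l] lr z(1) by simp
  have "(\<lambda>n. L *v (z \<circ> r) n) \<longlonglongrightarrow> L *v l"
    using lr(2) by (rule bounded_linear.tendsto[OF matrix_vector_mul_bounded_linear])
  moreover have "(\<lambda>n. L *v (z \<circ> r) n) \<longlonglongrightarrow> L *v z0"
    using LIMSEQ_subseq_LIMSEQ[OF lim1 lr(1)] by (simp add: o_def)
  ultimately have "L *v l = L *v z0" by (rule LIMSEQ_unique)
  moreover have "(\<lambda>n. dotc u ((z \<circ> r) n)) \<longlonglongrightarrow> dotc u l"
    using lr(2) by (rule bounded_linear.tendsto[OF bounded_linear_dotc])
  then have "dotc u l = dotc u z0"
    using LIMSEQ_subseq_LIMSEQ[OF lim2 lr(1)] by (auto simp: o_def intro: LIMSEQ_unique)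
  ultimately have "l = z0" using sep \<open>l \<in> Z\<close> by blast
  then have "(\<lambda>n. dist ((z \<circ> r) n) z0) \<longlonglongrightarrow> 0" using iffD1[OF tendsto_dist_iff lr(2)] by simp
  then have "\<epsilon> \<le> 0"
    by (rule Lim_bounded2) (use z(4) in auto)
  then show False using \<open>\<epsilon> > 0\<close> by simp
qed

lemma separating_form:
  assumes "z0 \<in> Z" "finite X" "0 \<notin> X"
  obtains u where "\<And>z. z \<in> Z \<Longrightarrow> L *v z = L *v z0 \<Longrightarrow> dotc u z = dotc u z0 \<Longrightarrow> z = z0"
    "\<And>x. x \<in> X \<Longrightarrow> dotc u x \<noteq> 0"
proof -
  let ?X = "(\<lambda>z. z - z0) ` ({z\<in>Z. L *v z = L *v z0} - {z0}) \<union> X"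
  have "finite ?X" "0 \<notin> ?X" using assms finite_fibre by auto
  then obtain u where u: "\<forall>x\<in>?X. dotc u x \<noteq> 0" using functional_nonzero_on_finite by blast
  show thesis
  proof (rule that[of u])
    fix z assume z: "z \<in> Z" "L *v z = L *v z0" "dotc u z = dotc u z0"
    show "z = z0"
    proof (rule ccontr)
      assume "z \<noteq> z0"
      then have "z - z0 \<in> ?X" using z by blast
      then have "dotc u (z - z0) \<noteq> 0" using u by blast
      then show False using z(3) by simp
    qed
  qed (use u in blast)
qed

end

context dominant_projection
begin

text \<open>By continuity the minimal polynomial at a nearby point of the target is small at
  \<open>w0\<close>, so it has a root near \<open>w0\<close>. The root is the value of
  \<open>u\<close> at a point of the fibre, and such a point is close to \<open>z0\<close>.\<close>

lemma open_at_point: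
  assumes z0: "z0 \<in> Z" and "\<epsilon> > 0"
  obtains \<delta> where "\<delta> > 0" "\<And>x. dist (L *v x) (L *v z0) < \<delta> \<Longrightarrow> \<exists>z\<in>Z. L *v z = L *v x \<and> dist z z0 < \<epsilon>"
proof -
  obtain u where u: "\<And>z. z \<in> Z \<Longrightarrow> L *v z = L *v z0 \<Longrightarrow> dotc u z = dotc u z0 \<Longrightarrow> z = z0"
    using separating_form[OF z0, of "{}"] by auto
  obtain r P where P: "monicfam r P" "r > 0"
    "\<And>z. z \<in> Z \<Longrightarrow> poly (P (L *v z)) (dotc u z) = 0"
    "\<And>x w. poly (P (L *v x)) w = 0 \<Longrightarrow> \<exists>z\<in>Z. L *v z = L *v x \<and> dotc u z = w"
    by (rule minimal_polynomial) blast
  obtain \<delta>1 where \<delta>1: "\<delta>1 > 0" "\<And>z. z \<in> Z \<Longrightarrow> dist (L *v z) (L *v z0) < \<delta>1 \<Longrightarrow>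
    dist (dotc u z) (dotc u z0) < \<delta>1 \<Longrightarrow> dist z z0 < \<epsilon>"
    using near_fibre_point[OF z0 u \<open>\<epsilon> > 0\<close>] by blast
  define w0 where "w0 = dotc u z0"
  have pP: "polyfam P" using P(1) by (simp add: monicfam_def)
  have "complex_poly (\<lambda>q. poly (P q) w0)" using pP by (intro complex_poly_polyfam complex_poly.intros)
  then have "isCont (\<lambda>q. poly (P q) w0) (L *v z0)"
    using continuous_on_complex_poly continuous_on_eq_continuous_at open_UNIV by blast
  moreover have "poly (P (L *v z0)) w0 = 0" using P(3)[OF z0] by (simp add: w0_def)
  ultimately obtain \<delta>2 where \<delta>2: "\<delta>2 > 0" "\<And>q. dist q (L *v z0) < \<delta>2 \<Longrightarrow> norm (poly (P q) w0) < \<delta>1 ^ r"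
    using \<delta>1(1) unfolding continuous_at_eps_delta dist_norm by (metis diff_zero zero_less_power)
  show thesis
  proof (rule that[of "min \<delta>1 \<delta>2"])
    show "min \<delta>1 \<delta>2 > 0" using \<delta>1 \<delta>2 by simp
    fix x assume x: "dist (L *v x) (L *v z0) < min \<delta>1 \<delta>2"
    have lead: "lead_coeff (P (L *v x)) = 1" "degree (P (L *v x)) = r"
      using P(1) by (auto simp: monicfam_def)
    then obtain b where b: "poly (P (L *v x)) b = 0" "norm (w0 - b) ^ r \<le> norm (poly (P (L *v x)) w0)"
      using monic_root_near[of "P (L *v x)" w0] P(2) by auto
    have "norm (w0 - b) ^ r < \<delta>1 ^ r" using b(2) \<delta>2(2)[of "L *v x"] x by simp
    then have "norm (w0 - b) < \<delta>1" using \<delta>1(1) by (meson less_imp_le power_less_imp_less_base)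
    moreover obtain z where "z \<in> Z" "L *v z = L *v x" "dotc u z = b" using P(4)[OF b(1)] by blast
    ultimately show "\<exists>z\<in>Z. L *v z = L *v x \<and> dist z z0 < \<epsilon>"
      using \<delta>1(2)[of z] x by (auto simp: w0_def dist_norm norm_minus_commute)
  qed
qed

lemma simple_root:
  assumes z0: "z0 \<in> Z" and "\<epsilon> > 0"
    and inj: "\<And>y z. y \<in> Z \<Longrightarrow> z \<in> Z \<Longrightarrow> dist y z0 < \<epsilon> \<Longrightarrow> dist z z0 < \<epsilon> \<Longrightarrow> L *v y = L *v z \<Longrightarrow> y = z"
    and u: "\<And>z. z \<in> Z \<Longrightarrow> L *v z = L *v z0 \<Longrightarrow> dotc u z = dotc u z0 \<Longrightarrow> z = z0"
  obtains P where "polyfam P" "\<And>z. z \<in> Z \<Longrightarrow> poly (P (L *v z)) (dotc u z) = 0"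
    "poly (pderiv (P (L *v z0))) (dotc u z0) \<noteq> 0"
proof -
  obtain r P where P: "monicfam r P" "r > 0"
    "\<And>z. z \<in> Z \<Longrightarrow> poly (P (L *v z)) (dotc u z) = 0"
    "\<And>x w. poly (P (L *v x)) w = 0 \<Longrightarrow> \<exists>z\<in>Z. L *v z = L *v x \<and> dotc u z = w"
    "\<And>g x. polyfam g \<Longrightarrow> (\<And>q. degree (g q) < r) \<Longrightarrow>
      (\<And>z. z \<in> Z \<Longrightarrow> poly (g (L *v z)) (dotc u z) = 0) \<Longrightarrow> g (L *v x) = 0"
    by (rule minimal_polynomial) blast
  have pP: "polyfam P" and degP: "degree (P q) = r" and leadP: "coeff (P q) r = 1" for q
    using P(1) by (auto simp: monicfam_def)
  define Q where "Q = (\<lambda>q. pderiv (P q))"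
  have pQ: "polyfam Q" unfolding Q_def using pP by (rule polyfam_pderiv)
  have Q0: "Q q \<noteq> 0" for q using degP[of q] P(2) by (simp add: Q_def pderiv_eq_0_iff)
  have degQ: "degree (Q q) = r - 1" for q by (simp add: Q_def degree_pderiv degP)
  text \<open>By minimality the derivative is not a relation, so its norm is nonzero and \<open>P\<close> is generically
    squarefree.\<close>
  have "\<exists>z\<in>Z. poly (Q (L *v z)) (dotc u z) \<noteq> 0"
  proof (rule ccontr)
    assume "\<not> ?thesis"
    moreover have "degree (Q q) < r" for q using degQ P(2) by simp
    ultimately have "Q (L *v 0) = 0" using P(5)[OF pQ] by blast
    then show False using Q0 by blast
  qed
  moreover have "complex_poly (\<lambda>z. poly (Q (L *v z)) (dotc u z))"
    using pQ by (intro complex_poly_polyfam polyfam_compose_matrix complex_poly_dotc)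
  ultimately obtain d where d: "complex_poly d" "\<exists>z\<in>Z. d (L *v z) \<noteq> 0"
    "\<And>z. z \<in> Z \<Longrightarrow> poly (Q (L *v z)) (dotc u z) = 0 \<Longrightarrow> d (L *v z) = 0"
    using norm_polynomial by blast
  have sqfree: "poly (Q (L *v x)) w \<noteq> 0" if "d (L *v x) \<noteq> 0" "poly (P (L *v x)) w = 0" for x w
    using P(4)[OF that(2)] d(3) that(1) by metis
  \<comment> \<open>The polynomial \<open>d\<close> composed with \<open>L\<close> does not vanish
    identically on the line from \<open>z0\<close> to \<open>y\<close>, so points with nonzero value
    occur arbitrarily close to \<open>z0\<close>. The summand 1 in \<open>c + 1\<close> avoids
    division by 0.\<close>
  have generic: "\<exists>x. d (L *v x) \<noteq> 0 \<and> dist (L *v x) (L *v z0) < \<delta>" if "\<delta> > 0" for \<delta>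
  proof -
    obtain y where y: "y \<in> Z" "d (L *v y) \<noteq> 0" using d(2) by blast
    define v where "v = y - z0"
    define x where "x = (\<lambda>t. z0 + t *s v)"
    obtain h where h: "\<And>v t. d (L *v (z0 + t *s v)) = poly (h v) t"
      using polyfam_on_line[OF complex_poly_compose_matrix[OF d(1)]] by blast
    have "h v \<noteq> 0" using h[of 1 v] y(2) by (auto simp: v_def)
    then have fin: "finite {t. poly (h v) t = 0}" by (rule poly_roots_finite)
    define c where "c = norm (L *v v)"
    define e where "e = \<delta> / (c + 1)"
    have e: "e > 0" using that by (simp add: e_def c_def add_nonneg_pos)
    have "infinite (of_real ` {0<..<e} :: complex set)"
      using e by (simp add: finite_image_iff inj_on_def)
    then obtain t where t: "0 < t" "t < e" "poly (h v) (complex_of_real t) \<noteq> 0"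
      using finite_subset[OF _ fin] by (smt (verit) greaterThanLessThan_iff image_iff mem_Collect_eq subsetI)
    have "L *v x (of_real t) - L *v z0 = of_real t *s (L *v v)"
      by (simp add: x_def matrix_vector_right_distrib vector_scalar_commute)
    then have "dist (L *v x (of_real t)) (L *v z0) = t * c"
      using t by (simp add: dist_norm c_def norm_vector_scale)
    also have "\<dots> \<le> t * (c + 1)" using t by simp
    also have "\<dots> < \<delta>" using t(2) pos_less_divide_eq[of "c + 1" t \<delta>]
      by (simp add: e_def c_def add_nonneg_pos)
    finally show ?thesis using t(3) h[of "of_real t" v] by (intro exI[of _ "x (of_real t)"]) (simp add: x_def)
  qed
  define w0 where "w0 = dotc u z0"
  define q0 where "q0 = L *v z0"
  have "poly (Q q0) w0 \<noteq> 0"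
  proof
    assume Qw0: "poly (Q q0) w0 = 0"
    have r2: "r - 1 > 0"
    proof (rule ccontr)
      assume "\<not> r - 1 > 0"
      then have "degree (Q q0) = 0" by (simp add: degQ)
      then obtain e where "Q q0 = [:e:]" by (metis degree_eq_zeroE)
      then show False using Q0[of q0] Qw0 by simp
    qed
    obtain \<delta>1 where \<delta>1: "\<delta>1 > 0" "\<And>z. z \<in> Z \<Longrightarrow> dist (L *v z) q0 < \<delta>1 \<Longrightarrow>
      dist (dotc u z) w0 < \<delta>1 \<Longrightarrow> dist z z0 < \<epsilon>"
      using near_fibre_point[OF z0 u \<open>\<epsilon> > 0\<close>] unfolding w0_def q0_def by blast
    have "isCont (\<lambda>p. poly (Q (fst p)) (snd p)) (q0, w0)"
      using continuous_on_polyfam[OF pQ] continuous_on_eq_continuous_at open_UNIV by blast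
    then have "\<forall>e>0. \<exists>d>0. \<forall>p. dist p (q0, w0) < d \<longrightarrow> dist (poly (Q (fst p)) (snd p)) 0 < e"
      unfolding continuous_at_eps_delta by (simp add: Qw0)
    then obtain \<delta>2 where \<delta>2: "\<delta>2 > 0"
      "\<And>p. dist p (q0, w0) < \<delta>2 \<Longrightarrow> norm (poly (Q (fst p)) (snd p)) < (\<delta>1 / 2) ^ (r - 1)"
      using \<delta>1(1) by (metis dist_0_norm dist_commute half_gt_zero zero_less_power)
    \<comment> \<open>\<open>w1\<close> will lie within \<open>\<delta>3\<close> of
      \<open>w0\<close> and \<open>w2\<close> within \<open>\<delta>1 / 2\<close> of
      \<open>w1\<close>, so both are within \<open>\<delta>1\<close> of \<open>w0\<close> and come
      from points within \<epsilon> of \<open>z0\<close>.\<close>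
    define \<delta>3 where "\<delta>3 = min (\<delta>1 / 2) (\<delta>2 / 2)"
    have \<delta>3: "\<delta>3 > 0" using \<delta>1 \<delta>2 by (simp add: \<delta>3_def)
    have "complex_poly (\<lambda>q. poly (P q) w0)" using pP by (intro complex_poly_polyfam complex_poly.intros)
    then have "isCont (\<lambda>q. poly (P q) w0) q0"
      using continuous_on_complex_poly continuous_on_eq_continuous_at open_UNIV by blast
    moreover have "poly (P q0) w0 = 0" using P(3)[OF z0] by (simp add: w0_def q0_def)
    ultimately obtain \<delta>4 where \<delta>4: "\<delta>4 > 0" "\<And>q. dist q q0 < \<delta>4 \<Longrightarrow> norm (poly (P q) w0) < \<delta>3 ^ r"
      using \<delta>3 unfolding continuous_at_eps_delta dist_norm by (metis diff_zero zero_less_power)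
    obtain x where x: "d (L *v x) \<noteq> 0" "dist (L *v x) q0 < min \<delta>3 \<delta>4"
      using generic[of "min \<delta>3 \<delta>4"] \<delta>3 \<delta>4 by (auto simp: q0_def)
    define q where "q = L *v x"
    obtain w1 where w1: "poly (P q) w1 = 0" "norm (w0 - w1) ^ r \<le> norm (poly (P q) w0)"
      using monic_root_near[of "P q" w0] P(2) by (auto simp: degP leadP)
    have "norm (w0 - w1) ^ r < \<delta>3 ^ r" using w1(2) \<delta>4(2)[of q] x by (simp add: q_def)
    then have w01: "norm (w0 - w1) < \<delta>3" using \<delta>3 by (meson less_imp_le power_less_imp_less_base)
    \<comment> \<open>The cofactor \<open>R\<close> takes at \<open>w1\<close> the value of the
      derivative of \<open>P\<close>. This value is small near a multiple root, so \<open>R\<close>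
      has a root \<open>w2\<close> near \<open>w1\<close>; generic squarefreeness makes the two
      differ.\<close>
    obtain R where R: "P q = [:- w1, 1:] * R" using w1(1) by (metis dvdE poly_eq_0_iff_dvd)
    have "R \<noteq> 0" using leadP[of q] R by auto
    then have degR: "degree R = r - 1" using degP[of q] R degree_mult_eq[of "[:- w1, 1:]" R] by simp
    have "lead_coeff (P q) = lead_coeff R" unfolding R lead_coeff_mult by simp
    then have leadR: "lead_coeff R = 1" by (simp add: degP leadP)
    have QR: "poly (Q q) w1 = poly R w1"
      unfolding Q_def R by (simp add: pderiv_mult pderiv_pCons del: mult_pCons_left)
    obtain w2 where w2: "poly R w2 = 0" "norm (w1 - w2) ^ (r - 1) \<le> norm (poly R w1)"
      using monic_root_near[OF leadR, of w1] r2 by (auto simp: degR)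
    have "dist (q, w1) (q0, w0) \<le> dist q q0 + dist w1 w0"
      by (simp add: dist_Pair_Pair sqrt_sum_squares_le_sum)
    also have "\<dots> < \<delta>2" using x(2) w01 by (simp add: \<delta>3_def q_def dist_norm norm_minus_commute)
    finally have "norm (poly (Q q) w1) < (\<delta>1 / 2) ^ (r - 1)" using \<delta>2(2)[of "(q, w1)"] by simp
    then have "norm (w1 - w2) ^ (r - 1) < (\<delta>1 / 2) ^ (r - 1)" using w2(2) QR by simp
    then have w12: "norm (w1 - w2) < \<delta>1 / 2"
      using \<delta>1(1) by (meson half_gt_zero less_imp_le power_less_imp_less_base)
    have "poly (P q) w2 = 0" unfolding R using w2(1) by simp
    then obtain z2 where z2: "z2 \<in> Z" "L *v z2 = q" "dotc u z2 = w2" using P(4) unfolding q_def by blast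
    obtain z1 where z1: "z1 \<in> Z" "L *v z1 = q" "dotc u z1 = w1" using P(4) w1(1) unfolding q_def by blast
    have "norm (w0 - w2) < \<delta>1"
      using norm_triangle_ineq[of "w0 - w1" "w1 - w2"] w01 w12 by (simp add: \<delta>3_def)
    then have "dist z2 z0 < \<epsilon>" using z2 x(2) \<delta>1(1)
      by (intro \<delta>1(2)) (auto simp: dist_norm norm_minus_commute q_def \<delta>3_def)
    moreover have "dist z1 z0 < \<epsilon>" using z1 x(2) \<delta>1(1) w01
      by (intro \<delta>1(2)) (auto simp: dist_norm norm_minus_commute q_def \<delta>3_def)
    ultimately have "z1 = z2" using inj z1 z2 by metis
    then have "poly R w1 = 0" using z1 z2 w2(1) by simp
    moreover have "poly (Q q) w1 \<noteq> 0" using sqfree x(1) w1(1) by (simp add: q_def)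
    ultimately show False using QR by simp
  qed
  then show thesis using that[of P] pP P(3) by (simp add: Q_def w0_def q0_def)
qed

text \<open>The relation \<open>P\<close>, read as a polynomial on the source, vanishes on
  \<open>Z\<close>. Along \<open>v\<close> only the value of \<open>u\<close> moves, so its
  derivative is that of \<open>P\<close> at a simple root times \<open>dotc u v\<close>, and both
  factors are nonzero.\<close>

lemma tangent_vector_in_kernel:
  assumes z0: "z0 \<in> Z" and "\<epsilon> > 0"
    and inj: "\<And>y z. y \<in> Z \<Longrightarrow> z \<in> Z \<Longrightarrow> dist y z0 < \<epsilon> \<Longrightarrow> dist z z0 < \<epsilon> \<Longrightarrow> L *v y = L *v z \<Longrightarrow> y = z"
    and v: "L *v v = 0"
      "\<And>F. F \<in> vanishing_ideal Z \<Longrightarrow> ((\<lambda>t. F (z0 + t *s v)) has_field_derivative 0) (at 0)"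
  shows "v = 0"
proof (rule ccontr)
  assume "v \<noteq> 0"
  obtain u where u: "\<And>z. z \<in> Z \<Longrightarrow> L *v z = L *v z0 \<Longrightarrow> dotc u z = dotc u z0 \<Longrightarrow> z = z0" "dotc u v \<noteq> 0"
    using separating_form[OF z0, of "{v}"] \<open>v \<noteq> 0\<close> by auto
  obtain P where P: "polyfam P" "\<And>z. z \<in> Z \<Longrightarrow> poly (P (L *v z)) (dotc u z) = 0"
    "poly (pderiv (P (L *v z0))) (dotc u z0) \<noteq> 0"
    using simple_root[OF z0 \<open>\<epsilon> > 0\<close> inj u(1)] by blast
  define F where "F = (\<lambda>z. poly (P (L *v z)) (dotc u z))"
  have "F \<in> vanishing_ideal Z"
    unfolding vanishing_ideal_def F_def using P(1,2)
    by (auto intro!: complex_poly_polyfam polyfam_compose_matrix complex_poly_dotc)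
  from v(2)[OF this] have D0: "((\<lambda>t. F (z0 + t *s v)) has_field_derivative 0) (at 0)" .
  have "F (z0 + t *s v) = poly (P (L *v z0)) (dotc u z0 + t * dotc u v)" for t
    using v(1) by (simp add: F_def matrix_vector_right_distrib vector_scalar_commute)
  moreover have "((\<lambda>t. poly (P (L *v z0)) (dotc u z0 + t * dotc u v)) has_field_derivative
      poly (pderiv (P (L *v z0))) (dotc u z0) * dotc u v) (at 0)"
    by (auto intro!: derivative_eq_intros)
  ultimately have "((\<lambda>t. F (z0 + t *s v)) has_field_derivative
      poly (pderiv (P (L *v z0))) (dotc u z0) * dotc u v) (at 0)" by simp
  from DERIV_unique[OF D0 this] show False using P(3) u(2) by simp
qed

end

section \<open>Holomorphic maps between complex coordinate spaces\<close>

lemma complex_linear_form: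
  fixes f :: "complex ^ 'd \<Rightarrow> complex"
  assumes "\<And>u v. f (u + v) = f u + f v" "\<And>c v. f (c *s v) = c * f v"
  shows "f v = (\<Sum>j\<in>UNIV. f (axis j 1) * v $ j)"
proof -
  have sum: "f (\<Sum>j\<in>X. g j) = (\<Sum>j\<in>X. f (g j))" if "finite X" for X :: "'d set" and g
    using that assms(2)[of 0 0] by (induction X rule: finite_induct) (auto simp: assms(1))
  have "f v = f (\<Sum>j\<in>UNIV. v $ j *s axis j 1)" by (simp add: basis_expansion)
  also have "\<dots> = (\<Sum>j\<in>UNIV. f (v $ j *s axis j 1))" by (rule sum) simp
  finally show ?thesis by (simp add: assms(2) mult.commute)
qed

text \<open>Complex homogeneity is the only extra condition, additivity being part of real
  differentiability. In this form composition and inversion of maps need no coordinates.\<close>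

lemma holo_fun_on_iff:
  "holo_fun_on W g \<longleftrightarrow> open W \<and>
     (\<forall>z\<in>W. \<exists>g'. (g has_derivative g') (at z) \<and> (\<forall>c v. g' (c *s v) = c * g' v))"
proof (intro iffI conjI ballI; (elim conjE)?)
  assume g: "holo_fun_on W g"
  then show "open W" by (simp add: holo_fun_on_def)
  fix z assume "z \<in> W"
  then obtain a where "(g has_derivative (\<lambda>v. \<Sum>j\<in>UNIV. a $ j * v $ j)) (at z)"
    using g by (auto simp: holo_fun_on_def)
  then show "\<exists>g'. (g has_derivative g') (at z) \<and> (\<forall>c v. g' (c *s v) = c * g' v)"
    by (intro exI[of _ "\<lambda>v. \<Sum>j\<in>UNIV. a $ j * v $ j"]) (auto simp: sum_distrib_left mult_ac)
next
  assume W: "open W" and g: "\<forall>z\<in>W. \<exists>g'. (g has_derivative g') (at z) \<and> (\<forall>c v. g' (c *s v) = c * g' v)"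
  have "\<exists>a. (g has_derivative (\<lambda>v. \<Sum>j\<in>UNIV. a $ j * v $ j)) (at z)" if z: "z \<in> W" for z
  proof -
    obtain g' where g': "(g has_derivative g') (at z)" "\<And>c v. g' (c *s v) = c * g' v"
      using g z by blast
    have eq: "g' v = (\<Sum>j\<in>UNIV. g' (axis j 1) * v $ j)" for v
      by (rule complex_linear_form[OF linear_add[OF has_derivative_linear[OF g'(1)]] g'(2)])
    have "g' = (\<lambda>v. \<Sum>j\<in>UNIV. (\<chi> j. g' (axis j 1)) $ j * v $ j)"
      by (rule ext) (simp only: vec_lambda_beta eq[symmetric])
    from subst[where P = "\<lambda>h. (g has_derivative h) (at z)", OF this g'(1)] show ?thesis by (rule exI)
  qed
  then show "holo_fun_on W g" using W by (simp add: holo_fun_on_def)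
qed

lemma has_derivative_vec_iff:
  fixes g :: "'a::real_normed_vector \<Rightarrow> complex ^ 'e"
  shows "(g has_derivative g') (at z) \<longleftrightarrow> (\<forall>i. ((\<lambda>x. g x $ i) has_derivative (\<lambda>v. g' v $ i)) (at z))"
proof
  assume "(g has_derivative g') (at z)"
  then show "\<forall>i. ((\<lambda>x. g x $ i) has_derivative (\<lambda>v. g' v $ i)) (at z)"
    using bounded_linear.has_derivative[OF bounded_linear_vec_nth] by blast
next
  assume r: "\<forall>i. ((\<lambda>x. g x $ i) has_derivative (\<lambda>v. g' v $ i)) (at z)"
  have bl: "bounded_linear (axis i :: complex \<Rightarrow> complex ^ 'e)" for i
    unfolding linear_conv_bounded_linear[symmetric]
    by (rule linearI) (simp_all add: axis_def vec_eq_iff)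
  have "((\<lambda>x. \<Sum>i\<in>UNIV. axis i (g x $ i)) has_derivative (\<lambda>v. \<Sum>i\<in>UNIV. axis i (g' v $ i))) (at z)"
    by (intro has_derivative_sum bounded_linear.has_derivative[OF bl]) (use r in blast)
  moreover have "(\<Sum>i\<in>UNIV. axis i (w $ i)) = w" for w :: "complex ^ 'e"
    by (simp add: vec_eq_iff axis_def)
  ultimately show "(g has_derivative g') (at z)" by simp
qed

lemma holo_map_on_iff:
  fixes g :: "complex ^ 'd \<Rightarrow> complex ^ 'e"
  shows "holo_map_on W g \<longleftrightarrow> open W \<and>
     (\<forall>z\<in>W. \<exists>g'. (g has_derivative g') (at z) \<and> (\<forall>c v. g' (c *s v) = c *s g' v))"
proof (intro iffI conjI ballI; (elim conjE)?)
  assume g: "holo_map_on W g"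
  then show "open W" by (simp add: holo_map_on_def holo_fun_on_def)
  fix z assume z: "z \<in> W"
  have "\<forall>i. \<exists>g'. ((\<lambda>x. g x $ i) has_derivative g') (at z) \<and> (\<forall>c v. g' (c *s v) = c * g' v)"
    using g z by (auto simp: holo_map_on_def holo_fun_on_iff)
  then obtain g' where g': "\<And>i. ((\<lambda>x. g x $ i) has_derivative g' i) (at z)"
    "\<And>i c v. g' i (c *s v) = c * g' i v" by metis
  then show "\<exists>g'. (g has_derivative g') (at z) \<and> (\<forall>c v. g' (c *s v) = c *s g' v)"
    by (intro exI[of _ "\<lambda>v. \<chi> i. g' i v"]) (auto simp: has_derivative_vec_iff vec_eq_iff)
next
  assume "open W" "\<forall>z\<in>W. \<exists>g'. (g has_derivative g') (at z) \<and> (\<forall>c v. g' (c *s v) = c *s g' v)"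
  then show "holo_map_on W g"
    unfolding holo_map_on_def holo_fun_on_iff has_derivative_vec_iff
    by (fastforce simp: vec_eq_iff)
qed

lemma holo_map_on_open: "holo_map_on W g \<Longrightarrow> open W"
  by (simp add: holo_map_on_iff)

lemma holo_map_on_subset: "holo_map_on W g \<Longrightarrow> open V \<Longrightarrow> V \<subseteq> W \<Longrightarrow> holo_map_on V g"
  by (auto simp: holo_map_on_iff)

lemma holo_map_on_continuous: "holo_map_on W g \<Longrightarrow> continuous_on W g"
  unfolding holo_map_on_iff by (meson continuous_at_imp_continuous_on has_derivative_continuous)

lemma holo_map_on_compose:
  assumes "holo_map_on W g" "holo_map_on V f" "g ` W \<subseteq> V"
  shows "holo_map_on W (\<lambda>z. f (g z))"
  unfolding holo_map_on_iff
proof (intro conjI ballI)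
  show "open W" using assms(1) by (rule holo_map_on_open)
  fix z assume z: "z \<in> W"
  obtain g' where g': "(g has_derivative g') (at z)" "\<And>c v. g' (c *s v) = c *s g' v"
    using assms(1) z unfolding holo_map_on_iff by blast
  obtain f' where f': "(f has_derivative f') (at (g z))" "\<And>c v. f' (c *s v) = c *s f' v"
    using assms(2,3) z unfolding holo_map_on_iff by blast
  from has_derivative_compose[OF g'(1) f'(1)]
  show "\<exists>h'. ((\<lambda>z. f (g z)) has_derivative h') (at z) \<and> (\<forall>c v. h' (c *s v) = c *s h' v)"
    using g'(2) f'(2) by (intro exI[of _ "\<lambda>v. f' (g' v)"]) simp
qed

lemma holo_map_on_restrict_line:
  fixes g :: "complex ^ 'd \<Rightarrow> complex ^ 'e"
  assumes g: "holo_map_on W g" and z: "a + t *s v \<in> W"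
    and g': "(g has_derivative g') (at (a + t *s v))"
  shows "((\<lambda>t. g (a + t *s v) $ i) has_field_derivative g' v $ i) (at t)"
proof -
  obtain g'' where g'': "(g has_derivative g'') (at (a + t *s v))" "\<And>c v. g'' (c *s v) = c *s g'' v"
    using g z unfolding holo_map_on_iff by blast
  have eq: "g'' = g'" using has_derivative_unique[OF g''(1) g'] .
  have "bounded_linear (\<lambda>t :: complex. t *s v)"
    unfolding linear_conv_bounded_linear[symmetric]
    by (rule linearI) (simp_all add: vec_eq_iff algebra_simps)
  then have "((\<lambda>t. a + t *s v) has_derivative (\<lambda>s. s *s v)) (at t)"
    by (auto intro!: derivative_eq_intros bounded_linear_imp_has_derivative)
  from has_derivative_compose[OF this g']
  have "((\<lambda>t. g (a + t *s v) $ i) has_derivative (\<lambda>s. g' (s *s v) $ i)) (at t)"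
    by (simp add: has_derivative_vec_iff)
  moreover have lin: "g' (s *s v) $ i = g' v $ i * s" for s
    using g''(2)[of s v] by (simp add: eq)
  ultimately have "((\<lambda>t. g (a + t *s v) $ i) has_derivative (\<lambda>s. g' v $ i * s)) (at t)"
    by (simp only: lin)
  then show ?thesis unfolding has_field_derivative_def .
qed

lemma norm_le_sum_components: "norm (x :: complex ^ 'm) \<le> (\<Sum>i\<in>UNIV. norm (x $ i))"
  by (simp add: norm_vec_def L2_set_le_sum)

text \<open>The Cauchy inequality on the complex line through \<open>z\<close> in direction \<open>v\<close>, applied to the
  difference of two translates of \<open>g\<close>.\<close>

lemma holo_map_derivative_continuous:
  fixes g :: "complex ^ 'd \<Rightarrow> complex ^ 'e"
  assumes g: "holo_map_on W g" and g': "\<And>z. z \<in> W \<Longrightarrow> (g has_derivative g' z) (at z)"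
    and z0: "z0 \<in> W" and "e > 0"
  obtains d where "d > 0" "ball z0 d \<subseteq> W"
    "\<And>z v. dist z z0 < d \<Longrightarrow> norm (g' z v - g' z0 v) \<le> e * norm v"
proof -
  obtain r0 where r0: "r0 > 0" "cball z0 r0 \<subseteq> W"
    using holo_map_on_open[OF g] z0 open_contains_cball by blast
  define r where "r = r0 / 2"
  have r: "r > 0" "cball z0 (2 * r) \<subseteq> W" using r0 by (auto simp: r_def)
  have "uniformly_continuous_on (cball z0 (2 * r)) g"
    by (intro compact_uniformly_continuous continuous_on_subset[OF holo_map_on_continuous[OF g] r(2)]) simp
  \<comment> \<open>The Cauchy estimate on a disc of radius \<open>r\<close> gives
    \<open>e1 / r\<close> for each of the \<open>CARD('e)\<close> components, and these add up to
    \<open>e\<close>. The discs stay in the ball of radius \<open>2 * r\<close>, as their centres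
    are within \<open>r\<close> of \<open>z0\<close>.\<close>
  define e1 where "e1 = e * r / CARD('e)"
  have "e1 > 0" using \<open>e > 0\<close> r by (simp add: e1_def)
  then obtain d where d: "d > 0"
    "\<And>x y. x \<in> cball z0 (2 * r) \<Longrightarrow> y \<in> cball z0 (2 * r) \<Longrightarrow> dist x y < d \<Longrightarrow> dist (g x) (g y) < e1"
    using \<open>uniformly_continuous_on _ _\<close> unfolding uniformly_continuous_on_def by (metis dist_commute)
  have unit: "norm (g' z v - g' z0 v) \<le> e" if z: "dist z z0 < min d r" and v: "norm v = 1" for z v
  proof -
    have line: "x + t *s v \<in> cball z0 (2 * r)" if "dist x z0 \<le> r" "norm t \<le> r" for x t
      using that v norm_triangle_ineq[of "x - z0" "t *s v"]
      by (simp add: dist_norm norm_minus_commute[of z0] norm_vector_scale algebra_simps)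
    have zz: "dist z z0 \<le> r" "dist z0 z0 \<le> r" using z r by auto
    have bound: "norm ((g' z v - g' z0 v) $ i) \<le> e1 / r" for i
    proof -
      define h where "h = (\<lambda>t. g (z + t *s v) $ i - g (z0 + t *s v) $ i)"
      have dh: "(h has_field_derivative (g' (z + t *s v) v $ i - g' (z0 + t *s v) v $ i)) (at t)"
        if "norm t \<le> r" for t
        unfolding h_def using line[OF zz(1) that] line[OF zz(2) that] r(2)
        by (intro DERIV_diff holo_map_on_restrict_line[OF g] g') auto
      have hol: "h holomorphic_on cball 0 r"
      proof (rule holomorphic_onI)
        fix t :: complex assume "t \<in> cball 0 r"
        then have "norm t \<le> r" by simp
        from dh[OF this] show "h field_differentiable at t within cball 0 r"
          using field_differentiable_at_within field_differentiable_def by blast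
      qed
      have "norm ((deriv ^^ 1) h 0) \<le> fact 1 * e1 / r ^ 1"
      proof (rule Cauchy_inequality)
        show "h holomorphic_on ball 0 r"
          using hol ball_subset_cball by (rule holomorphic_on_subset)
        show "continuous_on (cball 0 r) h"
          using hol by (rule holomorphic_on_imp_continuous_on)
        fix t :: complex assume "norm (0 - t) = r"
        then have t: "norm t \<le> r" by simp
        have "norm (h t) \<le> norm (g (z + t *s v) - g (z0 + t *s v))"
          unfolding h_def using Finite_Cartesian_Product.norm_nth_le[of "g (z + t *s v) - g (z0 + t *s v)" i] by simp
        also have "\<dots> < e1"
          using d(2)[OF line[OF zz(1) t] line[OF zz(2) t]] z by (simp add: dist_norm)
        finally show "norm (h t) \<le> e1" by simp
      qed (use r in auto)
      moreover have "deriv h 0 = (g' z v - g' z0 v) $ i"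
        using dh[of 0] r by (intro DERIV_imp_deriv) simp
      ultimately show ?thesis by simp
    qed
    have "norm (g' z v - g' z0 v) \<le> (\<Sum>i\<in>(UNIV :: 'e set). e1 / r)"
      by (rule order_trans[OF norm_le_sum_components sum_mono[OF bound]])
    also have "\<dots> = e" using r by (simp add: e1_def)
    finally show ?thesis .
  qed
  show thesis
  proof (rule that[of "min d r"])
    show "min d r > 0" using d r by simp
    show sub: "ball z0 (min d r) \<subseteq> W" using r(2) r(1) by (force simp: subset_iff)
    fix z v assume z: "dist z z0 < min d r"
    have zW: "z \<in> W" using z sub by (auto simp: dist_commute)
    interpret g1: bounded_linear "g' z" using g'[OF zW] by (rule has_derivative_bounded_linear)
    interpret g0: bounded_linear "g' z0" using g'[OF z0] by (rule has_derivative_bounded_linear)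
    show "norm (g' z v - g' z0 v) \<le> e * norm v"
    proof (cases "v = 0")
      case False
      define w where "w = (1 / norm v) *\<^sub>R v"
      have w: "norm w = 1" "v = norm v *\<^sub>R w" using False by (auto simp: w_def)
      have "g' z v - g' z0 v = norm v *\<^sub>R (g' z w - g' z0 w)"
        by (subst (1 2) w(2)) (simp only: g1.scaleR g0.scaleR scaleR_diff_right)
      then show ?thesis
        using mult_left_mono[OF unit[OF z w(1)] norm_ge_zero[of v]] by (simp add: mult.commute)
    qed simp
  qed
qed

text \<open>The mean value inequality is applied to \<open>g - D\<close> on a ball where the
  derivative differs from \<open>D\<close> by at most \<open>e\<close>. Both points move, which is
  what an estimate for chords of \<open>Z\<close> requires.\<close>

lemma holo_map_strict_derivative:
  fixes g :: "complex ^ 'd \<Rightarrow> complex ^ 'e"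
  assumes g: "holo_map_on W g" and z0: "z0 \<in> W" and D: "(g has_derivative D) (at z0)" and "e > 0"
  obtains d where "d > 0" "ball z0 d \<subseteq> W"
    "\<And>y z. dist y z0 < d \<Longrightarrow> dist z z0 < d \<Longrightarrow> norm (g y - g z - D (y - z)) \<le> e * norm (y - z)"
proof -
  obtain g' where g': "\<And>z. z \<in> W \<Longrightarrow> (g has_derivative g' z) (at z)"
    using g unfolding holo_map_on_iff by metis
  have gz0: "g' z0 = D" using has_derivative_unique[OF g'[OF z0] D] .
  obtain d where d: "d > 0" "ball z0 d \<subseteq> W"
    "\<And>z v. dist z z0 < d \<Longrightarrow> norm (g' z v - g' z0 v) \<le> e * norm v"
    using holo_map_derivative_continuous[OF g g' z0 \<open>e > 0\<close>] by blast
  interpret D: bounded_linear D using D by (rule has_derivative_bounded_linear)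
  show thesis
  proof (rule that[OF d(1,2)])
    fix y z assume yz: "dist y z0 < d" "dist z z0 < d"
    have "norm ((g y - D y) - (g z - D z)) \<le> e * norm (y - z)"
    proof (rule differentiable_bound[where S = "ball z0 d" and f' = "\<lambda>x v. g' x v - D v"])
      fix x assume x: "x \<in> ball z0 d"
      have "(g has_derivative g' x) (at x)" using g' d(2) x by blast
      from has_derivative_at_withinI[OF has_derivative_diff[OF this
          bounded_linear_imp_has_derivative[OF has_derivative_bounded_linear[OF D]]]]
      show "((\<lambda>x. g x - D x) has_derivative (\<lambda>v. g' x v - D v)) (at x within ball z0 d)" .
      show "onorm (\<lambda>v. g' x v - D v) \<le> e"
        using d(3)[of x] x gz0 \<open>e > 0\<close> by (intro onorm_bound) (auto simp: dist_commute)
    qed (use yz in \<open>auto simp: dist_commute\<close>)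
    then show "norm (g y - g z - D (y - z)) \<le> e * norm (y - z)"
      by (simp add: D.diff algebra_simps)
  qed
qed

section \<open>Polynomials as holomorphic functions and their gradients\<close>

lemma holo_map_on_complex_poly:
  assumes "complex_poly F" "holo_map_on W g"
  shows "holo_fun_on W (\<lambda>z. F (g z))"
  unfolding holo_fun_on_iff
proof (intro conjI ballI)
  show "open W" using assms(2) by (rule holo_map_on_open)
  fix z assume z: "z \<in> W"
  show "\<exists>h'. ((\<lambda>z. F (g z)) has_derivative h') (at z) \<and> (\<forall>c v. h' (c *s v) = c * h' v)"
    using assms(1)
  proof (induction F rule: complex_poly.induct)
    case (1 a)
    show ?case by (intro exI[of _ "\<lambda>v. 0"]) auto
  next
    case (2 i)
    obtain g' where "(g has_derivative g') (at z)" "\<And>c v. g' (c *s v) = c *s g' v"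
      using assms(2) z unfolding holo_map_on_iff by blast
    then show ?case by (intro exI[of _ "\<lambda>v. g' v $ i"]) (auto simp: has_derivative_vec_iff)
  next
    case (3 F G)
    then obtain F' G' where "((\<lambda>z. F (g z)) has_derivative F') (at z)" "\<forall>c v. F' (c *s v) = c * F' v"
      "((\<lambda>z. G (g z)) has_derivative G') (at z)" "\<forall>c v. G' (c *s v) = c * G' v" by blast
    then show ?case
      by (intro exI[of _ "\<lambda>v. F' v + G' v"]) (auto intro: has_derivative_add simp: algebra_simps)
  next
    case (4 F G)
    then obtain F' G' where "((\<lambda>z. F (g z)) has_derivative F') (at z)" "\<forall>c v. F' (c *s v) = c * F' v"
      "((\<lambda>z. G (g z)) has_derivative G') (at z)" "\<forall>c v. G' (c *s v) = c * G' v" by blast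
    then show ?case
      by (intro exI[of _ "\<lambda>v. F (g z) * G' v + F' v * G (g z)"] conjI has_derivative_mult)
        (auto simp: algebra_simps)
  qed
qed

lemma holo_fun_on_line:
  assumes "holo_fun_on W f" "open U" "\<And>t. t \<in> U \<Longrightarrow> a + t *s v \<in> W"
  shows "(\<lambda>t. f (a + t *s v)) holomorphic_on U"
proof -
  \<comment> \<open>The scalar function is treated as a map into \<open>complex ^ 1\<close>, where
    \<open>undefined\<close> names the only index.\<close>
  let ?g = "\<lambda>z. axis undefined (f z) :: complex ^ 1"
  have "holo_map_on W ?g" unfolding holo_map_on_def
    using assms(1) by (auto simp: axis_def holo_fun_on_def)
  then have "((\<lambda>t. ?g (a + t *s v) $ undefined) field_differentiable (at t within U))" if "t \<in> U" for t
    using assms(3)[OF that] holo_map_on_restrict_line[of W ?g a t v]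
    unfolding holo_map_on_iff field_differentiable_def by (meson has_field_derivative_at_within)
  then show ?thesis by (simp add: holomorphic_on_def axis_def)
qed

lemma complex_poly_derivative:
  fixes F :: "complex ^ 'm \<Rightarrow> complex"
  assumes "complex_poly F"
  shows "(F has_derivative (\<lambda>v. dotc (gradient F x) v)) (at x)"
proof -
  have "holo_map_on UNIV (\<lambda>z :: complex ^ 'm. z)"
    unfolding holo_map_on_iff by (auto intro!: exI[of _ "\<lambda>v. v"])
  from holo_map_on_complex_poly[OF assms this] obtain a
    where a: "(F has_derivative (\<lambda>v. \<Sum>j\<in>UNIV. a $ j * v $ j)) (at x)"
    unfolding holo_fun_on_def by auto
  then have "frechet_derivative F (at x) = dotc a"
    using frechet_derivative_at[OF a] by (simp add: dotc_def[abs_def])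
  then have "gradient F x = a"
    by (simp add: gradient_def vec_eq_iff dotc_commute[of a])
  then show ?thesis using a by (simp add: dotc_def)
qed

section \<open>Holomorphic retractions onto a cone\<close>

lemma matrix_of_complex_linear:
  fixes f :: "complex ^ 'm \<Rightarrow> complex ^ 'm"
  assumes "\<And>u v. f (u + v) = f u + f v" "\<And>c v. f (c *s v) = c *s f v"
  obtains M where "f = (*v) M"
proof -
  have "Vector_Spaces.linear (*s) (*s) f"
    by unfold_locales (simp_all add: assms vec_eq_iff algebra_simps)
  then have "f = (*v) (matrix f)" by (intro ext) (simp add: matrix_works)
  then show thesis by (rule that)
qed

lemma complex_poly_line_derivative:
  fixes F :: "complex ^ 'm \<Rightarrow> complex"
  assumes "complex_poly F"
  shows "((\<lambda>t. F (a + t *s v)) has_field_derivative dotc (gradient F a) v) (at 0)"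
proof -
  let ?g = "\<lambda>z. (\<chi> i. F z) :: complex ^ 1"
  have "holo_map_on UNIV (\<lambda>z :: complex ^ 'm. z)"
    unfolding holo_map_on_iff by (auto intro!: exI[of _ "\<lambda>v. v"])
  then have g: "holo_map_on UNIV ?g"
    using holo_map_on_complex_poly[OF assms] by (simp add: holo_map_on_def)
  have "(?g has_derivative (\<lambda>v. \<chi> i. dotc (gradient F a) v)) (at (a + 0 *s v))"
    using complex_poly_derivative[OF assms, of a] by (simp add: has_derivative_vec_iff)
  from holo_map_on_restrict_line[OF g _ this] show ?thesis by simp
qed

locale cone_retraction = irreducible_cone Z
  for Z :: "(complex ^ 'm::finite) set" +
  fixes \<Omega> :: "(complex ^ 'm) set" and \<rho> :: "complex ^ 'm \<Rightarrow> complex ^ 'm"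
    and p :: "complex ^ 'm" and D :: "complex ^ 'm ^ 'm"
  assumes holo: "holo_map_on \<Omega> \<rho>"
    and p: "p \<in> \<Omega>" "p \<in> Z" "p \<noteq> 0"
    and into: "z \<in> \<Omega> \<Longrightarrow> \<rho> z \<in> Z"
    and fixed: "z \<in> \<Omega> \<Longrightarrow> z \<in> Z \<Longrightarrow> \<rho> z = z"
    and deriv: "(\<rho> has_derivative ((*v) D)) (at p)"
begin

lemma open_domain: "open \<Omega>"
  using holo by (rule holo_map_on_open)

lemma D_idempotent: "D *v (D *v v) = D *v v"
proof -
  have "\<rho> p = p" using fixed p by blast
  define W where "W = \<Omega> \<inter> \<rho> -` \<Omega>"
  have "open W" unfolding W_def
    using continuous_open_preimage[OF holo_map_on_continuous[OF holo] open_domain open_domain] .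
  have "(\<rho> has_derivative ((*v) D)) (at (\<rho> p))" using deriv \<open>\<rho> p = p\<close> by simp
  from has_derivative_compose[OF deriv this]
  have 1: "((\<lambda>z. \<rho> (\<rho> z)) has_derivative (\<lambda>v. D *v (D *v v))) (at p)" .
  have "((\<lambda>z. \<rho> (\<rho> z)) has_derivative ((*v) D)) (at p)"
    by (rule has_derivative_transform_within_open[OF deriv \<open>open W\<close>])
      (use p \<open>\<rho> p = p\<close> in \<open>auto simp: W_def fixed into\<close>)
  from fun_cong[OF has_derivative_unique[OF 1 this], of v] show ?thesis .
qed

text \<open>The ray through \<open>p\<close> lies in the cone and is fixed by \<rho> near
  \<open>p\<close>, so its direction is tangent.\<close>

lemma D_point: "D *v p = p"
proof -
  let ?g = "\<lambda>t :: real. p + t *\<^sub>R p"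
  have g: "(?g has_derivative (\<lambda>t. t *\<^sub>R p)) (at 0)" by (auto intro!: derivative_eq_intros)
  have "(\<rho> has_derivative ((*v) D)) (at (?g 0))" using deriv by simp
  from has_derivative_compose[OF g this]
  have 1: "((\<lambda>t. \<rho> (?g t)) has_derivative (\<lambda>t. D *v (t *\<^sub>R p))) (at 0)" .
  have "open (?g -` \<Omega>)" using open_domain by (intro open_vimage) (auto intro!: continuous_intros)
  have 2: "((\<lambda>t. \<rho> (?g t)) has_derivative (\<lambda>t. t *\<^sub>R p)) (at 0)"
  proof (rule has_derivative_transform_within_open[OF g \<open>open (?g -` \<Omega>)\<close>])
    fix t assume t: "t \<in> ?g -` \<Omega>"
    have "?g t = complex_of_real (1 + t) *s p"
      by (simp add: vec_eq_iff scaleR_conv_of_real[where 'a = complex] algebra_simps)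
    then have "?g t \<in> Z" using scale_closed[OF p(2)] by metis
    then show "?g t = \<rho> (?g t)" using fixed t by simp
  qed (use p in simp)
  from fun_cong[OF has_derivative_unique[OF 1 2], of 1] show ?thesis by simp
qed

text \<open>Since \<rho> fixes both ends, strict differentiability says that chords of
  \<open>Z\<close> near \<open>p\<close> are almost tangent, that is, almost fixed by
  \<open>D\<close>.\<close>

lemma strict_on_cone:
  assumes "e > 0"
  obtains d where "d > 0" "ball p d \<subseteq> \<Omega>"
    "\<And>y z. y \<in> Z \<Longrightarrow> z \<in> Z \<Longrightarrow> dist y p < d \<Longrightarrow> dist z p < d \<Longrightarrow>
      norm ((y - z) - D *v (y - z)) \<le> e * norm (y - z)"
proof -
  obtain d where d: "d > 0" "ball p d \<subseteq> \<Omega>"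
    "\<And>y z. dist y p < d \<Longrightarrow> dist z p < d \<Longrightarrow> norm (\<rho> y - \<rho> z - D *v (y - z)) \<le> e * norm (y - z)"
    by (rule holo_map_strict_derivative[OF holo p(1) deriv assms]) blast
  show thesis
  proof (rule that[OF d(1,2)])
    fix y z assume yz: "y \<in> Z" "z \<in> Z" "dist y p < d" "dist z p < d"
    then have "y \<in> \<Omega>" "z \<in> \<Omega>" using d(2) by (auto simp: dist_commute)
    then show "norm ((y - z) - D *v (y - z)) \<le> e * norm (y - z)"
      using d(3)[OF yz(3,4)] fixed yz by simp
  qed
qed

text \<open>If the range of \<open>L\<close> were larger than that of \<open>D\<close>, minimality
  would make \<open>L\<close> dominant and hence open at \<open>p\<close>: \<open>Z\<close> would
  contain points near \<open>p\<close> over \<open>L *v p\<close> plus any small multiple of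
  \<open>q1\<close>. Their chords to \<open>p\<close> are almost tangent, while \<open>q1\<close> is
  transversal to the range of \<open>D\<close>.\<close>

lemma range_of_minimal_projection:
  assumes L: "finite_projection Z L" "\<And>x. L *v (L *v x) = L *v x" "\<And>x. L *v (D *v x) = D *v x"
    and minimal: "\<And>M. finite_projection Z M \<Longrightarrow> (\<And>x. M *v (M *v x) = M *v x) \<Longrightarrow>
      (\<And>x. M *v (D *v x) = D *v x) \<Longrightarrow> vec.dim (range ((*v) L)) \<le> vec.dim (range ((*v) M))"
  shows "D *v (L *v x0) = L *v x0"
proof (rule ccontr)
  interpret finite_projection Z L by fact
  assume x0: "D *v (L *v x0) \<noteq> L *v x0"
  define q1 where "q1 = L *v x0"
  have q1: "q1 \<notin> range ((*v) D)"
  proof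
    assume "q1 \<in> range ((*v) D)"
    then obtain y where "q1 = D *v y" by (rule rangeE)
    then show False using x0 D_idempotent[of y] by (simp add: q1_def)
  qed
  text \<open>Otherwise one could project further from \<open>q\<close>.\<close>
  have hit: "\<exists>z\<in>Z. L *v z = L *v x" if q: "L *v x \<notin> range ((*v) D)" for x
  proof -
    define q where "q = L *v x"
    obtain u where u: "\<And>w. w \<in> range ((*v) D) \<Longrightarrow> dotc u w = 0" "dotc u q = 1"
      by (rule separating_functional[OF subspace_range_matrix q[folded q_def]]) blast
    obtain E where E: "\<And>x. E *v x = x - dotc u x *s q" using rank_one_projector by blast
    define M where "M = E ** L"
    have M: "M *v x = L *v x - dotc u (L *v x) *s q" for x
      by (simp add: M_def E flip: matrix_vector_mul_assoc)
    have Lq: "L *v q = q" by (simp add: q_def L(2))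
    have M1: "M *v (M *v x) = M *v x" for x
      by (simp add: M matrix_vector_mult_diff_distrib vector_scalar_commute L(2) Lq u(2))
    have M2: "M *v (D *v x) = D *v x" for x by (simp add: M L(3) u(1))
    have "range ((*v) M) \<subset> range ((*v) L)"
    proof
      have "M *v y = L *v (y - dotc u (L *v y) *s x)" for y
        by (simp add: M q_def matrix_vector_mult_diff_distrib vector_scalar_commute)
      then show "range ((*v) M) \<subseteq> range ((*v) L)" by auto
      have "dotc u (M *v y) = 0" for y by (simp add: M u)
      then have "q \<notin> range ((*v) M)" using u by auto
      then show "range ((*v) M) \<noteq> range ((*v) L)" by (auto simp: q_def)
    qed
    then have "vec.span (range ((*v) M)) \<subset> vec.span (range ((*v) L))"
      using vec.span_eq_iff subspace_range_matrix by metis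
    then have "vec.dim (range ((*v) M)) < vec.dim (range ((*v) L))" by (rule vec.dim_psubset)
    then have "\<not> finite_projection Z M" using minimal[OF _ M1 M2] by linarith
    then obtain z where z: "z \<in> Z" "M *v z = 0" "z \<noteq> 0"
      using irreducible_cone_axioms by (auto simp: finite_projection_def finite_projection_axioms_def)
    define c where "c = dotc u (L *v z)"
    have Lz: "L *v z = c *s q" using z(2) by (simp add: M c_def)
    have "L *v z \<noteq> 0" using kernel z by blast
    then have "c \<noteq> 0" using Lz by auto
    then have "L *v (inverse c *s z) = q" by (simp add: vector_scalar_commute Lz)
    then show ?thesis using scale_closed[OF z(1)] q_def by blast
  qed
  interpret dominant_projection Z L
  proof
    show "L *v (L *v x) = L *v x" for x by (rule L(2))
    fix F x assume F: "complex_poly F" "\<And>z. z \<in> Z \<Longrightarrow> F (L *v z) = 0"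
    show "F (L *v x) = 0"
    proof (cases "L *v x \<in> range ((*v) D)")
      case False
      then show ?thesis using hit F(2) by metis
    next
      case True
      then obtain y where y: "L *v x = D *v y" by (rule rangeE)
      have "complex_poly (\<lambda>y. F (L *v y))" using F(1) by (rule complex_poly_compose_matrix)
      then obtain h where "polyfam h" and h: "\<And>v t. F (L *v (x + t *s v)) = poly (h v) t"
        by (rule polyfam_on_line[where a = x]) blast
      \<comment> \<open>If \<open>L *v x\<close> is in the range of \<open>D\<close>, the line
        through \<open>x\<close> in direction \<open>x0\<close> has its other points mapped outside,
        since the image moves along \<open>q1\<close>. The polynomial vanishes at those points and
        therefore also at \<open>x\<close>.\<close>
      have "poly (h x0) t = 0" if t: "t \<noteq> 0" for t
      proof -
        have "L *v (x + t *s x0) \<notin> range ((*v) D)"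
        proof
          assume "L *v (x + t *s x0) \<in> range ((*v) D)"
          then obtain y' where "L *v (x + t *s x0) = D *v y'" by (rule rangeE)
          moreover have "L *v (x + t *s x0) = D *v y + t *s q1"
            by (simp add: matrix_vector_right_distrib vector_scalar_commute q1_def y)
          ultimately have eq: "t *s q1 = D *v (y' - y)"
            unfolding matrix_vector_mult_diff_distrib by (metis add_diff_cancel_left')
          have "D *v (inverse t *s (y' - y)) = inverse t *s (t *s q1)"
            by (simp only: vector_scalar_commute eq)
          also have "\<dots> = q1" using t by simp
          finally show False using q1 by (metis rangeI)
        qed
        then show ?thesis using hit F(2) h by metis
      qed
      then have "- {0} \<subseteq> {t. poly (h x0) t = 0}" by auto
      moreover have "infinite (- {0 :: complex})"
        by (simp add: infinite_UNIV_char_0 Compl_eq_Diff_UNIV)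
      ultimately have "h x0 = 0" using poly_zero_on_infinite finite_subset by blast
      then show ?thesis using h[of 0 x0] by simp
    qed
  qed
  obtain u where u: "\<And>w. w \<in> range ((*v) D) \<Longrightarrow> dotc u w = 0" "dotc u q1 = 1"
    using separating_functional[OF subspace_range_matrix q1] by blast
  define U where "U = (\<Sum>i\<in>UNIV. norm (u $ i))"
  have U: "U \<ge> 0" "\<And>v. norm (dotc u v) \<le> U * norm v"
    using norm_dotc_le by (auto simp: U_def sum_nonneg)
  obtain K where K: "K > 0" "\<And>x. norm (L *v x) \<le> K * norm x" using matrix_vector_bounded[of L] by blast
  \<comment> \<open>\<open>B\<close> dominates both constants that occur below. With
    \<open>e = 1 / (2 * B)\<close> the product \<open>(1 + K) * e\<close> is at most
    \<open>1 / 2\<close>, which absorbs the normal part of \<open>v\<close>, and the final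
    comparison with \<open>t\<close> has a factor below 1.\<close>
  define B where "B = (1 + K) * (1 + U) * (1 + norm q1)"
  have B: "1 + K \<le> B" "U * K * norm q1 < B" "B > 0"
  proof -
    have pos: "(1 + K) * (1 + U) > 0" using K U by simp
    show "B > 0" unfolding B_def using pos by (simp add: add_pos_nonneg)
    have "1 + K \<le> (1 + K) * (1 + U)" using K U by simp
    also have "\<dots> \<le> B" using pos by (simp add: B_def mult_le_cancel_left1 not_le)
    finally show "1 + K \<le> B" .
    have "U * K \<le> (1 + K) * (1 + U)" using K U by (simp add: algebra_simps)
    then have "U * K * norm q1 \<le> (1 + K) * (1 + U) * norm q1" by (rule mult_right_mono) simp
    also have "\<dots> < B" unfolding B_def using pos by (intro mult_strict_left_mono) auto
    finally show "U * K * norm q1 < B" .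
  qed
  define e where "e = 1 / (2 * B)"
  have e: "e > 0" using B by (simp add: e_def)
  have e1: "(1 + K) * e \<le> 1 / 2" using B by (simp add: e_def field_simps)
  have e2: "U * K * e * (2 * norm q1) < 1" using B by (simp add: e_def field_simps)
  obtain d where "ball p d \<subseteq> \<Omega>" and d: "d > 0" "\<And>y z. y \<in> Z \<Longrightarrow> z \<in> Z \<Longrightarrow> dist y p < d \<Longrightarrow> dist z p < d \<Longrightarrow>
      norm ((y - z) - D *v (y - z)) \<le> e * norm (y - z)"
    using strict_on_cone[OF e] by metis
  obtain \<delta> where \<delta>: "\<delta> > 0" "\<And>x. dist (L *v x) (L *v p) < \<delta> \<Longrightarrow> \<exists>z\<in>Z. L *v z = L *v x \<and> dist z p < d"
    by (rule open_at_point[OF p(2) d(1)]) blast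
  define Q where "Q = 1 + norm q1"
  define t where "t = \<delta> / (2 * Q)"
  have Q: "Q > 0" "norm q1 \<le> Q" by (simp_all add: Q_def add_pos_nonneg)
  have t: "t > 0" using \<delta> Q by (simp add: t_def)
  have Lx: "L *v (p + of_real t *s x0) = L *v p + of_real t *s q1"
    by (simp add: matrix_vector_right_distrib vector_scalar_commute q1_def)
  have "t * norm q1 \<le> t * Q" using t Q by simp
  also have "\<dots> = \<delta> / 2" using Q by (simp add: t_def)
  also have "\<dots> < \<delta>" using \<delta> by simp
  finally have "dist (L *v (p + of_real t *s x0)) (L *v p) < \<delta>"
    using t by (simp add: Lx dist_norm norm_vector_scale)
  then obtain z where z: "z \<in> Z" "L *v z = L *v p + of_real t *s q1" "dist z p < d"
    using \<delta>(2)[of "p + of_real t *s x0"] Lx by auto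
  define v where "v = z - p"
  define w where "w = v - D *v v"
  have w: "norm w \<le> e * norm v" using d(2)[OF z(1) p(2) z(3)] d(1) by (simp add: v_def w_def)
  have Lv: "L *v v = of_real t *s q1" by (simp add: v_def matrix_vector_mult_diff_distrib z(2))
  have Lw: "L *v w = of_real t *s q1 - D *v v" by (simp add: w_def matrix_vector_mult_diff_distrib Lv L(3))
  \<comment> \<open>The functional \<open>u\<close> is 0 on the range of \<open>D\<close> and 1 at
    \<open>q1\<close>, so \<open>t\<close> is read off from the normal part \<open>w\<close> alone,
    which is too small for that.\<close>
  have "dotc u (L *v w) = of_real t" by (simp add: Lw u)
  then have "t = norm (dotc u (L *v w))" using t by simp
  also have "\<dots> \<le> U * (K * norm w)" using U K(2)[of w] by (meson mult_left_mono order_trans)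
  also have "\<dots> \<le> U * (K * (e * norm v))" using U K w by (intro mult_left_mono) auto
  finally have tle: "t \<le> U * K * e * norm v" by (simp add: mult.assoc)
  have "D *v v = of_real t *s q1 - L *v w" using Lw by simp
  then have "norm (D *v v) \<le> t * norm q1 + norm (L *v w)"
    using norm_triangle_ineq4[of "of_real t *s q1" "L *v w"] t by (simp add: norm_vector_scale)
  then have "norm (D *v v) \<le> t * norm q1 + K * norm w" using K(2)[of w] by linarith
  moreover have "norm v \<le> norm w + norm (D *v v)"
    using norm_triangle_ineq[of w "D *v v"] by (simp add: w_def)
  ultimately have "norm v \<le> t * norm q1 + (1 + K) * norm w" by (simp add: algebra_simps)
  also have "(1 + K) * norm w \<le> (1 + K) * (e * norm v)" using w K by (intro mult_left_mono) auto
  also have "(1 + K) * (e * norm v) \<le> 1 / 2 * norm v"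
    using mult_right_mono[OF e1 norm_ge_zero[of v]] by (simp add: mult.assoc)
  finally have nv: "norm v \<le> t * (2 * norm q1)" by simp
  have "U * K * e * norm v \<le> U * K * e * (t * (2 * norm q1))"
    using nv U K e by (intro mult_left_mono) auto
  also have "\<dots> = t * (U * K * e * (2 * norm q1))" by simp
  also have "\<dots> < t * 1" using e2 t by (intro mult_strict_left_mono)
  finally show False using tle by simp
qed

lemma good_projection:
  obtains L where "finite_projection Z L" "\<And>x. L *v (L *v x) = L *v x"
    "\<And>x. L *v (D *v x) = D *v x" "\<And>x. D *v (L *v x) = L *v x"
proof -
  let ?P = "\<lambda>L. finite_projection Z L \<and> (\<forall>x. L *v (L *v x) = L *v x) \<and> (\<forall>x. L *v (D *v x) = D *v x)"
  have "?P (mat 1)"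
    using irreducible_cone_axioms by (simp add: finite_projection_def finite_projection_axioms_def)
  then obtain L where L: "?P L" "\<And>M. ?P M \<Longrightarrow> vec.dim (range ((*v) L)) \<le> vec.dim (range ((*v) M))"
    using ex_has_least_nat[of ?P "mat 1" "\<lambda>L. vec.dim (range ((*v) L))"] by blast
  have "D *v (L *v x) = L *v x" for x
    by (rule range_of_minimal_projection) (use L in blast)+
  then show thesis using that L(1) by blast
qed

end

text \<open>\<open>L\<close> is now a projection onto the tangent space at \<open>p\<close>.\<close>

locale tangent_projection = cone_retraction Z \<Omega> \<rho> p D + finite_projection Z L
  for Z :: "(complex ^ 'm::finite) set" and \<Omega> \<rho> p D L +
  assumes LL: "L *v (L *v x) = L *v x"
    and LD: "L *v (D *v x) = D *v x"
    and DL: "D *v (L *v x) = L *v x"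
begin

lemma range_eq: "range ((*v) L) = range ((*v) D)"
proof (intro subset_antisym subsetI)
  show "y \<in> range ((*v) D)" if "y \<in> range ((*v) L)" for y
    using that DL by (metis rangeE rangeI)
  show "y \<in> range ((*v) L)" if "y \<in> range ((*v) D)" for y
    using that LD by (metis rangeE rangeI)
qed

text \<open>The map \<open>h\<close>, equal to \<rho> followed by \<open>L\<close> plus the identity
  minus \<open>L\<close>, has the same image under \<open>L\<close> as \<rho> and is locally
  invertible at \<open>p\<close>. Composing \<rho> with its inverse lifts the projection to
  \<open>Z\<close>.\<close>

lemma local_section:
  obtains V \<psi> where "holo_map_on V \<psi>" "p \<in> V" "\<And>y. y \<in> V \<Longrightarrow> \<psi> y \<in> Z"
    "\<And>y. y \<in> V \<Longrightarrow> L *v \<psi> y = L *v y"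
proof -
  obtain \<rho>' where \<rho>': "\<And>z. z \<in> \<Omega> \<Longrightarrow> (\<rho> has_derivative \<rho>' z) (at z)"
    "\<And>z c v. z \<in> \<Omega> \<Longrightarrow> \<rho>' z (c *s v) = c *s \<rho>' z v"
    using holo unfolding holo_map_on_iff by metis
  have \<rho>'p: "\<rho>' p = (*v) D" using has_derivative_unique[OF \<rho>'(1)[OF p(1)] deriv] .
  define h where "h = (\<lambda>z. L *v \<rho> z + (z - L *v z))"
  define h' where "h' = (\<lambda>z v. L *v \<rho>' z v + (v - L *v v))"
  have L': "(f has_derivative f') (at z) \<Longrightarrow> ((\<lambda>z. L *v f z) has_derivative (\<lambda>v. L *v f' v)) (at z)"
    for f f' and z :: "complex ^ 'm"
    by (rule bounded_linear.has_derivative[OF matrix_vector_mul_bounded_linear])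
  have dh: "(h has_derivative h' z) (at z)" if "z \<in> \<Omega>" for z
    unfolding h_def h'_def
    by (intro has_derivative_add has_derivative_diff L' \<rho>'(1) that has_derivative_ident)
  have lin: "h' z (c *s v) = c *s h' z v" if "z \<in> \<Omega>" for z c v
    unfolding h'_def \<rho>'(2)[OF that] vector_scalar_commute by (simp add: vec_eq_iff algebra_simps)
  have holh: "holo_map_on \<Omega> h"
    unfolding holo_map_on_iff using open_domain dh lin by blast
  define f' where "f' = (\<lambda>z. Blinfun (h' z))"
  have f': "blinfun_apply (f' z) = h' z" if "z \<in> \<Omega>" for z
    unfolding f'_def using has_derivative_bounded_linear[OF dh[OF that]]
    by (rule bounded_linear_Blinfun_apply)
  have "continuous_on \<Omega> f'"
  proof (rule continuous_at_imp_continuous_on, rule ballI)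
    fix z0 assume z0: "z0 \<in> \<Omega>"
    show "isCont f' z0"
      unfolding continuous_at_eps_delta
    proof (intro allI impI)
      fix e :: real assume "e > 0"
      then have e2: "e / 2 > 0" by simp
      obtain d where d: "d > 0" "ball z0 d \<subseteq> \<Omega>"
        "\<And>z v. dist z z0 < d \<Longrightarrow> norm (h' z v - h' z0 v) \<le> e / 2 * norm v"
        by (rule holo_map_derivative_continuous[OF holh dh z0 e2]) blast+
      have "dist (f' z) (f' z0) < e" if z: "dist z z0 < d" for z
      proof -
        have "z \<in> \<Omega>" using z d(2) by (auto simp: dist_commute)
        then have "norm (f' z - f' z0) \<le> e / 2"
          using d(3)[OF z] e2 by (intro norm_blinfun_bound) (auto simp: blinfun.diff_left f' z0)
        then show ?thesis using \<open>e > 0\<close> by (simp add: dist_norm)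
      qed
      then show "\<exists>d>0. \<forall>z. dist z z0 < d \<longrightarrow> dist (f' z) (f' z0) < e" using d(1) by blast
    qed
  qed
  \<comment> \<open>With \<open>N = L - D\<close> one has \<open>N N = 0\<close>, because
    \<open>L\<close> and \<open>D\<close> are projections with the same range. The derivative of
    \<open>h\<close> at \<open>p\<close> is \<open>1 - N\<close>, and \<open>Y\<close> is
    \<open>1 + N\<close>.\<close>
  define Y where "Y = (\<lambda>v. v + (L *v v - D *v v))"
  have blY: "bounded_linear Y"
    unfolding Y_def by (intro bounded_linear_add bounded_linear_sub bounded_linear_ident
        matrix_vector_mul_bounded_linear)
  have "Y (h' p v) = v" for v
    unfolding Y_def h'_def \<rho>'p
    by (simp add: matrix_vector_right_distrib matrix_vector_mult_diff_distrib LL LD DL D_idempotent algebra_simps)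
  then have inv: "Blinfun Y o\<^sub>L f' p = id_blinfun"
    by (intro blinfun_eqI) (simp add: f'[OF p(1)] bounded_linear_Blinfun_apply[OF blY])
  have derf: "(h has_derivative blinfun_apply (f' z)) (at z)" if "z \<in> \<Omega>" for z
    using dh[OF that] f'[OF that] by simp
  obtain U V g g' where IFT: "open U" "U \<subseteq> \<Omega>" "p \<in> U" "open V" "h p \<in> V" "homeomorphism U V h g"
    "\<And>y. y \<in> V \<Longrightarrow> (g has_derivative (g' y)) (at y)"
    "\<And>y. y \<in> V \<Longrightarrow> g' y = inv (blinfun_apply (f' (g y)))"
    "\<And>y. y \<in> V \<Longrightarrow> bij (blinfun_apply (f' (g y)))"
    using inverse_function_theorem[OF open_domain derf \<open>continuous_on \<Omega> f'\<close> p(1) inv] by blast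
  have hp: "h p = p" using fixed p by (simp add: h_def)
  have gU: "g y \<in> \<Omega>" "h (g y) = y" if "y \<in> V" for y
    using IFT(2,6) that by (auto simp: homeomorphism_def)
  have "holo_map_on V g"
    unfolding holo_map_on_iff
  proof (intro conjI ballI)
    fix y assume y: "y \<in> V"
    have bij: "bij (h' (g y))" and g'y: "g' y = inv (h' (g y))"
      using IFT(8,9)[OF y] f'[OF gU(1)[OF y]] by auto
    \<comment> \<open>The inverse function theorem is applied over the reals, so complex homogeneity
      is obtained separately, from the inverse of a complex linear bijection.\<close>
    have "g' y (c *s v) = c *s g' y v" for c v
    proof -
      have "h' (g y) (c *s g' y v) = c *s v"
        using lin[OF gU(1)[OF y]] bij by (simp add: g'y bij_is_surj surj_f_inv_f)
      then show ?thesis using bij by (metis g'y bij_inv_eq_iff)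
    qed
    then show "\<exists>g'. (g has_derivative g') (at y) \<and> (\<forall>c v. g' (c *s v) = c *s g' v)"
      using IFT(7)[OF y] by blast
  qed (rule IFT(4))
  then have "holo_map_on V (\<lambda>y. \<rho> (g y))"
    using gU(1) by (intro holo_map_on_compose[OF _ holo]) auto
  moreover have "L *v \<rho> (g y) = L *v y" if "y \<in> V" for y
  proof -
    have "L *v y = L *v h (g y)" using gU(2)[OF that] by simp
    also have "\<dots> = L *v \<rho> (g y)"
      by (simp add: h_def matrix_vector_right_distrib matrix_vector_mult_diff_distrib LL)
    finally show ?thesis by simp
  qed
  ultimately show thesis
    using that[of V "\<lambda>y. \<rho> (g y)"] IFT(5) hp gU(1) into by auto
qed

text \<open>By the local section the image of \<open>Z\<close> contains that of a neighbourhood of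
  \<open>p\<close>; a polynomial vanishing there vanishes on the whole range, as one sees on lines
  through \<open>p\<close>.\<close>

sublocale dominant_projection Z L
proof
  show "L *v (L *v x) = L *v x" for x by (rule LL)
  fix F x assume F: "complex_poly F" "\<And>z. z \<in> Z \<Longrightarrow> F (L *v z) = 0"
  obtain V \<psi> where V: "holo_map_on V \<psi>" "p \<in> V" "\<And>y. y \<in> V \<Longrightarrow> \<psi> y \<in> Z"
    "\<And>y. y \<in> V \<Longrightarrow> L *v \<psi> y = L *v y" by (rule local_section) blast
  have FV: "F (L *v y) = 0" if "y \<in> V" for y using F(2)[OF V(3)[OF that]] V(4)[OF that] by simp
  have "complex_poly (\<lambda>y. F (L *v y))" using F(1) by (rule complex_poly_compose_matrix)
  then obtain h where "polyfam h" and h: "\<And>v t. F (L *v (p + t *s v)) = poly (h v) t"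
    by (rule polyfam_on_line[where a = p]) blast
  obtain r where r: "r > 0" "ball p r \<subseteq> V"
    using holo_map_on_open[OF V(1)] V(2) open_contains_ball by blast
  define e where "e = r / (1 + norm (x - p))"
  have pos: "1 + norm (x - p) > 0" by (simp add: add_pos_nonneg)
  have e: "e > 0" using r pos by (simp add: e_def)
  have "poly (h (x - p)) t = 0" if t: "t \<in> ball 0 e" for t
  proof -
    have "norm t * norm (x - p) \<le> norm t * (1 + norm (x - p))" by (simp add: mult_left_mono)
    also have "\<dots> < r" using t pos by (simp add: e_def pos_less_divide_eq)
    finally have "norm (t *s (x - p)) < r" by (simp only: norm_vector_scale)
    then have "p + t *s (x - p) \<in> ball p r" by (simp only: mem_ball dist_norm norm_minus_commute[of p] add_diff_cancel_left')
    then have "p + t *s (x - p) \<in> V" using r(2) by blast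
    then show ?thesis using FV h by metis
  qed
  then have "ball 0 e \<subseteq> {t. poly (h (x - p)) t = 0}" by blast
  moreover have "infinite (ball (0 :: complex) e)"
    using e uncountable_ball[of e "0 :: complex"] countable_finite by blast
  ultimately have "h (x - p) = 0" using poly_zero_on_infinite finite_subset by blast
  then show "F (L *v x) = 0" using h[of 1 "x - p"] by simp
qed

text \<open>For two points with equal image the chord \<open>v\<close> has a normal part
  \<open>w\<close> with \<open>L *v w = - (D *v v)\<close>. So the norm of \<open>v\<close> is at
  most \<open>1 + K\<close> times that of \<open>w\<close>, and near \<open>p\<close> this is at
  most half the norm of \<open>v\<close>.\<close>

lemma locally_injective:
  obtains e where "e > 0"
    "\<And>y z. y \<in> Z \<Longrightarrow> z \<in> Z \<Longrightarrow> dist y p < e \<Longrightarrow> dist z p < e \<Longrightarrow> L *v y = L *v z \<Longrightarrow> y = z"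
proof -
  obtain K where K: "K > 0" "\<And>x. norm (L *v x) \<le> K * norm x" using matrix_vector_bounded[of L] by blast
  define c where "c = 1 / (2 * (1 + K))"
  have c: "c > 0" using K by (simp add: c_def)
  obtain d where "ball p d \<subseteq> \<Omega>" and d: "d > 0" "\<And>y z. y \<in> Z \<Longrightarrow> z \<in> Z \<Longrightarrow> dist y p < d \<Longrightarrow> dist z p < d \<Longrightarrow>
      norm ((y - z) - D *v (y - z)) \<le> c * norm (y - z)"
    by (rule strict_on_cone[OF c]) blast
  show thesis
  proof (rule that[OF d(1)])
    fix y z assume yz: "y \<in> Z" "z \<in> Z" "dist y p < d" "dist z p < d" "L *v y = L *v z"
    define v where "v = y - z"
    define w where "w = v - D *v v"
    have w: "norm w \<le> c * norm v" using d(2)[OF yz(1-4)] by (simp add: v_def w_def)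
    have "L *v v = 0" by (simp add: v_def matrix_vector_mult_diff_distrib yz(5))
    then have "L *v w = - (D *v v)" by (simp add: w_def matrix_vector_mult_diff_distrib LD)
    then have "norm (D *v v) \<le> K * norm w" using K(2)[of w] by simp
    moreover have "norm v \<le> norm w + norm (D *v v)"
      using norm_triangle_ineq[of w "D *v v"] by (simp add: w_def)
    ultimately have "norm v \<le> (1 + K) * norm w" by (simp add: algebra_simps)
    also have "\<dots> \<le> (1 + K) * (c * norm v)" using w K by (intro mult_left_mono) auto
    also have "\<dots> = norm v / 2" using K by (simp add: c_def field_simps)
    finally have "v = 0" by simp
    then show "y = z" by (simp add: v_def)
  qed
qed

text \<open>The composite of \<open>F\<close> with \<rho> is identically zero near \<open>p\<close>;
  the chain rule does the rest.\<close>

lemma gradient_vanishes_on_tangent: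
  assumes "F \<in> vanishing_ideal Z"
  shows "dotc (gradient F p) (D *v x) = 0"
proof -
  have F: "complex_poly F" "\<And>z. z \<in> Z \<Longrightarrow> F z = 0" using assms by (auto simp: vanishing_ideal_def)
  have "\<rho> p = p" using fixed p by blast
  then have "(F has_derivative (\<lambda>v. dotc (gradient F p) v)) (at (\<rho> p))"
    using complex_poly_derivative[OF F(1)] by simp
  from has_derivative_compose[OF deriv this]
  have 1: "((\<lambda>z. F (\<rho> z)) has_derivative (\<lambda>v. dotc (gradient F p) (D *v v))) (at p)" .
  have "((\<lambda>z. F (\<rho> z)) has_derivative (\<lambda>v. 0)) (at p)"
    by (rule has_derivative_transform_within_open[OF has_derivative_const[of 0] open_domain p(1)])
      (simp add: F(2) into)
  from fun_cong[OF has_derivative_unique[OF 1 this], of x] show ?thesis by simp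
qed

text \<open>The part \<open>v - L *v v\<close> lies in the kernel of \<open>L\<close> and is still
  annihilated by all gradients, because \<open>L *v v\<close> is an analytic tangent vector. The
  simple root relation excludes nonzero vectors of this kind.\<close>

lemma zariski_tangent_space:
  assumes v: "\<And>F. F \<in> vanishing_ideal Z \<Longrightarrow> dotc (gradient F p) v = 0"
  shows "D *v v = v"
proof -
  obtain e where e: "e > 0"
    "\<And>y z. y \<in> Z \<Longrightarrow> z \<in> Z \<Longrightarrow> dist y p < e \<Longrightarrow> dist z p < e \<Longrightarrow> L *v y = L *v z \<Longrightarrow> y = z"
    by (rule locally_injective) blast
  have "v - L *v v = 0"
  proof (rule tangent_vector_in_kernel[OF p(2) e])
    show "L *v (v - L *v v) = 0" by (simp add: matrix_vector_mult_diff_distrib LL)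
    fix F assume F: "F \<in> vanishing_ideal Z"
    have "dotc (gradient F p) (L *v v) = 0"
      using gradient_vanishes_on_tangent[OF F, of "L *v v"] by (simp add: DL)
    then have "dotc (gradient F p) (v - L *v v) = 0" using v[OF F] by simp
    then show "((\<lambda>t. F (p + t *s (v - L *v v))) has_field_derivative 0) (at 0)"
      using complex_poly_line_derivative[of F p "v - L *v v"] F by (simp add: vanishing_ideal_def)
  qed
  then show ?thesis using DL[of v] by simp
qed

end

section \<open>Cones over projective varieties\<close>

lemma proj_class_eq_iff:
  assumes "y \<noteq> 0" "z \<noteq> 0"
  shows "proj_class y = proj_class z \<longleftrightarrow> (\<exists>c. c \<noteq> 0 \<and> z = c *s y)"
proof -
  have refl: "proportional w w" if "w \<noteq> 0" for w :: "complex ^ 'a"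
    using that by (auto simp: proportional_def intro!: exI[of _ 1])
  show ?thesis
    using Quotient3_rel[OF Quotient3_proj, of y z] refl assms by (auto simp: proportional_def)
qed

lemma proj_class_surj: "\<exists>z. z \<noteq> 0 \<and> proj_class z = q"
proof -
  have "proportional (rep_proj q) (rep_proj q)" using Quotient3_rep_reflp[OF Quotient3_proj] .
  then show ?thesis using Quotient3_abs_rep[OF Quotient3_proj, of q] by (auto simp: proportional_def)
qed

lemma proj_cone_scale: "z \<in> proj_cone S \<Longrightarrow> c \<noteq> 0 \<Longrightarrow> c *s z \<in> proj_cone S"
  using proj_class_eq_iff[of z "c *s z"] by (auto simp: proj_cone_def)

lemma homogeneous_poly_zero_scale:
  assumes "homogeneous_poly F" "F z = 0"
  shows "F (c *s z) = 0"
  using assms by (auto simp: homogeneous_poly_def)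

lemma homogeneous_poly_zero_class:
  assumes "homogeneous_poly F" "F y = 0" "y \<noteq> 0" "z \<noteq> 0" "proj_class z = proj_class y"
  shows "F z = 0"
proof -
  obtain c where "z = c *s y" using proj_class_eq_iff[of y z] assms by auto
  then show ?thesis using homogeneous_poly_zero_scale assms by blast
qed

section \<open>Zariski closures of sets of vectors\<close>

definition zariski_closure :: "(complex ^ 'm::finite) set \<Rightarrow> 'm proj set" where
  "zariski_closure Y = {q. \<forall>F. homogeneous_poly F \<and> (\<forall>y\<in>Y. F y = 0) \<longrightarrow>
     (\<forall>z. z \<noteq> 0 \<and> proj_class z = q \<longrightarrow> F z = 0)}"

lemma zariski_closed_closure: "zariski_closed (zariski_closure Y)"
  unfolding zariski_closed_def zariski_closure_def
  by (rule exI[of _ "{F. homogeneous_poly F \<and> (\<forall>y\<in>Y. F y = 0)}"]) auto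

lemma zariski_closure_contains:
  assumes "y \<in> Y" "y \<noteq> 0"
  shows "proj_class y \<in> zariski_closure Y"
  using assms homogeneous_poly_zero_class[of _ y] by (auto simp: zariski_closure_def)

lemma zariski_closure_zero:
  assumes "homogeneous_poly F" "\<And>y. y \<in> Y \<Longrightarrow> F y = 0" "z \<noteq> 0" "proj_class z \<in> zariski_closure Y"
  shows "F z = 0"
  using assms unfolding zariski_closure_def by blast

lemma zariski_closure_mono: "X \<subseteq> Y \<Longrightarrow> zariski_closure X \<subseteq> zariski_closure Y"
  unfolding zariski_closure_def by blast

lemma zariski_closure_subset:
  assumes "zariski_closed S" "Y \<subseteq> proj_cone S"
  shows "zariski_closure Y \<subseteq> S"
proof -
  obtain \<F> where \<F>: "\<And>F. F \<in> \<F> \<Longrightarrow> homogeneous_poly F"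
    "S = {p. \<forall>F\<in>\<F>. \<forall>z. z \<noteq> 0 \<and> proj_class z = p \<longrightarrow> F z = 0}"
    using assms(1) by (auto simp: zariski_closed_def)
  have "F y = 0" if "F \<in> \<F>" "y \<in> Y" for F y
    using that assms(2) unfolding \<F>(2) proj_cone_def by blast
  then show ?thesis unfolding \<F>(2) zariski_closure_def using \<F>(1) by blast
qed

lemma zariski_closed_nonmember:
  assumes "zariski_closed S" "z \<noteq> 0" "proj_class z \<notin> S"
  obtains F where "homogeneous_poly F" "\<And>y. y \<in> proj_cone S \<Longrightarrow> F y = 0" "F z \<noteq> 0"
proof -
  obtain \<F> where \<F>: "\<And>F. F \<in> \<F> \<Longrightarrow> homogeneous_poly F"
    "S = {p. \<forall>F\<in>\<F>. \<forall>z. z \<noteq> 0 \<and> proj_class z = p \<longrightarrow> F z = 0}"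
    using assms(1) by (auto simp: zariski_closed_def)
  obtain F y where F: "F \<in> \<F>" "y \<noteq> 0" "proj_class y = proj_class z" "F y \<noteq> 0"
    using assms(3) unfolding \<F>(2) by blast
  have "F z \<noteq> 0"
    using homogeneous_poly_zero_class[OF \<F>(1)[OF F(1)], of z y] F assms(2) by blast
  moreover have "F y = 0" if "y \<in> proj_cone S" for y
    using that F(1) unfolding \<F>(2) proj_cone_def by blast
  ultimately show thesis using that \<F>(1)[OF F(1)] by blast
qed

lemma projective_variety_closure:
  assumes Y: "y0 \<in> Y" "0 \<notin> Y"
    and prime: "\<And>F G. homogeneous_poly F \<Longrightarrow> homogeneous_poly G \<Longrightarrow> (\<And>y. y \<in> Y \<Longrightarrow> F y * G y = 0) \<Longrightarrow>
      (\<forall>y\<in>Y. F y = 0) \<or> (\<forall>y\<in>Y. G y = 0)"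
  shows "projective_variety (zariski_closure Y)"
  unfolding projective_variety_def
proof (intro conjI allI impI)
  show "zariski_closed (zariski_closure Y)" by (rule zariski_closed_closure)
  show "zariski_closure Y \<noteq> {}" using zariski_closure_contains[of y0 Y] Y by auto
  fix Z1 Z2 :: "'a proj set"
  assume Z: "zariski_closed Z1 \<and> zariski_closed Z2 \<and> zariski_closure Y \<subseteq> Z1 \<union> Z2"
  have in_closure: "proj_class y \<in> Z1 \<or> proj_class y \<in> Z2" if "y \<in> Y" for y
    using zariski_closure_contains[of y Y] that Y(2) Z by blast
  have key: "\<exists>F. homogeneous_poly F \<and> (\<forall>y\<in>proj_cone Z'. F y = 0) \<and> (\<exists>y\<in>Y. F y \<noteq> 0)"
    if Z': "zariski_closed Z'" "\<not> zariski_closure Y \<subseteq> Z'" for Z' :: "'a proj set"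
  proof -
    obtain q where q: "q \<in> zariski_closure Y" "q \<notin> Z'" using Z'(2) by blast
    obtain z where z: "z \<noteq> 0" "proj_class z = q" using proj_class_surj by blast
    have "proj_class z \<notin> Z'" using q z by simp
    then obtain F where F: "homogeneous_poly F" "\<And>y. y \<in> proj_cone Z' \<Longrightarrow> F y = 0" "F z \<noteq> 0"
      using zariski_closed_nonmember[OF Z'(1) z(1)] by blast
    have "\<exists>y\<in>Y. F y \<noteq> 0"
      using zariski_closure_zero[OF F(1) _ z(1)] q z F(3) by blast
    then show ?thesis using F by blast
  qed
  show "zariski_closure Y \<subseteq> Z1 \<or> zariski_closure Y \<subseteq> Z2"
  proof (rule ccontr)
    assume "\<not> ?thesis"
    then have not_sub: "\<not> zariski_closure Y \<subseteq> Z1" "\<not> zariski_closure Y \<subseteq> Z2" by auto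
    obtain F where F: "homogeneous_poly F" "\<forall>y\<in>proj_cone Z1. F y = 0" "\<exists>y\<in>Y. F y \<noteq> 0"
      using key[OF _ not_sub(1)] Z by auto
    obtain G where G: "homogeneous_poly G" "\<forall>y\<in>proj_cone Z2. G y = 0" "\<exists>y\<in>Y. G y \<noteq> 0"
      using key[OF _ not_sub(2)] Z by auto
    note FG = F G
    have "F y * G y = 0" if y: "y \<in> Y" for y
    proof -
      have "y \<noteq> 0" using y Y(2) by blast
      then have "y \<in> proj_cone Z1 \<or> y \<in> proj_cone Z2"
        using in_closure[OF y] by (simp add: proj_cone_def)
      then show ?thesis using FG by auto
    qed
    then show False using prime[OF FG(1,4)] FG by blast
  qed
qed

text \<open>With \<open>h v\<close> describing \<open>F\<close> on the line through 0 and
  \<open>v\<close>, the coefficient of index \<open>i\<close> is the homogeneous component of degree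
  \<open>i\<close> of \<open>F\<close>.\<close>

lemma homogeneous_coefficient:
  assumes h: "polyfam h" "\<And>v t. F (t *s v) = poly (h v) t"
  shows "homogeneous_poly (\<lambda>v. coeff (h v) i)"
proof -
  have "h (c *s v) = pcompose (h v) [:0, c:]" for c v
  proof -
    have "poly (h (c *s v)) t = poly (pcompose (h v) [:0, c:]) t" for t
      using h(2)[of t "c *s v"] h(2)[of "t * c" v] by (simp add: poly_pcompose)
    then have "poly (h (c *s v)) = poly (pcompose (h v) [:0, c:])" by (rule ext)
    then show ?thesis by (simp only: poly_eq_poly_eq_iff)
  qed
  then have "coeff (h (c *s v)) i = c ^ i * coeff (h v) i" for c v
    by (simp add: coeff_pcompose_linear)
  then show ?thesis using polyfam_coeff[OF h(1)] unfolding homogeneous_poly_def by blast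
qed

text \<open>On the line through a point of the cone the product of two polynomials in one variable
  vanishes, so one of them is zero identically. Irreducibility of \<open>S\<close> concerns sets
  given by homogeneous equations and is applied to components of the factors.\<close>

lemma irreducible_cone_of_variety:
  assumes S: "projective_variety S"
  shows "irreducible_cone (insert 0 (proj_cone S))"
proof
  have closed: "zariski_closed S" using S by (simp add: projective_variety_def)
  obtain q0 where "q0 \<in> S" using S by (auto simp: projective_variety_def)
  moreover obtain z0 where "z0 \<noteq> 0" "proj_class z0 = q0" using proj_class_surj by blast
  ultimately have z0: "z0 \<in> proj_cone S" by (simp add: proj_cone_def)
  then have "z0 \<noteq> 0" by (simp add: proj_cone_def)
  have zero: "F 0 = 0" if "homogeneous_poly F" "F z0 = 0" for F
    using homogeneous_poly_zero_scale[OF that, of 0] by simp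
  show "c *s z \<in> insert 0 (proj_cone S)" if "z \<in> insert 0 (proj_cone S)" for c z
    using that proj_cone_scale[of z S c] by (cases "c = 0") auto
  show "\<exists>z\<in>insert 0 (proj_cone S). z \<noteq> 0" using z0 \<open>z0 \<noteq> 0\<close> by blast
  show "\<exists>F. complex_poly F \<and> (\<forall>y\<in>insert 0 (proj_cone S). F y = 0) \<and> F z \<noteq> 0"
    if "z \<notin> insert 0 (proj_cone S)" for z
  proof -
    have "z \<noteq> 0" "proj_class z \<notin> S" using that by (auto simp: proj_cone_def)
    then obtain F where F: "homogeneous_poly F" "\<And>y. y \<in> proj_cone S \<Longrightarrow> F y = 0" "F z \<noteq> 0"
      using zariski_closed_nonmember[OF closed] by blast
    then show ?thesis using zero[OF F(1) F(2)[OF z0]]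
      by (intro exI[of _ F]) (auto simp: homogeneous_poly_def)
  qed
  fix F G :: "complex ^ 'a \<Rightarrow> complex"
  assume FG: "complex_poly F" "complex_poly G" "\<And>z. z \<in> insert 0 (proj_cone S) \<Longrightarrow> F z * G z = 0"
  obtain f where f: "polyfam f" "\<And>v t. F (t *s v) = poly (f v) t"
    using polyfam_on_line[OF FG(1), of 0] by auto
  obtain g where g: "polyfam g" "\<And>v t. G (t *s v) = poly (g v) t"
    using polyfam_on_line[OF FG(2), of 0] by auto
  have fg: "f z = 0 \<or> g z = 0" if z: "z \<in> proj_cone S" for z
  proof -
    have "poly (f z * g z) t = 0" for t
    proof -
      have "t *s z \<in> insert 0 (proj_cone S)" using z proj_cone_scale[of z S t] by (cases "t = 0") auto
      then show ?thesis using FG(3)[of "t *s z"] f g by simp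
    qed
    then have "poly (f z * g z) = poly 0" by (auto simp: fun_eq_iff)
    then have "f z * g z = 0" by (simp only: poly_eq_poly_eq_iff)
    then show ?thesis by simp
  qed
  text \<open>If neither factor vanished, some homogeneous component of each would not vanish on \<open>S\<close>, while
    every product of components does.\<close>
  show "(\<forall>z\<in>insert 0 (proj_cone S). F z = 0) \<or> (\<forall>z\<in>insert 0 (proj_cone S). G z = 0)"
  proof (rule ccontr)
    have comp: "\<exists>i. \<exists>z\<in>proj_cone S. coeff (h z) i \<noteq> 0"
      if "\<not> (\<forall>z\<in>insert 0 (proj_cone S). H z = 0)" "\<And>v t. H (t *s v) = poly (h v) t"
      for H :: "complex ^ 'a \<Rightarrow> complex" and h
    proof (rule ccontr)
      assume "\<not> ?thesis"
      then have "h z = 0" if "z \<in> proj_cone S" for z using that by (intro poly_eqI) simp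
      then have "H z = 0" "H 0 = 0" if "z \<in> proj_cone S" for z
        using \<open>\<And>v t. H (t *s v) = poly (h v) t\<close>[of 1 z] \<open>\<And>v t. H (t *s v) = poly (h v) t\<close>[of 0 z] that
        by auto
      then show False using that(1) z0 by blast
    qed
    assume "\<not> ?thesis"
    then obtain i j y z where ij: "y \<in> proj_cone S" "coeff (f y) i \<noteq> 0" "z \<in> proj_cone S" "coeff (g z) j \<noteq> 0"
      using comp[OF _ f(2)] comp[OF _ g(2)] by blast
    define V where "V = (\<lambda>F :: complex ^ 'a \<Rightarrow> complex. {p. \<forall>z. z \<noteq> 0 \<and> proj_class z = p \<longrightarrow> F z = 0})"
    have closed_V: "zariski_closed (V F)" if "homogeneous_poly F" for F
      unfolding zariski_closed_def V_def by (rule exI[of _ "{F}"]) (use that in auto)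
    let ?F = "\<lambda>v. coeff (f v) i" and ?G = "\<lambda>v. coeff (g v) j"
    have hom: "homogeneous_poly ?F" "homogeneous_poly ?G"
      using homogeneous_coefficient[OF f] homogeneous_coefficient[OF g] by auto
    have "S \<subseteq> V ?F \<union> V ?G"
    proof
      fix q assume q: "q \<in> S"
      obtain z where z: "z \<noteq> 0" "proj_class z = q" using proj_class_surj by blast
      then have "?F z = 0 \<or> ?G z = 0" using fg[of z] q by (auto simp: proj_cone_def)
      then show "q \<in> V ?F \<union> V ?G"
        using homogeneous_poly_zero_class[OF hom(1) _ z(1)] homogeneous_poly_zero_class[OF hom(2) _ z(1)] z(2)
        by (auto simp: V_def)
    qed
    then have "S \<subseteq> V ?F \<or> S \<subseteq> V ?G"
      using S closed_V[OF hom(1)] closed_V[OF hom(2)] unfolding projective_variety_def by blast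
    then show False using ij by (auto simp: V_def proj_cone_def)
  qed
qed

section \<open>Dimension and smoothness from a retraction\<close>

lemma holomorphic_product_nonzero:
  assumes U: "open U" "connected U" and fg: "f holomorphic_on U" "g holomorphic_on U"
    and zero: "\<And>t. t \<in> U \<Longrightarrow> f t * g t = 0" and t: "t1 \<in> U" "f t1 \<noteq> 0" "t2 \<in> U"
  shows "g t2 = 0"
proof -
  have "open (U \<inter> f -` (- {0}))"
    using continuous_open_preimage[OF holomorphic_on_imp_continuous_on[OF fg(1)] U(1)] by auto
  moreover have "t1 \<in> U \<inter> f -` (- {0})" using t by auto
  ultimately obtain e where e: "e > 0" "ball t1 e \<subseteq> U \<inter> f -` (- {0})"
    using open_contains_ball by blast
  show ?thesis
  proof (rule analytic_continuation[OF fg(2) U, of "ball t1 e" t1])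
    show "t1 islimpt ball t1 e" using e(1) by (simp add: islimpt_ball)
    show "g z = 0" if "z \<in> ball t1 e" for z
    proof -
      have "z \<in> U" "f z \<noteq> 0" using e(2) that by blast+
      then show ?thesis using zero[of z] by simp
    qed
  qed (use e t in auto)
qed

context tangent_projection
begin

text \<open>Linear slices of the tangent space are lifted to \<open>Z\<close> by the local section,
  and their closures form the chain. Irreducibility comes from joining two points of a slice by a
  complex line and the identity theorem on it, strictness from a linear form composed with
  \<open>L\<close>.\<close>

lemma chain_of_slices:
  assumes S: "projective_variety S" "Z = insert 0 (proj_cone S)" and k: "k < vec.dim (range ((*v) D))"
  shows "\<exists>C. (\<forall>i\<le>k. projective_variety (C i) \<and> C i \<subseteq> S) \<and> (\<forall>i<k. C i \<subset> C (Suc i))"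
proof -
  have pD: "p \<in> range ((*v) D)" using D_point by (metis rangeI)
  obtain b where b: "b 0 = p" "\<And>j. j \<le> k \<Longrightarrow> b j \<in> range ((*v) D)"
    "\<And>j. j \<le> k \<Longrightarrow> b j \<notin> vec.span (b ` {..<j})"
    using flag_exists[OF subspace_range_matrix pD p(3) k] by blast
  obtain V \<psi> where V: "holo_map_on V \<psi>" "p \<in> V" "\<And>y. y \<in> V \<Longrightarrow> \<psi> y \<in> Z"
    "\<And>y. y \<in> V \<Longrightarrow> L *v \<psi> y = L *v y" by (rule local_section) blast
  obtain r0 where r0: "r0 > 0" "ball p r0 \<subseteq> V"
    using holo_map_on_open[OF V(1)] V(2) open_contains_ball by blast
  \<comment> \<open>The bound by \<open>norm p\<close> keeps 0 out of the ball, so lifted points are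
    nonzero and define points of projective space.\<close>
  define r where "r = min r0 (norm p)"
  have r: "r > 0" "ball p r \<subseteq> V" "0 \<notin> ball p r" using r0 p(3) by (auto simp: r_def)
  define E where "E = (\<lambda>j. vec.span (b ` {..j}))"
  define B where "B = (\<lambda>j. ball p r \<inter> E j)"
  define C where "C = (\<lambda>j. zariski_closure (\<psi> ` B j))"
  have LE: "L *v y = y" if y: "y \<in> E j" "j \<le> k" for y j
  proof -
    have "E j \<subseteq> range ((*v) D)" unfolding E_def
      by (rule vec.span_minimal) (use b(2) y(2) subspace_range_matrix in auto)
    then have "y \<in> range ((*v) D)" using y(1) by (rule subsetD)
    then obtain x where "y = D *v x" by (rule rangeE)
    then show ?thesis using LD by simp
  qed
  have L\<psi>: "L *v \<psi> y = y" if "y \<in> B j" "j \<le> k" for y j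
    using V(4)[of y] LE[of y j] that r(2) by (auto simp: B_def)
  have nz: "\<psi> y \<noteq> 0" if "y \<in> B j" "j \<le> k" for y j
  proof
    assume "\<psi> y = 0"
    then have "y = 0" using L\<psi>[OF that] by simp
    then show False using that(1) r(3) by (simp add: B_def)
  qed
  have pB: "p \<in> B j" for j
    using r(1) b(1) by (auto simp: B_def E_def intro!: vec.span_base image_eqI[of _ _ 0])
  have incr: "B j \<subseteq> B (Suc j)" for j
  proof -
    have "b ` {..j} \<subseteq> b ` {..Suc j}" by auto
    then have "E j \<subseteq> E (Suc j)" unfolding E_def by (rule vec.span_mono)
    then show ?thesis unfolding B_def by blast
  qed
  have "projective_variety (C j)" if j: "j \<le> k" for j
    unfolding C_def
  proof (rule projective_variety_closure)
    show "\<psi> p \<in> \<psi> ` B j" using pB by blast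
    show "0 \<notin> \<psi> ` B j" using nz[OF _ j] by auto
    fix F G assume FG: "homogeneous_poly F" "homogeneous_poly G" "\<And>y. y \<in> \<psi> ` B j \<Longrightarrow> F y * G y = 0"
    show "(\<forall>y\<in>\<psi> ` B j. F y = 0) \<or> (\<forall>y\<in>\<psi> ` B j. G y = 0)"
    proof (rule ccontr)
      assume "\<not> ?thesis"
      then obtain y1 y2 where y: "y1 \<in> B j" "F (\<psi> y1) \<noteq> 0" "y2 \<in> B j" "G (\<psi> y2) \<noteq> 0" by blast
      define v where "v = y2 - y1"
      define U where "U = (\<lambda>t. y1 + t *s v) -` ball p r"
      have lin: "bounded_linear (\<lambda>t :: complex. t *s v)"
        unfolding linear_conv_bounded_linear[symmetric]
        by (rule linearI) (simp_all add: vec_eq_iff algebra_simps)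
      have "open U" unfolding U_def
        by (intro open_vimage open_ball continuous_on_add continuous_on_const linear_continuous_on lin)
      moreover have "convex U"
      proof -
        have "U = (\<lambda>t. t *s v) -` ((\<lambda>x. x - y1) ` ball p r)"
          unfolding U_def by (auto simp: image_iff algebra_simps intro!: exI bexI)
        moreover have "convex ((\<lambda>t. t *s v) -` ((\<lambda>x. x - y1) ` ball p r))"
          using lin by (intro convex_linear_vimage convex_translation_subtract convex_ball)
            (simp add: linear_conv_bounded_linear)
        ultimately show ?thesis by simp
      qed
      then have "connected U" by (rule convex_connected)
      have line: "y1 + t *s v \<in> B j" if "t \<in> U" for t
      proof -
        have "y1 \<in> E j" "y2 \<in> E j" using y by (auto simp: B_def)
        then have "y1 + t *s v \<in> E j"
          unfolding v_def E_def by (intro vec.span_add vec.span_scale vec.span_diff)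
        then show ?thesis using that by (simp add: B_def U_def)
      qed
      have BV: "B j \<subseteq> V" using r(2) by (auto simp: B_def)
      have hol: "(\<lambda>t. H (\<psi> (y1 + t *s v))) holomorphic_on U" if "homogeneous_poly H" for H
      proof -
        have "holo_fun_on V (\<lambda>y. H (\<psi> y))"
          using that V(1) by (intro holo_map_on_complex_poly) (auto simp: homogeneous_poly_def)
        then show ?thesis using line BV \<open>open U\<close> by (intro holo_fun_on_line) auto
      qed
      have "G (\<psi> (y1 + 1 *s v)) = 0"
      proof (rule holomorphic_product_nonzero[OF \<open>open U\<close> \<open>connected U\<close> hol[OF FG(1)] hol[OF FG(2)]])
        show "F (\<psi> (y1 + t *s v)) * G (\<psi> (y1 + t *s v)) = 0" if "t \<in> U" for t
          using FG(3) line[OF that] by blast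
        show "0 \<in> U" "1 \<in> U" using y by (auto simp: U_def v_def B_def)
        show "F (\<psi> (y1 + 0 *s v)) \<noteq> 0" using y by simp
      qed
      then show False using y(4) by (simp add: v_def)
    qed
  qed
  moreover have "C j \<subseteq> S" if j: "j \<le> k" for j
    unfolding C_def
  proof (rule zariski_closure_subset)
    show "zariski_closed S" using S by (simp add: projective_variety_def)
    have "\<psi> y \<in> proj_cone S" if y: "y \<in> B j" for y
    proof -
      have "y \<in> V" using y r(2) by (auto simp: B_def)
      then have "\<psi> y \<in> insert 0 (proj_cone S)" using V(3) S(2) by simp
      then show ?thesis using nz[OF y j] by simp
    qed
    then show "\<psi> ` B j \<subseteq> proj_cone S" by blast
  qed
  moreover have "C j \<subset> C (Suc j)" if j: "j < k" for j
  proof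
    show "C j \<subseteq> C (Suc j)" unfolding C_def using incr by (intro zariski_closure_mono image_mono)
    have jk: "j \<le> k" "Suc j \<le> k" using j by auto
    have "b (Suc j) \<notin> E j" using b(3)[OF jk(2)] by (simp add: E_def lessThan_Suc_atMost)
    then obtain u where u: "\<And>w. w \<in> E j \<Longrightarrow> dotc u w = 0" "dotc u (b (Suc j)) = 1"
      using separating_functional[OF vec.subspace_span] unfolding E_def by blast
    define F where "F = (\<lambda>z. dotc u (L *v z))"
    have F: "homogeneous_poly F"
      unfolding homogeneous_poly_def F_def
      by (intro conjI complex_poly_compose_matrix complex_poly_dotc exI[of _ 1])
        (simp add: vector_scalar_commute)
    have Fz: "F y = 0" if y: "y \<in> \<psi> ` B j" for y
    proof -
      obtain x where x: "x \<in> B j" "y = \<psi> x" using y by blast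
      then show ?thesis using L\<psi>[OF x(1) jk(1)] u(1)[of x] by (simp add: F_def B_def)
    qed
    define e where "e = r / (2 * norm (b (Suc j)))"
    have bn: "norm (b (Suc j)) > 0" using u(2) by auto
    then have e: "e > 0" using r by (simp add: e_def)
    define y where "y = p + of_real e *s b (Suc j)"
    have "p \<in> E (Suc j)" "b (Suc j) \<in> E (Suc j)" "p \<in> E j"
      using pB[of "Suc j"] pB[of j] by (auto simp: B_def E_def intro!: vec.span_base)
    then have "y \<in> E (Suc j)" unfolding y_def E_def by (intro vec.span_add vec.span_scale)
    moreover have "dist p y = e * norm (b (Suc j))"
      using e by (simp add: y_def dist_norm norm_vector_scale)
    then have "dist p y < r" using bn r by (simp add: e_def)
    ultimately have yB: "y \<in> B (Suc j)" by (simp add: B_def)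
    have "F (\<psi> y) = of_real e"
      using L\<psi>[OF yB jk(2)] u(1)[OF \<open>p \<in> E j\<close>] u(2) by (simp add: F_def y_def)
    then have "F (\<psi> y) \<noteq> 0" using e by simp
    then have "proj_class (\<psi> y) \<notin> C j"
      unfolding C_def using zariski_closure_zero[OF F Fz nz[OF yB jk(2)]] by blast
    moreover have "proj_class (\<psi> y) \<in> C (Suc j)"
      unfolding C_def using yB nz[OF yB jk(2)] by (intro zariski_closure_contains) auto
    ultimately show "C j \<noteq> C (Suc j)" by blast
  qed
  ultimately show ?thesis by blast
qed

text \<open>A chain of length \<open>n\<close> has \<open>n + 1\<close> members, and the cone over a
  point already has dimension one; this accounts for the strict inequality.\<close>

lemma chain_bound:
  assumes S: "Z = insert 0 (proj_cone S)"
    and C: "\<And>i. i \<le> n \<Longrightarrow> projective_variety (C i) \<and> C i \<subseteq> S" "\<And>i. i < n \<Longrightarrow> C i \<subset> C (Suc i)"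
  shows "n < vec.dim (range ((*v) D))"
proof -
  let ?K = "\<lambda>i. insert 0 (proj_cone (C i))"
  have cone: "irreducible_cone (?K i)" if "i \<le> n" for i
    using C(1)[OF that] by (intro irreducible_cone_of_variety) simp
  have "n < vec.dim (range ((*v) L))"
  proof (rule chain_length_bound[of n ?K])
    show "irreducible_cone (?K i)" if "i \<le> n" for i using cone that .
    show "?K i \<subset> ?K (Suc i)" if i: "i < n" for i
    proof -
      obtain q where q: "q \<in> C (Suc i)" "q \<notin> C i" using C(2)[OF i] by blast
      obtain z where z: "z \<noteq> 0" "proj_class z = q" using proj_class_surj by blast
      have "z \<in> ?K (Suc i)" "z \<notin> ?K i" using q z by (auto simp: proj_cone_def)
      moreover have "?K i \<subseteq> ?K (Suc i)" using C(2)[OF i] by (auto simp: proj_cone_def)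
      ultimately show ?thesis by blast
    qed
    have "?K n \<subseteq> Z" using C(1)[of n] S by (auto simp: proj_cone_def)
    from finite_projection_subset[OF finite_projection_axioms cone[OF order_refl] this]
    show "finite_projection (?K n) L" .
  qed
  then show ?thesis by (simp add: range_eq)
qed

lemma variety_dim_eq:
  assumes S: "projective_variety S" "Z = insert 0 (proj_cone S)"
  shows "Suc (variety_dim S) = vec.dim (range ((*v) D))"
proof -
  let ?\<kappa> = "vec.dim (range ((*v) D))"
  have "\<not> range ((*v) D) \<subseteq> {0}" using D_point p(3) by (metis rangeI singletonD subsetD)
  then have "?\<kappa> \<noteq> 0" unfolding vec.dim_eq_0 .
  then have \<kappa>: "?\<kappa> - 1 < ?\<kappa>" by (metis diff_less neq0_conv zero_less_one)
  have "variety_dim S = ?\<kappa> - 1"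
    unfolding variety_dim_def
  proof (rule Greatest_equality)
    show "\<exists>C. (\<forall>i\<le>?\<kappa> - 1. projective_variety (C i) \<and> C i \<subseteq> S) \<and> (\<forall>i<?\<kappa> - 1. C i \<subset> C (Suc i))"
      by (rule chain_of_slices[OF S \<kappa>])
    fix n assume "\<exists>C. (\<forall>i\<le>n. projective_variety (C i) \<and> C i \<subseteq> S) \<and> (\<forall>i<n. C i \<subset> C (Suc i))"
    then have "n < ?\<kappa>" using chain_bound[OF S(2), of n] by blast
    then show "n \<le> ?\<kappa> - 1" by simp
  qed
  then show ?thesis using \<kappa> by simp
qed

text \<open>The chart is the slice of the cone by \<open>z $ i = 1\<close>, a hyperplane transversal
  to the cone at \<open>p\<close>, so its tangent space is cut out by \<open>v $ i = 0\<close> in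
  that of the cone.\<close>

lemma annihilator_of_gradients:
  assumes S: "Z = insert 0 (proj_cone S)" and i: "p $ i = 1"
  shows "annihilator ((\<lambda>F. gradient F p) ` vanishing_ideal (affine_part i S)) =
    {v \<in> range ((*v) D). dotc (axis i 1) v = 0}" (is "annihilator ?G = ?T")
proof (intro subset_antisym subsetI)
  have affine: "affine_part i S = {x \<in> Z. x $ i = 1}"
    unfolding S affine_part_def proj_cone_def by auto
  {
    fix v assume v: "v \<in> annihilator ?G"
    have "complex_poly (\<lambda>z. z $ i - 1)" by (intro complex_poly_diff complex_poly.intros)
    moreover from this have "(\<lambda>z. z $ i - 1) \<in> vanishing_ideal (affine_part i S)"
      by (auto simp: vanishing_ideal_def affine)
    ultimately have "((\<lambda>t. (p + t *s v) $ i - 1) has_field_derivative 0) (at 0)"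
      using complex_poly_line_derivative[of "\<lambda>z. z $ i - 1" p v] v by (auto simp: annihilator_def)
    moreover have "((\<lambda>t. (p + t *s v) $ i - 1) has_field_derivative v $ i) (at 0)"
      by (auto intro!: derivative_eq_intros)
    ultimately have "v $ i = 0" using DERIV_unique by blast
    moreover have "D *v v = v"
    proof (rule zariski_tangent_space)
      fix F assume "F \<in> vanishing_ideal Z"
      then have "F \<in> vanishing_ideal (affine_part i S)" by (auto simp: vanishing_ideal_def affine)
      then show "dotc (gradient F p) v = 0" using v by (auto simp: annihilator_def)
    qed
    then have "v \<in> range ((*v) D)" by (metis rangeI)
    ultimately show "v \<in> ?T" by simp
  }
  fix v assume "v \<in> ?T"
  then obtain w where v: "v = D *v w" and vi: "v $ i = 0" by auto
  have "dotc (gradient F p) v = 0" if F: "F \<in> vanishing_ideal (affine_part i S)" for F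
  proof -
    have cF: "complex_poly F" "\<And>y. y \<in> Z \<Longrightarrow> y $ i = 1 \<Longrightarrow> F y = 0"
      using F by (auto simp: vanishing_ideal_def affine)
    text \<open>Homogenizing \<open>F\<close> does not change it on the hyperplane \<open>z $ i = 1\<close>; the extra factor
      \<open>z $ i\<close> makes the result vanish on all of \<open>Z\<close>.\<close>
    obtain N H where H: "mspan {\<alpha>. expo_deg \<alpha> = N} H"
      "\<And>z. z $ i \<noteq> 0 \<Longrightarrow> z $ i ^ N * F (inverse (z $ i) *s z) = H z"
      using homogenize[OF cF(1), of i] by blast
    define G where "G = (\<lambda>z. z $ i * H z)"
    have cG: "complex_poly G"
      unfolding G_def by (intro complex_poly.intros complex_poly_mspan[OF H(1)])
    have "G z = 0" if z: "z \<in> Z" for z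
    proof (cases "z $ i = 0")
      case False
      have "F (inverse (z $ i) *s z) = 0"
        using False by (intro cF(2) scale_closed z) simp
      then show ?thesis using H(2)[OF False] by (simp add: G_def)
    qed (simp add: G_def)
    then have "G \<in> vanishing_ideal Z" using cG by (simp add: vanishing_ideal_def)
    then have "dotc (gradient G p) v = 0" using gradient_vanishes_on_tangent v by simp
    then have 1: "((\<lambda>t. G (p + t *s v)) has_field_derivative 0) (at 0)"
      using complex_poly_line_derivative[OF cG, of p v] by simp
    have "G (p + t *s v) = F (p + t *s v)" for t
      using H(2)[of "p + t *s v"] i vi by (simp add: G_def)
    then have "((\<lambda>t. F (p + t *s v)) has_field_derivative 0) (at 0)" using 1 by simp
    from DERIV_unique[OF complex_poly_line_derivative[OF cF(1)] this] show ?thesis .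
  qed
  then show "v \<in> annihilator ?G" by (auto simp: annihilator_def)
qed

text \<open>The gradients and their annihilator have complementary dimensions. The annihilator is a
  hyperplane in the range of \<open>D\<close>, proper because \<open>p\<close> is in that range with
  \<open>p $ i = 1\<close>, and the lost dimension is the shift between \<open>S\<close> and its
  cone.\<close>

lemma jacobian_rank:
  assumes S: "projective_variety S" "Z = insert 0 (proj_cone S)" and i: "p $ i = 1"
  shows "vec.dim ((\<lambda>F. gradient F p) ` vanishing_ideal (affine_part i S)) + variety_dim S = CARD('m)"
proof -
  let ?G = "(\<lambda>F. gradient F p) ` vanishing_ideal (affine_part i S)"
  have "p \<in> range ((*v) D)" using D_point by (metis rangeI)
  then have "vec.dim (range ((*v) D)) = Suc (vec.dim {v \<in> range ((*v) D). dotc (axis i 1) v = 0})"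
    using i by (intro dim_kernel_functional[OF subspace_range_matrix]) auto
  then have "vec.dim (annihilator ?G) = variety_dim S"
    using variety_dim_eq[OF S] annihilator_of_gradients[OF S(2) i] by simp
  then show ?thesis using dim_annihilator[of ?G] by simp
qed

end

theorem jacobian_criterion_of_retraction:
  fixes S :: "('m::finite) proj set"
  assumes S: "projective_variety S" and pS: "p \<in> proj_cone S" "p $ i = 1"
    and \<rho>: "holo_map_on \<Omega> \<rho>" "p \<in> \<Omega>"
      "\<And>z. z \<in> \<Omega> \<Longrightarrow> \<rho> z \<in> insert 0 (proj_cone S)"
      "\<And>z. z \<in> \<Omega> \<Longrightarrow> z \<in> proj_cone S \<Longrightarrow> \<rho> z = z"
  shows "vec.dim ((\<lambda>F. gradient F p) ` vanishing_ideal (affine_part i S)) + variety_dim S = CARD('m)"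
proof -
  define Z where "Z = insert 0 (proj_cone S)"
  interpret irreducible_cone Z unfolding Z_def using S by (rule irreducible_cone_of_variety)
  have p0: "p \<noteq> 0" using pS(1) by (simp add: proj_cone_def)
  obtain \<rho>' where \<rho>': "(\<rho> has_derivative \<rho>') (at p)" "\<And>c v. \<rho>' (c *s v) = c *s \<rho>' v"
    using \<rho>(1,2) unfolding holo_map_on_iff by blast
  obtain D where D: "\<rho>' = (*v) D"
    using matrix_of_complex_linear[OF linear_add[OF has_derivative_linear[OF \<rho>'(1)]] \<rho>'(2)] by blast
  \<comment> \<open>The vertex is removed because \<rho> is known to fix only nonzero points of the
    cone.\<close>
  define \<Omega>' where "\<Omega>' = \<Omega> - {0}"
  have "open \<Omega>'" unfolding \<Omega>'_def using holo_map_on_open[OF \<rho>(1)] by (rule open_delete)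
  then have "holo_map_on \<Omega>' \<rho>"
    by (rule holo_map_on_subset[OF \<rho>(1)]) (auto simp: \<Omega>'_def)
  interpret cone_retraction Z \<Omega>' \<rho> p D
    by unfold_locales (use \<open>holo_map_on \<Omega>' \<rho>\<close> pS p0 \<rho> \<rho>'(1) D in \<open>auto simp: Z_def \<Omega>'_def\<close>)
  obtain L where L: "finite_projection Z L" "\<And>x. L *v (L *v x) = L *v x"
    "\<And>x. L *v (D *v x) = D *v x" "\<And>x. D *v (L *v x) = L *v x" by (rule good_projection) blast
  interpret L: finite_projection Z L by (rule L(1))
  interpret tangent_projection Z \<Omega>' \<rho> p D L
    by unfold_locales (use L in auto)
  show ?thesis by (rule jacobian_rank[OF S Z_def pS(2)])
qed

section \<open>Retractions from local sections\<close>

lemma holo_fun_on_mult: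
  assumes "holo_fun_on W f" "holo_fun_on W g"
  shows "holo_fun_on W (\<lambda>z. f z * g z)"
  unfolding holo_fun_on_iff
proof (intro conjI ballI)
  show "open W" using assms(1) by (simp add: holo_fun_on_def)
  fix z assume z: "z \<in> W"
  obtain f' where f': "(f has_derivative f') (at z)" "\<And>c v. f' (c *s v) = c * f' v"
    using assms(1) z unfolding holo_fun_on_iff by blast
  obtain g' where g': "(g has_derivative g') (at z)" "\<And>c v. g' (c *s v) = c * g' v"
    using assms(2) z unfolding holo_fun_on_iff by blast
  show "\<exists>h'. ((\<lambda>z. f z * g z) has_derivative h') (at z) \<and> (\<forall>c v. h' (c *s v) = c * h' v)"
    by (rule exI, rule conjI, rule has_derivative_mult[OF f'(1) g'(1)])
      (simp add: f'(2) g'(2) algebra_simps)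
qed

lemma holo_fun_on_inverse:
  assumes "holo_fun_on W g" "\<And>z. z \<in> W \<Longrightarrow> g z \<noteq> 0"
  shows "holo_fun_on W (\<lambda>z. inverse (g z))"
  unfolding holo_fun_on_iff
proof (intro conjI ballI)
  show "open W" using assms(1) by (simp add: holo_fun_on_def)
  fix z assume z: "z \<in> W"
  obtain g' where g': "(g has_derivative g') (at z)" "\<And>c v. g' (c *s v) = c * g' v"
    using assms(1) z unfolding holo_fun_on_iff by blast
  show "\<exists>h'. ((\<lambda>z. inverse (g z)) has_derivative h') (at z) \<and> (\<forall>c v. h' (c *s v) = c * h' v)"
    by (rule exI, rule conjI, rule Deriv.has_derivative_inverse[OF assms(2)[OF z] g'(1)])
      (simp add: g'(2) algebra_simps)
qed

lemma holo_map_on_preimage: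
  assumes "holo_map_on W g" "open U"
  shows "open {z \<in> W. g z \<in> U}"
proof -
  have "open (W \<inter> g -` U)"
    using continuous_open_preimage[OF holo_map_on_continuous holo_map_on_open] assms by blast
  then show ?thesis by (simp add: vimage_def Int_def)
qed

text \<open>On the cone the composite of the section with a homogeneous lift of \<open>f\<close> is the identity only up to
  a scalar, which is normalized away by the \<open>i\<close>-th coordinate.\<close>

lemma retraction_of_section:
  fixes T :: "'a topology" and A :: "('a, 'd::finite) chart set" and f :: "'a \<Rightarrow> ('m::finite) proj"
  assumes M: "complex_manifold T A" and f: "holomorphic_to_proj T A f" "f ` topspace T = S"
    and sec: "has_local_sections A f S (proj_class p)" and p: "p \<in> proj_cone S" "p $ i = 1"
  obtains \<Omega> \<rho> where "holo_map_on \<Omega> \<rho>" "p \<in> \<Omega>"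
    "\<And>z. z \<in> \<Omega> \<Longrightarrow> \<rho> z \<in> insert 0 (proj_cone S)"
    "\<And>z. z \<in> \<Omega> \<Longrightarrow> z \<in> proj_cone S \<Longrightarrow> \<rho> z = z"
proof -
  define s where "s = proj_class p"
  have p0: "p \<noteq> 0" and sS: "s \<in> S" using p(1) by (auto simp: proj_cone_def s_def)
  have charts: "openin T (fst c)" "inj_on (snd c) (fst c)" if "c \<in> A" for c
  proof -
    have hom: "openin T (fst c)"
      "homeomorphic_map (subtopology T (fst c)) (top_of_set (chart_image c)) (snd c)"
      using M that by (auto simp: complex_manifold_def)
    show "openin T (fst c)" by (rule hom(1))
    have "topspace (subtopology T (fst c)) = fst c"
      using openin_subset[OF hom(1)] by (auto simp: topspace_subtopology)
    then show "inj_on (snd c) (fst c)"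
      using homeomorphic_imp_injective_map[OF hom(2)] by simp
  qed
  have param: "chart_param c (snd c x) = x" if "c \<in> A" "x \<in> fst c" for c x
    unfolding chart_param_def using charts(2)[OF that(1)] that(2) by (rule inv_into_f_f)
  have param_in: "chart_param c z \<in> topspace T" if "c \<in> A" "z \<in> chart_image c" for c z
    using that openin_subset[OF charts(1)[OF that(1)]] param[OF that(1)] by (auto simp: chart_image_def)
  obtain V \<sigma> where V: "openin (top_of_set S) V" "s \<in> V" "holomorphic_from_proj A V \<sigma>"
    "\<And>q. q \<in> V \<Longrightarrow> f (\<sigma> q) = q"
    using sec unfolding has_local_sections_def s_def by blast
  obtain V0 where V0: "open V0" "V = S \<inter> V0" using V(1) by (auto simp: openin_open)
  obtain c W G where G: "c \<in> A" "open W" "s \<in> W" "holo_map_on (proj_cone W) (\<lambda>z. G (proj_class z))"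
    "\<And>q. q \<in> V \<Longrightarrow> q \<in> W \<Longrightarrow> \<sigma> q \<in> fst c \<and> snd c (\<sigma> q) = G q"
    using V(2,3) unfolding holomorphic_from_proj_def by blast
  have \<sigma>s: "\<sigma> s \<in> fst c" "snd c (\<sigma> s) = G s" using G(5)[OF V(2) G(3)] by auto
  then have "\<sigma> s \<in> topspace T" using openin_subset[OF charts(1)[OF G(1)]] by blast
  then obtain c' W' F where F: "c' \<in> A" "\<sigma> s \<in> fst c'" "snd c' (\<sigma> s) \<in> W'" "local_lift c' W' F f"
    using f(1) unfolding holomorphic_to_proj_def by blast
  have F': "W' \<subseteq> chart_image c'" "holo_map_on W' F" "\<And>z. z \<in> W' \<Longrightarrow> F z \<noteq> 0"
    "\<And>z. z \<in> W' \<Longrightarrow> f (chart_param c' z) = proj_class (F z)"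
    using F(4) by (auto simp: local_lift_def)
  \<comment> \<open>\<Gamma> is the ambient extension of the section in the chart \<open>c\<close>;
    the transition \<tau> is required because the lift \<open>F\<close> of \<open>f\<close> is
    expressed in the chart \<open>c'\<close>.\<close>
  define \<Gamma> where "\<Gamma> = (\<lambda>z. G (proj_class z))"
  define \<tau> where "\<tau> = transition c c'"
  have h\<tau>: "holo_map_on (overlap c c') \<tau>" using M G(1) F(1) by (auto simp: complex_manifold_def \<tau>_def)
  have \<tau>: "\<tau> (snd c x) = snd c' x" if "x \<in> fst c" for x
    using param[OF G(1) that] by (simp add: \<tau>_def transition_def)
  define \<Omega>1 where "\<Omega>1 = {z \<in> proj_cone W. \<Gamma> z \<in> overlap c c'}"
  have h\<Gamma>: "holo_map_on \<Omega>1 \<Gamma>"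
    unfolding \<Omega>1_def \<Gamma>_def
    by (intro holo_map_on_subset[OF G(4)] holo_map_on_preimage[OF G(4)] holo_map_on_open[OF h\<tau>]) auto
  have h1: "holo_map_on \<Omega>1 (\<lambda>z. \<tau> (\<Gamma> z))"
    by (rule holo_map_on_compose[OF h\<Gamma> h\<tau>]) (auto simp: \<Omega>1_def)
  define \<Omega>2 where "\<Omega>2 = {z \<in> \<Omega>1. \<tau> (\<Gamma> z) \<in> W'}"
  have "holo_map_on \<Omega>2 (\<lambda>z. \<tau> (\<Gamma> z))"
    unfolding \<Omega>2_def
    by (intro holo_map_on_subset[OF h1] holo_map_on_preimage[OF h1] holo_map_on_open[OF F'(2)]) auto
  then have h2: "holo_map_on \<Omega>2 (\<lambda>z. F (\<tau> (\<Gamma> z)))"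
    by (rule holo_map_on_compose[OF _ F'(2)]) (auto simp: \<Omega>2_def)
  define N where "N = (\<lambda>z. F (\<tau> (\<Gamma> z)))"
  \<comment> \<open>The coordinate condition permits the normalization, and the intersection with
    \<open>proj_cone V0\<close> ensures that points of \<open>S\<close> met here lie in the domain
    \<open>V\<close> of the section.\<close>
  define \<Omega> where "\<Omega> = {z \<in> \<Omega>2. N z \<in> {w. w $ i \<noteq> 0}} \<inter> proj_cone V0"
  have "open {w :: complex ^ 'm. w $ i \<noteq> 0}" by (intro open_Collect_neq continuous_intros)
  then have "open {z \<in> \<Omega>2. N z \<in> {w. w $ i \<noteq> 0}}"
    unfolding N_def by (rule holo_map_on_preimage[OF h2])
  moreover have "open (proj_cone V0)" using V0(1) by (simp add: open_proj_def)
  ultimately have "open \<Omega>" unfolding \<Omega>_def by (rule open_Int)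
  then have hN: "holo_map_on \<Omega> N"
    unfolding N_def using h2 by (elim holo_map_on_subset) (auto simp: \<Omega>_def)
  define \<rho> where "\<rho> = (\<lambda>z. (z $ i * inverse (N z $ i)) *s N z)"
  have N: "N z $ i \<noteq> 0" if "z \<in> \<Omega>" for z using that by (simp add: \<Omega>_def)
  show thesis
  proof (rule that)
    have id: "holo_map_on \<Omega> (\<lambda>z :: complex ^ 'm. z)"
      unfolding holo_map_on_iff using \<open>open \<Omega>\<close> by (auto intro!: exI[of _ "\<lambda>v. v"])
    have h: "holo_fun_on \<Omega> (\<lambda>z. z $ i * inverse (N z $ i))"
      using id hN N by (intro holo_fun_on_mult holo_fun_on_inverse) (auto simp: holo_map_on_def)
    have "holo_fun_on \<Omega> (\<lambda>z. (z $ i * inverse (N z $ i)) * N z $ k)" for k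
      by (rule holo_fun_on_mult[OF h]) (use hN in \<open>simp add: holo_map_on_def\<close>)
    then show "holo_map_on \<Omega> \<rho>" by (simp add: \<rho>_def holo_map_on_def)
    have \<Gamma>p: "\<Gamma> p = snd c (\<sigma> s)" using \<sigma>s by (simp add: \<Gamma>_def s_def)
    then have \<tau>p: "\<tau> (\<Gamma> p) = snd c' (\<sigma> s)" by (simp only: \<tau>[OF \<sigma>s(1)])
    have "\<Gamma> p \<in> overlap c c'" unfolding overlap_def using \<Gamma>p \<sigma>s(1) F(2) by (intro image_eqI) auto
    moreover have "f (\<sigma> s) = proj_class (N p)"
      using F'(4)[OF F(3)] param[OF F(1,2)] by (simp add: N_def \<tau>p)
    then have "proj_class p = proj_class (N p)" using V(4)[OF V(2)] by (simp add: s_def)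
    then obtain a where "a \<noteq> 0" "N p = a *s p"
      using proj_class_eq_iff[OF p0, of "N p"] F'(3)[OF F(3)] by (auto simp: N_def \<tau>p)
    then have "N p $ i \<noteq> 0" using p(2) by simp
    ultimately show "p \<in> \<Omega>"
      using p0 G(3) V(2) V0(2) F(3) by (simp add: \<tau>p \<Omega>_def \<Omega>2_def \<Omega>1_def proj_cone_def s_def)
    fix z assume z: "z \<in> \<Omega>"
    have zW': "\<tau> (\<Gamma> z) \<in> W'" using z by (simp add: \<Omega>_def \<Omega>2_def)
    \<comment> \<open>Even off the cone, \<open>N z\<close> is a lift of the value of
      \<open>f\<close> at some point of the manifold, and \<open>f\<close> takes values in
      \<open>S\<close>. So \<rho> lands in the cone although \<Gamma> comes from a section only over
      \<open>S\<close>. The value 0 occurs when \<open>z $ i = 0\<close>.\<close>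
    have "chart_param c' (\<tau> (\<Gamma> z)) \<in> topspace T"
      using param_in[OF F(1)] F'(1) zW' by blast
    then have "f (chart_param c' (\<tau> (\<Gamma> z))) \<in> S" using f(2) by blast
    then have "proj_class (N z) \<in> S" using F'(4)[OF zW'] by (simp add: N_def)
    then have "N z \<in> proj_cone S" using F'(3)[OF zW'] by (simp add: proj_cone_def N_def)
    then show "\<rho> z \<in> insert 0 (proj_cone S)"
      using proj_cone_scale[of "N z" S] by (cases "z $ i = 0") (auto simp: \<rho>_def N[OF z])
    assume zS: "z \<in> proj_cone S"
    define q where "q = proj_class z"
    have z0: "z \<noteq> 0" using zS by (simp add: proj_cone_def)
    have q: "q \<in> V" "q \<in> W" using z zS V0(2) by (auto simp: q_def \<Omega>_def \<Omega>2_def \<Omega>1_def proj_cone_def)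
    have \<sigma>q: "\<sigma> q \<in> fst c" "snd c (\<sigma> q) = \<Gamma> z" using G(5)[OF q] by (auto simp: \<Gamma>_def q_def)
    have "\<Gamma> z \<in> overlap c c'" using z by (simp add: \<Omega>_def \<Omega>2_def \<Omega>1_def)
    \<comment> \<open>Only for points of the cone is \<Gamma> tied to \<sigma>. Injectivity of the
      chart then shows that \<open>\<sigma> q\<close> lies in the second chart domain as
      well.\<close>
    then obtain x where x: "x \<in> fst c" "x \<in> fst c'" "\<Gamma> z = snd c x" by (auto simp: overlap_def)
    have "\<sigma> q = x" using inj_onD[OF charts(2)[OF G(1)]] \<sigma>q x by simp
    then have "\<tau> (\<Gamma> z) = snd c' (\<sigma> q)" "\<sigma> q \<in> fst c'" using \<tau>[OF x(1)] x by auto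
    then have "proj_class (N z) = q"
      using F'(4)[OF zW'] param[OF F(1)] V(4)[OF q(1)] by (simp add: N_def)
    then obtain a where a: "a \<noteq> 0" "N z = a *s z"
      using proj_class_eq_iff[OF z0, of "N z"] F'(3)[OF zW'] by (auto simp: N_def q_def)
    then show "\<rho> z = z" using N[OF z] by (simp add: \<rho>_def vec_eq_iff field_simps)
  qed
qed

theorem mainTheorem1:
  fixes T :: "'a topology"
    and A :: "('a, 'd::finite) chart set"
    and \<Psi> :: "('a, 'd, complex) form2"
    and j :: "'a \<Rightarrow> ('n::finite) proj"
    and S :: "('m::finite) proj set"
    and f :: "'a \<Rightarrow> 'm proj"
    and s :: "'m proj"
  assumes "irreducible_symplectic T A \<Psi>"
    and "projective_embedding T A j"
    and "projective_variety S"
    and "lagrangian_fibration T A \<Psi> f S"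
    and "s \<in> S"
    and "has_local_sections A f S s"
  shows "smooth_at S s"
  unfolding smooth_at_def
proof (intro conjI allI ballI impI)
  show "s \<in> S" by fact
  fix i x assume x: "x \<in> affine_part i S" "proj_class x = s"
  have M: "complex_manifold T A" using assms(1) by (simp add: irreducible_symplectic_def)
  have f: "holomorphic_to_proj T A f" "f ` topspace T = S"
    using assms(4) by (auto simp: lagrangian_fibration_def)
  have xi: "x $ i = 1" and "x \<noteq> 0" using x(1) by (auto simp: affine_part_def)
  then have xS: "x \<in> proj_cone S" using x \<open>s \<in> S\<close> by (simp add: proj_cone_def)
  have "has_local_sections A f S (proj_class x)" using assms(6) x(2) by simp
  from retraction_of_section[OF M f this xS xi] obtain \<Omega> \<rho> where \<rho>: "holo_map_on \<Omega> \<rho>" "x \<in> \<Omega>"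
    "\<And>z. z \<in> \<Omega> \<Longrightarrow> \<rho> z \<in> insert 0 (proj_cone S)"
    "\<And>z. z \<in> \<Omega> \<Longrightarrow> z \<in> proj_cone S \<Longrightarrow> \<rho> z = z" by blast
  show "vec.dim ((\<lambda>F. gradient F x) ` vanishing_ideal (affine_part i S)) + variety_dim S = CARD('m)"
    by (rule jacobian_criterion_of_retraction[OF assms(3) xS xi \<rho>])
qed

end
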